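(* Let $R>0$ and let $G$ be a domain in $R\mathbb{D}\times\mathbb{C}^{n-1}\subset\mathbb{C}^n$. Suppose that $r>0$ and that there exists a $C^1$-diffeomorphism $\Phi:r\mathbb{B}^n\to G$ with $\Phi^*\omega=\omega$. Then $r\le R$.
   Context: $\mathbb{D}$ is the open unit disc in $\mathbb{C}$, $R\mathbb{D}=\{z\in\mathbb{C}:|z|<R\}$; $\mathbb{B}^n$ is the open Euclidean unit ball in $\mathbb{C}^n$ and $r\mathbb{B}^n$ is the ball of radius $r$ centered at $0$. The form $\omega=\sum_{j=1}^n dx_j\wedge dy_j=\frac{i}{2}\sum_{j=1}^n dZ_j\wedge d\overline{Z_j}$ is the standard symplectic form on $\mathbb{C}^n$ with coordinates $Z_j=x_j+iy_j$. *)

theory Defs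
  imports "HOL-Analysis.Analysis"
begin

text \<open>A differential 1-form (2-form) on \<open>'a\<close> takes a point followed by one (two) tangent
  vectors. The space of \<open>n\<close> complex variables is \<open>complex ^ 'n\<close> with \<open>n = CARD('n)\<close>; its library
  norm is the Euclidean norm, so \<open>ball 0 r\<close> is the Euclidean ball of radius \<open>r\<close>, and its
  derivatives (\<open>has_derivative\<close>) are real-linear.\<close>

type_synonym 'a form1 = "'a \<Rightarrow> 'a \<Rightarrow> real"
type_synonym 'a form2 = "'a \<Rightarrow> 'a \<Rightarrow> 'a \<Rightarrow> real"

definition wedge :: "'a form1 \<Rightarrow> 'a form1 \<Rightarrow> 'a form2"  (infixl \<open>\<and>\<^sub>d\<close> 70) where
  "(\<alpha> \<and>\<^sub>d \<beta>) p u v = \<alpha> p u * \<beta> p v - \<alpha> p v * \<beta> p u"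

definition dx :: "'n::finite \<Rightarrow> (complex ^ 'n) form1" where
  "dx j p u = Re (u $ j)"

definition dy :: "'n::finite \<Rightarrow> (complex ^ 'n) form1" where
  "dy j p u = Im (u $ j)"

definition std_symplectic :: "(complex ^ 'n::finite) form2" where
  "std_symplectic p u v = (\<Sum>j\<in>UNIV. (dx j \<and>\<^sub>d dy j) p u v)"

text \<open>Only meaningful at points where \<open>f\<close> is differentiable: elsewhere
  \<open>frechet_derivative\<close> is unspecified.\<close>

definition pullback ::
    "('a::real_normed_vector \<Rightarrow> 'b::real_normed_vector) \<Rightarrow> 'b form2 \<Rightarrow> 'a form2" where
  "pullback f \<alpha> p u v =
     \<alpha> (f p) (frechet_derivative f (at p) u) (frechet_derivative f (at p) v)"

text \<open>The derivative is required to be continuous in the operator norm.\<close>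

definition C1_on ::
    "'a::real_normed_vector set \<Rightarrow> ('a \<Rightarrow> 'b::real_normed_vector) \<Rightarrow> bool" where
  "C1_on U f \<longleftrightarrow> open U \<and>
     (\<exists>f' :: 'a \<Rightarrow> 'a \<Rightarrow>\<^sub>L 'b.
        (\<forall>x\<in>U. (f has_derivative blinfun_apply (f' x)) (at x)) \<and> continuous_on U f')"

definition C1_diffeomorphism ::
    "'a::real_normed_vector set \<Rightarrow> 'b::real_normed_vector set \<Rightarrow> ('a \<Rightarrow> 'b) \<Rightarrow> bool" where
  "C1_diffeomorphism U V f \<longleftrightarrow>
     bij_betw f U V \<and> C1_on U f \<and> C1_on V (inv_into U f)"

definition is_domain :: "'a::topological_space set \<Rightarrow> bool" where
  "is_domain G \<longleftrightarrow> open G \<and> connected G \<and> G \<noteq> {}"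

text \<open>The coordinate axes are indexed by the unordered type \<open>'n\<close>; the index \<open>k\<close> designates the
  axis carrying the disc factor, all other coordinates being unrestricted.\<close>

definition disc_cylinder :: "'n::finite \<Rightarrow> real \<Rightarrow> (complex ^ 'n) set" where
  "disc_cylinder k R = {Z. Z $ k \<in> ball 0 R}"

end

theory Submission
  imports Defs "HOL-Complex_Analysis.Great_Picard"
begin

text \<open>Suppose \<open>R < s < r\<close> and let \<open>K\<close> be the image of the closed ball of radius \<open>s\<close>. Following
  Hofer and Zehnder, take a Hamiltonian \<open>H \<ge> 0\<close> that is \<open>f(|\<Phi>\<^sup>-\<^sup>1 z|\<^sup>2)\<close> on \<open>K\<close> with \<open>0 \<le> f' < \<pi>\<close>, that vanishes to
  fourth order at \<open>\<Phi> 0\<close>, and that outside \<open>K\<close> grows from a constant larger than \<open>\<pi> R\<^sup>2\<close> to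
  \<open>a q(z)\<close>, up to a constant, where \<open>a\<close> is slightly larger than \<open>\<pi>\<close> and \<open>q\<close> is \<open>|z\<^sub>k|\<^sup>2\<close> plus a small
  multiple of the other \<open>|z\<^sub>i|\<^sup>2\<close>. The action functional is positive on a small sphere in the positive
  frequencies and nonpositive on the boundary of a box that links it, so minimax yields
  an orbit of period 1 that has positive action. Outside \<open>K\<close> the action density is nonpositive, hence the
  orbit lies in \<open>K\<close>. Pulled back to the ball, it rotates on a sphere with angular velocity
  \<open>2 f' < 2 \<pi>\<close>, so it cannot close up after time 1 unless it is constant; but constant orbits have
  action \<open>-H \<le> 0\<close>.

  The minimax takes place in finite dimension: time is discretized by the implicit midpoint rule with
  an odd number of steps, for which all estimates are uniform, and the orbit is obtained from
  almost critical points by the theorem of Arzela and Ascoli. In this way \<open>H\<close> need only be \<open>C\<^sup>1\<close>.\<close>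

section \<open>Zeros of maps on a cube of variable dimension\<close>

text \<open>As \<Phi> is only C1, the gradient of \<open>H\<close> is merely continuous: it has no
  flow, and the action has no Hessian. With finitely many modes, single gradient steps and a zero
  theorem on a cube are enough. The midpoint rule fits because its closed polygons are critical
  points of a function whose quadratic part is diagonal in Fourier modes, with k-th eigenvalue at
  least pi k for k > 0. An odd number of steps keeps the tangent in these eigenvalues away from its
  pole. The fourth-order zero of \<open>H\<close> is matched to the embedding of H^(1/2) into L^4.
  The limiting eigenvalues are pi k. Slope a > pi makes the action nonpositive far out in the first
  mode of the disc coordinate; a < 2 pi, together with small weights on the other coordinates,
  avoids resonance and bounds almost critical points uniformly. The assumption s > R enters through
  heights: a profile with slope below pi on an interval of length s^2 can climb above pi R^2, which
  is what makes the action density outside \<open>K\<close> nonpositive.\<close>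

lemma tendsto_fun_iff:
  fixes f :: "'a \<Rightarrow> 'i \<Rightarrow> 'b::topological_space"
  shows "(f \<longlongrightarrow> l) F \<longleftrightarrow> (\<forall>i. ((\<lambda>x. f x i) \<longlongrightarrow> l i) F)"
  using limitin_componentwise[of "\<lambda>_. euclidean" UNIV f l F]
  by (auto simp: euclidean_product_topology)

lemma compact_unit_cube: "compact {x::'i \<Rightarrow> real. \<forall>i. 0 \<le> x i \<and> x i \<le> 1}"
proof -
  have "compactin (product_topology (\<lambda>_. euclidean) UNIV) (PiE (UNIV::'i set) (\<lambda>_. {0..1::real}))"
    by (subst compactin_PiE) auto
  moreover have "PiE (UNIV::'i set) (\<lambda>_. {0..1::real}) = {x. \<forall>i. 0 \<le> x i \<and> x i \<le> 1}"
    by (auto simp: PiE_def Pi_def)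
  ultimately show ?thesis by (simp add: euclidean_product_topology)
qed

text \<open>Sperner labelling by the signs of the components replaces the labelling that proves
  Brouwer's theorem; the dimension is a term here, not a type, because it varies below.\<close>

lemma poincare_miranda_unit:
  fixes g :: "(nat \<Rightarrow> real) \<Rightarrow> nat \<Rightarrow> real" and n :: nat
  defines "B \<equiv> {x. \<forall>j. 0 \<le> x j \<and> x j \<le> (1::real)}"
  assumes cont: "\<And>i. i < n \<Longrightarrow> continuous_on B (\<lambda>x. g x i)"
    and lo: "\<And>x i. x \<in> B \<Longrightarrow> i < n \<Longrightarrow> x i = 0 \<Longrightarrow> g x i \<le> 0"
    and hi: "\<And>x i. x \<in> B \<Longrightarrow> i < n \<Longrightarrow> x i = 1 \<Longrightarrow> 0 \<le> g x i"
  obtains x where "x \<in> B" "\<And>i. i < n \<Longrightarrow> g x i = 0"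
proof -
  \<comment> \<open>Coordinates from \<open>n\<close> on are frozen at 0, so that all grid points
    lie in the infinite cube \<open>B\<close>, which is compact.\<close>
  define pt where "pt = (\<lambda>p (x::nat\<Rightarrow>nat) j. if j < n then real (x j) / real p else 0)"
  have ptB: "pt p x \<in> B" if "p > 0" "\<forall>j<n. x j \<le> p" for p x
    using that by (auto simp: pt_def B_def)
  have "\<exists>Q R S. Q \<in> B \<and> (\<forall>i<n. R i \<in> B \<and> S i \<in> B \<and> g (R i) i \<le> 0 \<and> 0 \<le> g (S i) i \<and>
      (\<forall>j. \<bar>R i j - Q j\<bar> \<le> 1 / real (Suc m) \<and> \<bar>S i j - Q j\<bar> \<le> 1 / real (Suc m)))" for m
  proof -
    define p where "p = Suc m"
    have p: "p > 0" by (simp add: p_def)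
    \<comment> \<open>The disjunct \<open>x i = 0\<close> forces the label 0 on the lower face, as
      Kuhn's lemma demands; there \<open>lo\<close> supplies the sign that the label 0 stands
      for.\<close>
    define label where "label = (\<lambda>x i. if g (pt p x) i < 0 \<or> x i = 0 then 0 else (1::nat))"
    have l0: "g (pt p x) i \<le> 0" if "label x i = 0" "\<forall>j<n. x j \<le> p" "i < n" for x i
      using that lo[OF ptB[OF p that(2)], of i] by (auto simp: label_def pt_def split: if_splits)
    have l1: "0 \<le> g (pt p x) i" if "label x i \<noteq> 0" for x i
      using that by (auto simp: label_def split: if_splits)
    obtain q where q: "\<forall>i<n. q i < p"
      and rs: "\<forall>i<n. \<exists>r s. (\<forall>j<n. q j \<le> r j \<and> r j \<le> q j + 1) \<and>
               (\<forall>j<n. q j \<le> s j \<and> s j \<le> q j + 1) \<and> label r i \<noteq> label s i"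
    proof (rule kuhn_lemma[of p n label])
      show "\<forall>x. (\<forall>i<n. x i \<le> p) \<longrightarrow> (\<forall>i<n. x i = p \<longrightarrow> label x i = 1)"
      proof (intro allI impI)
        fix x :: "nat \<Rightarrow> nat" and i
        assume x: "\<forall>i<n. x i \<le> p" and i: "i < n" "x i = p"
        have "0 \<le> g (pt p x) i"
          by (rule hi[OF ptB[OF p x] i(1)]) (use i p in \<open>auto simp: pt_def\<close>)
        then show "label x i = 1" using i p by (auto simp: label_def)
      qed
    qed (use p in \<open>auto simp: label_def\<close>)
    have near: "\<bar>pt p x j - pt p q j\<bar> \<le> 1 / real p" if "\<forall>j<n. q j \<le> x j \<and> x j \<le> q j + 1" for x j
    proof (cases "j < n")
      case True
      then have "\<bar>real (x j) - real (q j)\<bar> \<le> 1" using that by force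
      then show ?thesis using True p by (simp add: pt_def diff_divide_distrib[symmetric] abs_divide divide_right_mono)
    qed (auto simp: pt_def)
    have ex: "\<exists>R S. R \<in> B \<and> S \<in> B \<and> g R i \<le> 0 \<and> 0 \<le> g S i \<and>
      (\<forall>j. \<bar>R j - pt p q j\<bar> \<le> 1 / real p \<and> \<bar>S j - pt p q j\<bar> \<le> 1 / real p)" if i: "i < n" for i
    proof -
      obtain r s where r: "\<forall>j<n. q j \<le> r j \<and> r j \<le> q j + 1" 
        and s: "\<forall>j<n. q j \<le> s j \<and> s j \<le> q j + 1" and ne: "label r i \<noteq> label s i"
        using rs i by blast
      have rp: "\<forall>j<n. r j \<le> p" "\<forall>j<n. s j \<le> p" using r s q by force+
      have "label r i = 0 \<and> label s i \<noteq> 0 \<or> label s i = 0 \<and> label r i \<noteq> 0"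
        using ne by (auto simp: label_def split: if_splits)
      then show ?thesis
        using l0[OF _ rp(1) i] l0[OF _ rp(2) i] l1[of r i] l1[of s i] ptB[OF p rp(1)] ptB[OF p rp(2)]
          near[OF r] near[OF s] by blast
    qed
    have "pt p q \<in> B" using ptB[OF p] q by (simp add: less_imp_le)
    moreover obtain R S where "\<forall>i<n. R i \<in> B \<and> S i \<in> B \<and> g (R i) i \<le> 0 \<and> 0 \<le> g (S i) i \<and>
      (\<forall>j. \<bar>R i j - pt p q j\<bar> \<le> 1 / real p \<and> \<bar>S i j - pt p q j\<bar> \<le> 1 / real p)"
      using ex by metis
    ultimately show ?thesis unfolding p_def by blast
  qed
  then obtain Q R S where Q: "\<And>m. Q m \<in> B"
    and RS: "\<And>m i. i < n \<Longrightarrow> R m i \<in> B \<and> S m i \<in> B \<and> g (R m i) i \<le> 0 \<and> 0 \<le> g (S m i) i \<and>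
      (\<forall>j. \<bar>R m i j - Q m j\<bar> \<le> 1 / real (Suc m) \<and> \<bar>S m i j - Q m j\<bar> \<le> 1 / real (Suc m))"
    by metis
  \<comment> \<open>Only the base points \<open>Q\<close> are made to converge. \<open>R\<close> and
    \<open>S\<close> stay within \<open>1 / Suc m\<close> of them, so the two opposite sign
    conditions meet at one limit.\<close>
  have "seq_compact B"
    using compact_unit_cube unfolding B_def by (rule compact_imp_seq_compact)
  then obtain x k where x: "x \<in> B" and k: "strict_mono (k::nat\<Rightarrow>nat)" and lim: "(Q \<circ> k) \<longlonglongrightarrow> x"
    unfolding seq_compact_def using Q by metis
  have limQ: "(\<lambda>m. Q (k m) j) \<longlonglongrightarrow> x j" for j
    using lim unfolding tendsto_fun_iff by (simp add: o_def)
  have inv: "(\<lambda>m. 1 / real (Suc (k m))) \<longlonglongrightarrow> 0"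
    using LIMSEQ_subseq_LIMSEQ[OF LIMSEQ_inverse_real_of_nat k] by (simp add: o_def inverse_eq_divide)
  have limX: "(\<lambda>m. X (k m)) \<longlonglongrightarrow> x" if "\<And>m j. \<bar>X m j - Q m j\<bar> \<le> 1 / real (Suc m)" for X
    unfolding tendsto_fun_iff
  proof
    fix j
    have "(\<lambda>m. X (k m) j - Q (k m) j) \<longlonglongrightarrow> 0"
      by (rule Lim_null_comparison[OF _ inv]) (use that in auto)
    from tendsto_add[OF this limQ[of j]] show "(\<lambda>m. X (k m) j) \<longlonglongrightarrow> x j" by simp
  qed
  have "g x i = 0" if i: "i < n" for i
  proof -
    have lim_g: "(\<lambda>m. g (X (k m)) i) \<longlonglongrightarrow> g x i" 
      if "\<And>m. X m \<in> B" "\<And>m j. \<bar>X m j - Q m j\<bar> \<le> 1 / real (Suc m)" for X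
      by (rule continuous_on_tendsto_compose[OF cont[OF i] limX x]) (use that in auto)
    have "(\<lambda>m. g (R (k m) i) i) \<longlonglongrightarrow> g x i" "(\<lambda>m. g (S (k m) i) i) \<longlonglongrightarrow> g x i"
      by (rule lim_g; use RS[OF i] in blast)+
    then have "g x i \<le> 0" "0 \<le> g x i"
      using RS[OF i] by (auto intro: LIMSEQ_le_const2 LIMSEQ_le_const)
    then show ?thesis by simp
  qed
  then show ?thesis using that x by blast
qed

lemma poincare_miranda:
  fixes g :: "('i \<Rightarrow> real) \<Rightarrow> 'i \<Rightarrow> real" and l h :: "'i \<Rightarrow> real"
  assumes I: "finite I" and lh: "\<And>i. l i < h i"
    and cont: "\<And>i. i \<in> I \<Longrightarrow> continuous_on UNIV (\<lambda>x. g x i)"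
    and lo: "\<And>x i. (\<And>j. l j \<le> x j \<and> x j \<le> h j) \<Longrightarrow> i \<in> I \<Longrightarrow> x i = l i \<Longrightarrow> g x i \<le> p i"
    and hi: "\<And>x i. (\<And>j. l j \<le> x j \<and> x j \<le> h j) \<Longrightarrow> i \<in> I \<Longrightarrow> x i = h i \<Longrightarrow> p i \<le> g x i"
  obtains x where "\<And>j. l j \<le> x j \<and> x j \<le> h j" "\<And>i. i \<in> I \<Longrightarrow> g x i = p i"
proof -
  obtain idx :: "'i \<Rightarrow> nat" and n where bij: "bij_betw idx I {..<n}"
    using I by (metis ex_bij_betw_finite_nat lessThan_atLeast0)
  define e where "e = inv_into I idx"
  have e: "e k \<in> I" "idx (e k) = k" if "k < n" for k
    using bij that unfolding e_def by (auto simp: bij_betw_def inv_into_into f_inv_into_f)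
  have e': "e (idx i) = i" "idx i < n" if "i \<in> I" for i
    using bij that unfolding e_def by (auto simp: bij_betw_def)
  \<comment> \<open>Outside \<open>I\<close> the value of \<open>idx\<close> is arbitrary, which is
    harmless: \<open>y\<close> lies between 0 and 1 in every coordinate, hence \<open>X y\<close>
    lies in the box.\<close>
  define X where "X = (\<lambda>(y::nat\<Rightarrow>real) i. l i + (h i - l i) * y (idx i))"
  define B where "B = {x :: nat \<Rightarrow> real. \<forall>j. 0 \<le> x j \<and> x j \<le> 1}"
  have XB: "l j \<le> X y j \<and> X y j \<le> h j" if "y \<in> B" for y :: "nat \<Rightarrow> real" and j
  proof -
    have "(h j - l j) * y (idx j) \<le> (h j - l j) * 1"
      by (rule mult_left_mono) (use that lh[of j] in \<open>auto simp: B_def\<close>)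
    moreover have "0 \<le> (h j - l j) * y (idx j)" using that lh[of j] by (auto simp: B_def)
    ultimately show ?thesis by (auto simp: X_def)
  qed
  have cX: "continuous_on S X" for S
    unfolding X_def by (intro continuous_intros continuous_on_product_then_coordinatewise continuous_on_id)
  obtain y where y: "y \<in> B" "\<And>k. k < n \<Longrightarrow> g (X y) (e k) - p (e k) = 0"
  proof (rule poincare_miranda_unit[of n "\<lambda>y k. g (X y) (e k) - p (e k)", folded B_def])
    show "continuous_on B (\<lambda>x. g (X x) (e i) - p (e i))" if "i < n" for i
      by (intro continuous_intros continuous_on_compose2[OF cont[OF e(1)[OF that]] cX]) auto
    show "g (X x) (e i) - p (e i) \<le> 0" if "x \<in> B" "i < n" "x i = 0" for x i
    proof -
      have "X x (e i) = l (e i)" using that e(2)[of i] by (simp add: X_def)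
      then show ?thesis using lo[of "X x" "e i"] XB[OF that(1)] e(1)[OF that(2)] by auto
    qed
    show "0 \<le> g (X x) (e i) - p (e i)" if "x \<in> B" "i < n" "x i = 1" for x i
    proof -
      have "X x (e i) = h (e i)" using that e(2)[of i] by (simp add: X_def)
      then show ?thesis using hi[of "X x" "e i"] XB[OF that(1)] e(1)[OF that(2)] by auto
    qed
  qed auto
  show ?thesis
  proof (rule that[of "X y"])
    show "g (X y) i = p i" if "i \<in> I" for i
      using y(2)[OF e'(2)[OF that]] e'(1)[OF that] by simp
  qed (use XB y(1) in blast)
qed

section \<open>Discrete Fourier analysis\<close>

lemma inner_vector_smult_left:
  fixes u v :: "complex ^ 'n"
  shows "(a *s u) \<bullet> v = u \<bullet> (cnj a *s v)"
  by (simp add: inner_vec_def inner_complex_def algebra_simps)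

lemma norm_vector_smult:
  fixes u :: "complex ^ 'n"
  shows "norm (a *s u) = cmod a * norm u"
  by (simp add: norm_vec_def norm_mult L2_set_right_distrib)

lemma continuous_on_vector_smult [continuous_intros]:
  fixes f :: "'a::topological_space \<Rightarrow> complex ^ 'n"
  assumes "continuous_on S f"
  shows "continuous_on S (\<lambda>x. a *s f x)"
  unfolding vector_scalar_mult_def by (intro continuous_intros continuous_on_vec_lambda assms)

lemma scaleR_vector_smult:
  fixes u :: "complex ^ 'n"
  shows "r *\<^sub>R u = complex_of_real r *s u"
  by (simp add: vec_eq_iff scaleR_conv_of_real[where 'a=complex])

lemma vector_smult_sum:
  fixes f :: "'a \<Rightarrow> complex ^ 'n"
  shows "a *s (\<Sum>x\<in>A. f x) = (\<Sum>x\<in>A. a *s f x)"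
  by (simp add: vec_eq_iff sum_distrib_left)

lemma sum_vector_smult:
  fixes u :: "complex ^ 'n"
  shows "(\<Sum>x\<in>A. f x) *s u = (\<Sum>x\<in>A. f x *s u)"
  by (simp add: vec_eq_iff sum_distrib_right)

lemma vector_smult_inj: "\<i> *s u = \<i> *s (v :: complex ^ 'n) \<longleftrightarrow> u = v"
  by (auto simp: vec_eq_iff)

definition fourier_char :: "nat \<Rightarrow> nat \<Rightarrow> int \<Rightarrow> complex" where
  "fourier_char M j k = cis (2 * pi * (real j * real_of_int k) / real M)"

lemma fourier_char_add: "fourier_char M j (k + l) = fourier_char M j k * fourier_char M j l"
  by (simp add: fourier_char_def cis_mult distrib_left add_divide_distrib)

lemma cnj_fourier_char: "cnj (fourier_char M j k) = fourier_char M j (- k)"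
  by (simp add: fourier_char_def cis_cnj)

lemma norm_fourier_char [simp]: "cmod (fourier_char M j k) = 1"
  by (simp add: fourier_char_def)

lemma fourier_char_0 [simp]: "fourier_char M j 0 = 1" "fourier_char M 0 k = 1"
  by (simp_all add: fourier_char_def)

lemma fourier_char_power: "fourier_char M j k = fourier_char M 1 k ^ j"
  by (simp add: fourier_char_def Complex.DeMoivre mult_ac)

lemma fourier_char_eq_1: "M > 0 \<Longrightarrow> fourier_char M 1 k = 1 \<longleftrightarrow> int M dvd k"
proof
  assume M: "M > 0" and "fourier_char M 1 k = 1"
  then have "cos (2 * pi * real_of_int k / real M) = 1"
    by (metis fourier_char_def cis.simps(1) mult_1 of_nat_1 one_complex.simps(1))
  then obtain n :: int where "2 * pi * real_of_int k / real M = real_of_int n * 2 * pi"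
    unfolding cos_one_2pi_int by blast
  then have "real_of_int k = real_of_int (n * int M)" using M by (simp add: field_simps)
  then show "int M dvd k" by (simp only: of_int_eq_iff dvd_triv_right)
next
  assume M: "M > 0" and "int M dvd k"
  then obtain n where "k = int M * n" by (auto simp: dvd_def)
  then have "2 * pi * (real 1 * real_of_int k) / real M = 2 * pi * real_of_int n" using M by simp
  then show "fourier_char M 1 k = 1" by (simp only: fourier_char_def cis_multiple_2pi Ints_of_int)
qed

lemma fourier_char_period:
  assumes "M > 0"
  shows "fourier_char M M k = 1"
proof -
  have "2 * pi * (real M * real_of_int k) / real M = 2 * pi * real_of_int k" using assms by simp
  then show ?thesis by (simp only: fourier_char_def cis_multiple_2pi Ints_of_int)
qed

lemma fourier_char_Suc: "fourier_char M (Suc j) k = fourier_char M j k * fourier_char M 1 k"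
  by (simp add: fourier_char_def cis_mult distrib_left distrib_right add_divide_distrib add.commute)

lemma sum_fourier_char: "M > 0 \<Longrightarrow> (\<Sum>j<M. fourier_char M j k) = (if int M dvd k then of_nat M else 0)"
proof -
  assume M: "M > 0"
  have "(\<Sum>j<M. fourier_char M j k) = (\<Sum>j<M. fourier_char M 1 k ^ j)" by (intro sum.cong refl fourier_char_power)
  also have "\<dots> = (if int M dvd k then of_nat M else 0)"
    using fourier_char_eq_1[OF M, of k] fourier_char_period[OF M, of k] fourier_char_power[of M M k]
    by (auto simp: geometric_sum)
  finally show ?thesis .
qed

lemma sum_fourier_char_freq:
  assumes M: "M = 2 * N + 1" and jl: "j < M" "l < M"
  shows "(\<Sum>k\<in>{-int N..int N}. fourier_char M j k * fourier_char M l (- k)) = (if j = l then of_nat M else 0)"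
proof -
  define q where "q = int j - int l"
  have "fourier_char M j k * fourier_char M l (- k) = fourier_char M 1 (q * k)" for k
    by (simp add: fourier_char_def cis_mult q_def algebra_simps diff_divide_distrib add_divide_distrib)
  then have "(\<Sum>k\<in>{-int N..int N}. fourier_char M j k * fourier_char M l (- k)) = (\<Sum>k\<in>{-int N..int N}. fourier_char M 1 (q * k))"
    by simp
  \<comment> \<open>Shifting by \<open>N\<close> turns the symmetric range into a full period. It
    costs a unimodular factor, which equals 1 in the only surviving case
    \<open>q = 0\<close>.\<close>
  also have "\<dots> = (\<Sum>i<M. fourier_char M 1 (q * (int i - int N)))"
    by (rule sum.reindex_bij_witness[of _ "\<lambda>i. int i - int N" "\<lambda>k. nat (k + int N)"])
       (use M in auto)
  also have "\<dots> = fourier_char M 1 (- q * int N) * (\<Sum>i<M. fourier_char M i q)"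
    unfolding sum_distrib_left fourier_char_add[symmetric]
    by (intro sum.cong refl) (simp add: fourier_char_def cis_mult algebra_simps diff_divide_distrib add_divide_distrib)
  also have "(\<Sum>i<M. fourier_char M i q) = (if int M dvd q then of_nat M else 0)"
    by (rule sum_fourier_char) (use M in simp)
  also have "int M dvd q \<longleftrightarrow> j = l"
  proof
    assume "int M dvd q"
    moreover have "\<bar>q\<bar> < int M" using jl by (auto simp: q_def)
    ultimately have "q = 0" using dvd_imp_le_int[of q "int M"] by fastforce
    then show "j = l" by (simp add: q_def)
  qed (simp add: q_def)
  also have "fourier_char M 1 (- q * int N) * (if j = l then of_nat M else 0) = (if j = l then of_nat M else 0)"
    by (simp add: q_def)
  finally show ?thesis .
qed

definition synth :: "nat \<Rightarrow> int set \<Rightarrow> (int \<Rightarrow> complex ^ 'n) \<Rightarrow> nat \<Rightarrow> complex ^ 'n" where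
  "synth M K c j = (\<Sum>k\<in>K. fourier_char M j k *s c k)"

definition coef :: "nat \<Rightarrow> (nat \<Rightarrow> complex ^ 'n) \<Rightarrow> int \<Rightarrow> complex ^ 'n" where
  "coef M v k = (1 / real M) *\<^sub>R (\<Sum>j<M. fourier_char M j (- k) *s v j)"

text \<open>\<open>coef\<close> is the adjoint of \<open>synth\<close> for the averaged inner
  product of samples; this is how the derivative of a mean over samples becomes a vector of
  modes.\<close>

lemma sum_coef_inner:
  "(\<Sum>k\<in>K. coef M v k \<bullet> c k) = (1 / real M) * (\<Sum>j<M. v j \<bullet> synth M K c j)"
proof -
  have "(\<Sum>k\<in>K. coef M v k \<bullet> c k) = (1 / real M) * (\<Sum>k\<in>K. \<Sum>j<M. v j \<bullet> (fourier_char M j k *s c k))"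
    by (simp add: coef_def inner_sum_left sum_distrib_left inner_vector_smult_left cnj_fourier_char)
  also have "(\<Sum>k\<in>K. \<Sum>j<M. v j \<bullet> (fourier_char M j k *s c k)) = (\<Sum>j<M. v j \<bullet> synth M K c j)"
    by (subst sum.swap) (simp add: synth_def inner_sum_right)
  finally show ?thesis .
qed

text \<open>Orthogonality of the characters only needs frequencies that are distinct modulo
  \<open>M\<close>. The generality in \<open>K\<close> is used for the squares below, whose
  frequencies leave the range from \<open>-N\<close> to \<open>N\<close>.\<close>

lemma coef_synth:
  assumes M: "M > 0" and K: "finite K" "k \<in> K"
    and dist: "\<And>k l. k \<in> K \<Longrightarrow> l \<in> K \<Longrightarrow> int M dvd k - l \<Longrightarrow> k = l"
  shows "coef M (synth M K c) k = c k"
proof -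
  have "(\<Sum>j<M. fourier_char M j (- k) *s synth M K c j) = (\<Sum>j<M. \<Sum>l\<in>K. fourier_char M j (l - k) *s c l)"
    by (simp add: synth_def vector_smult_sum vector_smult_assoc fourier_char_add[symmetric])
  also have "\<dots> = (\<Sum>l\<in>K. (\<Sum>j<M. fourier_char M j (l - k)) *s c l)"
    by (subst sum.swap) (simp add: sum_vector_smult)
  also have "\<dots> = (\<Sum>l\<in>K. if l = k then of_nat M *s c k else 0)"
  proof (intro sum.cong refl)
    fix l assume "l \<in> K"
    then have "int M dvd l - k \<longleftrightarrow> l = k" using dist[of l k] K(2) by auto
    then show "(\<Sum>j<M. fourier_char M j (l - k)) *s c l = (if l = k then of_nat M *s c k else 0)"
      using sum_fourier_char[OF M, of "l - k"] by simp
  qed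
  also have "\<dots> = of_nat M *s c k" using K by simp
  finally show ?thesis using M by (simp add: coef_def scaleR_vector_smult vector_smult_assoc)
qed

lemma parseval_inner:
  assumes M: "M > 0" and K: "finite K"
    and dist: "\<And>k l. k \<in> K \<Longrightarrow> l \<in> K \<Longrightarrow> int M dvd k - l \<Longrightarrow> k = l"
  shows "(1 / real M) * (\<Sum>j<M. synth M K c j \<bullet> synth M K d j) = (\<Sum>k\<in>K. c k \<bullet> d k)"
  unfolding sum_coef_inner[symmetric] by (intro sum.cong refl) (simp add: coef_synth assms)

lemma synth_coef:
  assumes M: "M = 2 * N + 1" and j: "j < M"
  shows "synth M {-int N..int N} (coef M v) j = v j"
proof -
  have "synth M {-int N..int N} (coef M v) j
      = (1 / real M) *\<^sub>R (\<Sum>k\<in>{-int N..int N}. \<Sum>l<M. (fourier_char M j k * fourier_char M l (- k)) *s v l)"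
    by (simp add: synth_def coef_def scaleR_vector_smult vector_smult_sum vector_smult_assoc mult.left_commute)
  also have "(\<Sum>k\<in>{-int N..int N}. \<Sum>l<M. (fourier_char M j k * fourier_char M l (- k)) *s v l)
      = (\<Sum>l<M. (\<Sum>k\<in>{-int N..int N}. fourier_char M j k * fourier_char M l (- k)) *s v l)"
    by (subst sum.swap) (simp add: sum_vector_smult)
  also have "\<dots> = (\<Sum>l<M. if j = l then of_nat M *s v j else 0)"
    by (intro sum.cong refl) (use sum_fourier_char_freq[OF M j] in auto)
  also have "\<dots> = of_nat M *s v j" using j by simp
  moreover have "0 < real M" using M by simp
  ultimately show ?thesis by (simp add: scaleR_vector_smult vector_smult_assoc)
qed

lemma freq_distinct:
  assumes M: "M = 2 * N + 1" and k: "k \<in> {-int N..int N}" "l \<in> {-int N..int N}" "int M dvd k - l"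
  shows "k = l"
proof (rule ccontr)
  assume "k \<noteq> l"
  then have "int M \<le> \<bar>k - l\<bar>" using k(3) dvd_imp_le_int[of "k - l" "int M"] by simp
  then show False using k M by auto
qed

lemma sum_norm_coef:
  assumes M: "M = 2 * N + 1"
  shows "(\<Sum>k\<in>{-int N..int N}. (norm (coef M v k))\<^sup>2) = (1 / real M) * (\<Sum>j<M. (norm (v j))\<^sup>2)"
proof -
  have "(\<Sum>k\<in>{-int N..int N}. (norm (coef M v k))\<^sup>2)
      = (1 / real M) * (\<Sum>j<M. v j \<bullet> synth M {-int N..int N} (coef M v) j)"
    by (simp add: power2_norm_eq_inner sum_coef_inner)
  also have "(\<Sum>j<M. v j \<bullet> synth M {-int N..int N} (coef M v) j) = (\<Sum>j<M. (norm (v j))\<^sup>2)"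
    by (intro sum.cong refl) (simp add: synth_coef[OF M] power2_norm_eq_inner)
  finally show ?thesis .
qed

lemma parseval_complex:
  fixes d :: "int \<Rightarrow> complex"
  assumes M: "M > 0" and K: "finite K"
    and dist: "\<And>k l. k \<in> K \<Longrightarrow> l \<in> K \<Longrightarrow> int M dvd k - l \<Longrightarrow> k = l"
  shows "(1 / real M) * (\<Sum>j<M. (cmod (\<Sum>k\<in>K. fourier_char M j k * d k))\<^sup>2) = (\<Sum>k\<in>K. (cmod (d k))\<^sup>2)"
proof -
  have "synth M K (\<lambda>k. (\<chi> i. d k) :: complex ^ 1) j = (\<chi> i. \<Sum>k\<in>K. fourier_char M j k * d k)" for j
    by (simp add: synth_def vec_eq_iff)
  then show ?thesis
    using parseval_inner[OF assms, of "\<lambda>k. (\<chi> i. d k) :: complex ^ 1" "\<lambda>k. \<chi> i. d k"]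
    by (simp add: inner_vec_def power2_norm_eq_inner)
qed

text \<open>The square of a sum over frequencies \<open>1..N\<close> has the frequencies \<open>2..2N\<close>, and
  \<open>k * l \<ge> k + l - 1\<close> compensates the \<open>m - 1\<close> representations \<open>m = k + l\<close>. This discrete form of
  the embedding of \<open>H\<^sup>1\<^sup>/\<^sup>2\<close> into \<open>L\<^sup>4\<close> holds with a constant independent of \<open>N\<close>.\<close>

lemma L4_bound_complex:
  fixes b :: "int \<Rightarrow> complex"
  assumes M: "M = 2 * N + 1"
  shows "(1 / real M) * (\<Sum>j<M. (cmod (\<Sum>k\<in>{1..int N}. fourier_char M j k * b k)) ^ 4)
    \<le> (\<Sum>k\<in>{1..int N}. real_of_int k * (cmod (b k))\<^sup>2)\<^sup>2"
proof -
  let ?P = "{1..int N} \<times> {1..int N}" and ?s = "\<lambda>p::int\<times>int. fst p + snd p"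
  define T where "T = {2..2 * int N}"
  define d where "d = (\<lambda>m. \<Sum>p\<in>{p \<in> ?P. ?s p = m}. b (fst p) * b (snd p))"
  have sub: "?s ` ?P \<subseteq> T" by (auto simp: T_def)
  have fin: "finite ?P" "finite T" by (auto simp: T_def)
  have sq: "(\<Sum>k\<in>{1..int N}. fourier_char M j k * b k)\<^sup>2 = (\<Sum>m\<in>T. fourier_char M j m * d m)" for j
  proof -
    have "(\<Sum>k\<in>{1..int N}. fourier_char M j k * b k)\<^sup>2 = (\<Sum>p\<in>?P. fourier_char M j (?s p) * (b (fst p) * b (snd p)))"
      by (simp add: power2_eq_square sum_product sum.cartesian_product fourier_char_add case_prod_unfold mult_ac)
    also have "\<dots> = (\<Sum>m\<in>T. \<Sum>p\<in>{p \<in> ?P. ?s p = m}. fourier_char M j (?s p) * (b (fst p) * b (snd p)))"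
      by (rule sum.group[OF fin sub, symmetric])
    also have "\<dots> = (\<Sum>m\<in>T. fourier_char M j m * d m)"
      unfolding d_def sum_distrib_left by (intro sum.cong refl) auto
    finally show ?thesis .
  qed
  have dm: "(cmod (d m))\<^sup>2 \<le> (\<Sum>p\<in>{p \<in> ?P. ?s p = m}.
      (real_of_int (fst p) * (cmod (b (fst p)))\<^sup>2) * (real_of_int (snd p) * (cmod (b (snd p)))\<^sup>2))"
    if "m \<in> T" for m
  proof -
    define A where "A = {p \<in> ?P. ?s p = m}"
    have finA: "finite A" by (simp add: A_def)
    have "card A \<le> card {1..m - 1}"
    proof (rule card_inj_on_le)
      show "inj_on fst A" by (auto simp: inj_on_def A_def)
      show "fst ` A \<subseteq> {1..m - 1}" by (auto simp: A_def)
    qed auto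
    then have cA: "card A \<le> nat (m - 1)" by simp
    have "cmod (d m) \<le> (\<Sum>p\<in>A. cmod (b (fst p)) * cmod (b (snd p)))"
      unfolding d_def A_def[symmetric] by (rule order_trans[OF norm_sum]) (simp add: norm_mult)
    then have "(cmod (d m))\<^sup>2 \<le> (\<Sum>p\<in>A. cmod (b (fst p)) * cmod (b (snd p)))\<^sup>2"
      by (simp add: power_mono)
    also have "\<dots> \<le> (\<Sum>p\<in>A. (cmod (b (fst p)) * cmod (b (snd p)))\<^sup>2) * real (card A)"
      using sum_squared_le_sum_of_squares[of "\<lambda>p. cmod (b (fst p)) * cmod (b (snd p))" A] finA by simp
    also have "\<dots> \<le> (\<Sum>p\<in>A. (real_of_int (fst p) * (cmod (b (fst p)))\<^sup>2) * (real_of_int (snd p) * (cmod (b (snd p)))\<^sup>2))"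
      unfolding sum_distrib_right
    proof (rule sum_mono)
      fix p assume p: "p \<in> A"
      then have "0 \<le> (fst p - 1) * (snd p - 1)" by (auto simp: A_def)
      then have "m - 1 \<le> fst p * snd p" using p by (auto simp: A_def algebra_simps)
      then have "int (card A) \<le> fst p * snd p" using cA that by (auto simp: T_def)
      then have "real (card A) \<le> real_of_int (fst p) * real_of_int (snd p)"
        by (metis of_int_le_iff of_int_mult of_int_of_nat_eq)
      then have "(cmod (b (fst p)) * cmod (b (snd p)))\<^sup>2 * real (card A)
          \<le> (cmod (b (fst p)) * cmod (b (snd p)))\<^sup>2 * (real_of_int (fst p) * real_of_int (snd p))"
        by (rule mult_left_mono) simp
      then show "(cmod (b (fst p)) * cmod (b (snd p)))\<^sup>2 * real (card A)
          \<le> (real_of_int (fst p) * (cmod (b (fst p)))\<^sup>2) * (real_of_int (snd p) * (cmod (b (snd p)))\<^sup>2)"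
        by (simp add: power_mult_distrib mult_ac)
    qed
    finally show ?thesis unfolding A_def .
  qed
  have distT: "k = l" if "k \<in> T" "l \<in> T" "int M dvd k - l" for k l
  proof (rule ccontr)
    assume "k \<noteq> l"
    then have "int M \<le> \<bar>k - l\<bar>" using that(3) dvd_imp_le_int[of "k - l" "int M"] by simp
    then show False using that M by (auto simp: T_def)
  qed
  have "(1 / real M) * (\<Sum>j<M. (cmod (\<Sum>k\<in>{1..int N}. fourier_char M j k * b k)) ^ 4)
      = (1 / real M) * (\<Sum>j<M. (cmod (\<Sum>m\<in>T. fourier_char M j m * d m))\<^sup>2)"
    unfolding sq[symmetric] by (simp add: norm_power)
  also have "\<dots> = (\<Sum>m\<in>T. (cmod (d m))\<^sup>2)"
    by (rule parseval_complex[OF _ fin(2) distT]) (use M in auto)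
  also have "\<dots> \<le> (\<Sum>m\<in>T. \<Sum>p\<in>{p \<in> ?P. ?s p = m}.
      (real_of_int (fst p) * (cmod (b (fst p)))\<^sup>2) * (real_of_int (snd p) * (cmod (b (snd p)))\<^sup>2))"
    by (intro sum_mono dm)
  also have "\<dots> = (\<Sum>p\<in>?P. (real_of_int (fst p) * (cmod (b (fst p)))\<^sup>2) * (real_of_int (snd p) * (cmod (b (snd p)))\<^sup>2))"
    by (rule sum.group[OF fin sub])
  also have "\<dots> = (\<Sum>k\<in>{1..int N}. real_of_int k * (cmod (b k))\<^sup>2)\<^sup>2"
    by (simp add: power2_eq_square sum_product sum.cartesian_product case_prod_unfold)
  finally show ?thesis .
qed

text \<open>Applied to each component. The dimension factor is the price of Cauchy-Schwarz in
  passing from the Euclidean norm to components, and does not depend on \<open>N\<close>.\<close>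

lemma L4_bound:
  fixes c :: "int \<Rightarrow> complex ^ 'n"
  assumes M: "M = 2 * N + 1"
  shows "(1 / real M) * (\<Sum>j<M. (norm (synth M {1..int N} c j)) ^ 4)
    \<le> real CARD('n) * (\<Sum>k\<in>{1..int N}. real_of_int k * (norm (c k))\<^sup>2)\<^sup>2"
proof -
  define S where "S = (\<Sum>k\<in>{1..int N}. real_of_int k * (norm (c k))\<^sup>2)"
  define Si where "Si = (\<lambda>i. \<Sum>k\<in>{1..int N}. real_of_int k * (cmod (c k $ i))\<^sup>2)"
  have norm2: "(norm x)\<^sup>2 = (\<Sum>i\<in>UNIV. (cmod (x $ i))\<^sup>2)" for x :: "complex ^ 'n"
    by (simp add: norm_vec_def L2_set_def sum_nonneg)
  have S: "S = (\<Sum>i\<in>UNIV. Si i)"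
    unfolding S_def Si_def norm2 sum_distrib_left by (rule sum.swap)
  have Sipos: "0 \<le> Si i" for i unfolding Si_def by (intro sum_nonneg) auto
  have "(norm x) ^ 4 \<le> real CARD('n) * (\<Sum>i\<in>UNIV. (cmod (x $ i)) ^ 4)" for x :: "complex ^ 'n"
  proof -
    have "(norm x) ^ 4 = (\<Sum>i\<in>UNIV. (cmod (x $ i))\<^sup>2)\<^sup>2"
      unfolding norm2[symmetric] by simp
    also have "\<dots> \<le> (\<Sum>i\<in>UNIV. ((cmod (x $ i))\<^sup>2)\<^sup>2) * real CARD('n)"
      by (rule sum_squared_le_sum_of_squares)
    finally show ?thesis by (simp add: mult.commute)
  qed
  then have "(1 / real M) * (\<Sum>j<M. (norm (synth M {1..int N} c j)) ^ 4)
      \<le> (1 / real M) * (\<Sum>j<M. real CARD('n) * (\<Sum>i\<in>UNIV. (cmod (synth M {1..int N} c j $ i)) ^ 4))"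
    by (intro mult_left_mono sum_mono) auto
  also have "\<dots> = real CARD('n) * (\<Sum>i\<in>UNIV. (1 / real M) * (\<Sum>j<M. (cmod (synth M {1..int N} c j $ i)) ^ 4))"
    unfolding sum_distrib_left by (subst sum.swap, intro sum.cong refl) (simp only: mult_ac)
  also have "\<dots> \<le> real CARD('n) * (\<Sum>i\<in>UNIV. (Si i)\<^sup>2)"
  proof (intro mult_left_mono sum_mono)
    fix i
    show "(1 / real M) * (\<Sum>j<M. (cmod (synth M {1..int N} c j $ i)) ^ 4) \<le> (Si i)\<^sup>2"
      using L4_bound_complex[OF M, of "\<lambda>k. c k $ i"] by (simp add: synth_def Si_def)
  qed auto
  also have "(\<Sum>i\<in>UNIV. (Si i)\<^sup>2) \<le> (\<Sum>i\<in>UNIV. Si i * (\<Sum>i\<in>UNIV. Si i))"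
    unfolding power2_eq_square
    by (intro sum_mono mult_left_mono Sipos member_le_sum) (auto simp: Sipos)
  also have "(\<Sum>i\<in>UNIV. Si i * (\<Sum>i\<in>UNIV. Si i)) = S\<^sup>2"
    using S by (simp add: sum_distrib_right[symmetric] power2_eq_square)
  finally show ?thesis by (simp add: S_def)
qed

text \<open>If \<open>z\<^sub>j\<close> is the mode of frequency \<open>k\<close>, the difference quotient \<open>M (z\<^sub>j\<^sub>+\<^sub>1 - z\<^sub>j)\<close> is
  \<open>2 \<i> midpoint_eig M k\<close> times the midpoint \<open>(z\<^sub>j + z\<^sub>j\<^sub>+\<^sub>1) / 2\<close>.\<close>

definition midpoint_eig :: "nat \<Rightarrow> int \<Rightarrow> real" where
  "midpoint_eig M k = real M * tan (pi * real_of_int k / real M)"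

lemma midpoint_eig_0 [simp]: "midpoint_eig M 0 = 0"
  by (simp add: midpoint_eig_def)

lemma midpoint_eig_minus: "midpoint_eig M (- k) = - midpoint_eig M k"
  by (simp add: midpoint_eig_def)

text \<open>Oddness of \<open>M\<close> matters here: with an even number of steps the frequency
  \<open>M / 2\<close> would hit the pole of the tangent, since the alternating polygon has
  vanishing midpoints.\<close>

lemma arg_midpoint_eig_less:
  assumes "M = 2 * N + 1" "k \<in> {-int N..int N}"
  shows "\<bar>pi * real_of_int k / real M\<bar> < pi / 2"
proof -
  have "\<bar>2 * k\<bar> < int M" using assms by auto
  then have "2 * \<bar>real_of_int k\<bar> < real M" by linarith
  then have "pi * (2 * \<bar>real_of_int k\<bar>) < pi * real M" by simp
  moreover have "0 < real M" using assms by simp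
  ultimately show ?thesis by (simp add: abs_mult field_simps)
qed

text \<open>From \<open>tan x \<ge> x\<close>. The discrete quadratic form therefore dominates the
  H^(1/2) norm with a constant independent of the number of steps.\<close>

lemma midpoint_eig_ge:
  assumes "M = 2 * N + 1" "k \<in> {0..int N}"
  shows "pi * real_of_int k \<le> midpoint_eig M k"
proof -
  let ?x = "pi * real_of_int k / real M"
  have x: "\<bar>?x\<bar> < pi / 2" "0 \<le> ?x" using arg_midpoint_eig_less[OF assms(1), of k] assms by auto
  have "0 \<le> tan ?x" by (rule tan_pos_pi2_le[OF x(2)]) (use x in linarith)
  then have "?x \<le> tan ?x" using abs_tan_ge[OF x(1)] x(2) by linarith
  then have "real M * ?x \<le> midpoint_eig M k" unfolding midpoint_eig_def by (intro mult_left_mono) auto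
  then show ?thesis using assms by simp
qed

lemma midpoint_eig_nonpos:
  assumes "M = 2 * N + 1" "k \<in> {-int N..0}"
  shows "midpoint_eig M k \<le> 0"
proof -
  have "0 \<le> pi * real_of_int (- k)" using assms by (intro mult_nonneg_nonneg) auto
  also have "\<dots> \<le> midpoint_eig M (- k)" by (rule midpoint_eig_ge[OF assms(1)]) (use assms in auto)
  finally show ?thesis by (simp add: midpoint_eig_minus)
qed

text \<open>Since \<open>a > pi\<close>, the first eigenvalue stays below \<open>a\<close> with a
  fixed margin once the steps are fine enough.\<close>

lemma midpoint_eig_1_tendsto: "(\<lambda>M. midpoint_eig M 1) \<longlonglongrightarrow> pi"
proof -
  have d: "((\<lambda>x. tan (pi * x)) has_real_derivative pi) (at 0)"
    by (auto intro!: derivative_eq_intros)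
  have f: "filterlim (\<lambda>M. 1 / real M) (at 0) sequentially"
    unfolding filterlim_at
    using lim_1_over_n by (auto simp: eventually_sequentially intro!: exI[of _ 1])
  have "((\<lambda>h. tan (pi * h) / h) \<longlongrightarrow> pi) (at 0)"
    using d unfolding DERIV_def by simp
  from filterlim_compose[OF this f] show ?thesis by (simp add: midpoint_eig_def mult.commute)
qed

text \<open>The Cayley transform: e^(2ix) (1 - i tan x) = 1 + i tan x.\<close>

lemma fourier_char_1_tan:
  assumes "M = 2 * N + 1" "k \<in> {-int N..int N}"
  shows "fourier_char M 1 k * Complex 1 (- midpoint_eig M k / real M) = Complex 1 (midpoint_eig M k / real M)"
proof -
  define x where "x = pi * real_of_int k / real M"
  have "\<bar>x\<bar> < pi / 2" using arg_midpoint_eig_less[OF assms] by (simp only: x_def)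
  then have c: "cos x \<noteq> 0" using cos_gt_zero_pi[of x] by linarith
  have t: "midpoint_eig M k / real M = sin x / cos x" using assms by (simp add: midpoint_eig_def x_def tan_def)
  have "fourier_char M 1 k = cis (2 * x)" by (simp add: fourier_char_def x_def mult.assoc)
  moreover have "cos (2 * x) * cos x + sin (2 * x) * sin x = cos x"
    "sin (2 * x) * cos x - cos (2 * x) * sin x = sin x"
    using cos_diff[of "2 * x" x] sin_diff[of "2 * x" x] by simp_all
  ultimately show ?thesis
    using c unfolding minus_divide_left[symmetric] t
    by (simp add: complex_eq_iff field_simps)
qed

section \<open>Minimax for the discrete action\<close>

lemma uniformly_continuous_on_bounded_support:
  fixes f :: "'a::euclidean_space \<Rightarrow> 'b::real_normed_vector"
  assumes cont: "continuous_on UNIV f" and supp: "\<And>z. norm z > L \<Longrightarrow> f z = 0"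
  shows "uniformly_continuous_on UNIV f"
  unfolding uniformly_continuous_on_def
proof (intro allI impI)
  fix e :: real assume e: "e > 0"
  have "uniformly_continuous_on (cball 0 (L + 1)) f"
    by (rule compact_uniformly_continuous) (auto intro: continuous_on_subset[OF cont])
  then obtain d where d: "d > 0"
    "\<And>x y. x \<in> cball 0 (L + 1) \<Longrightarrow> y \<in> cball 0 (L + 1) \<Longrightarrow> dist y x < d \<Longrightarrow> dist (f y) (f x) < e"
    unfolding uniformly_continuous_on_def using e by metis
  have "dist (f y) (f x) < e" if "dist y x < min d 1" for x y
  proof (cases "x \<in> cball 0 (L + 1) \<and> y \<in> cball 0 (L + 1)")
    case False
    moreover have "norm x \<le> norm y + dist y x" "norm y \<le> norm x + dist y x"
      using norm_triangle_sub[of x y] norm_triangle_sub[of y x] by (simp_all add: dist_norm norm_minus_commute)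
    ultimately have "norm x > L" "norm y > L" using that by auto
    then show ?thesis using supp e by simp
  qed (use d that in auto)
  then show "\<exists>d>0. \<forall>x\<in>UNIV. \<forall>x'\<in>UNIV. dist x' x < d \<longrightarrow> dist (f x') (f x) < e"
    using d(1) by (intro exI[of _ "min d 1"]) auto
qed

lemma bounded_range_bounded_support:
  fixes f :: "'a::euclidean_space \<Rightarrow> 'b::real_normed_vector"
  assumes cont: "continuous_on UNIV f" and supp: "\<And>z. norm z > L \<Longrightarrow> f z = 0"
  obtains B where "B > 0" "\<And>z. norm (f z) \<le> B"
proof -
  have "bounded (f ` cball 0 L)"
    by (intro compact_imp_bounded compact_continuous_image continuous_on_subset[OF cont]) auto
  then obtain B where B: "B > 0" "\<And>z. z \<in> cball 0 L \<Longrightarrow> norm (f z) \<le> B"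
    unfolding bounded_pos by auto
  show ?thesis
  proof (rule that[OF B(1)])
    show "norm (f z) \<le> B" for z
      using B supp[of z] by (cases "norm z \<le> L") auto
  qed
qed

section \<open>The quadratic form at infinity; \<open>aniso\<close> is half its gradient\<close>

definition aniso :: "'n::finite \<Rightarrow> real \<Rightarrow> complex ^ 'n \<Rightarrow> complex ^ 'n" where
  "aniso m d z = (\<chi> i. (if i = m then 1 else d) *\<^sub>R z $ i)"

lemma aniso_add: "aniso m d (x + y) = aniso m d x + aniso m d y"
  by (simp add: aniso_def vec_eq_iff scaleR_add_right)

lemma aniso_scaleR: "aniso m d (r *\<^sub>R x) = r *\<^sub>R aniso m d x"
  by (simp add: aniso_def vec_eq_iff)

lemma bounded_linear_aniso: "bounded_linear (aniso m d)"
  by (rule linear_conv_bounded_linear[THEN iffD1], rule linearI) (simp_all add: aniso_add aniso_scaleR)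

lemma aniso_smult: "aniso m d (a *s x) = a *s aniso m d x"
  by (simp add: aniso_def vec_eq_iff)

lemma aniso_sum: "aniso m d (\<Sum>x\<in>A. f x) = (\<Sum>x\<in>A. aniso m d (f x))"
  by (rule linear_sum[OF bounded_linear.linear[OF bounded_linear_aniso]])

lemma aniso_synth: "aniso m d (synth M K c j) = synth M K (\<lambda>k. aniso m d (c k)) j"
  by (simp add: synth_def aniso_sum aniso_smult)

lemma aniso_coef: "aniso m d (coef M v k) = coef M (\<lambda>j. aniso m d (v j)) k"
  by (simp add: coef_def aniso_scaleR aniso_sum aniso_smult)

lemma inner_aniso_swap: "x \<bullet> aniso m d y = y \<bullet> aniso m d x"
  by (simp add: inner_vec_def aniso_def inner_commute mult_ac)

lemma norm_vec_sq: "(norm (x :: complex ^ 'n))\<^sup>2 = (\<Sum>i\<in>UNIV. (cmod (x $ i))\<^sup>2)"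
  by (simp add: norm_vec_def L2_set_def sum_nonneg)

lemma inner_aniso: "x \<bullet> aniso m d x = (\<Sum>i\<in>UNIV. (if i = m then 1 else d) * (cmod (x $ i))\<^sup>2)"
  unfolding inner_vec_def aniso_def vec_lambda_beta inner_scaleR_right power2_norm_eq_inner ..

lemma inner_aniso_ge: "d \<le> 1 \<Longrightarrow> d * (norm x)\<^sup>2 \<le> x \<bullet> aniso m d x"
  unfolding inner_aniso norm_vec_sq sum_distrib_left
  by (intro sum_mono mult_right_mono) auto

lemma inner_aniso_le: "0 \<le> d \<Longrightarrow> d \<le> 1 \<Longrightarrow> x \<bullet> aniso m d x \<le> (norm x)\<^sup>2"
  unfolding inner_aniso norm_vec_sq
proof (intro sum_mono)
  fix i assume "0 \<le> d" "d \<le> 1"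
  then show "(if i = m then 1 else d) * (cmod (x $ i))\<^sup>2 \<le> (cmod (x $ i))\<^sup>2"
    by (simp add: mult_left_le_one_le)
qed

lemma norm_aniso_le:
  assumes "0 \<le> d" "d \<le> 1"
  shows "norm (aniso m d x) \<le> norm x"
proof (rule power2_le_imp_le)
  show "(norm (aniso m d x))\<^sup>2 \<le> (norm x)\<^sup>2"
    unfolding norm_vec_sq aniso_def vec_lambda_beta norm_scaleR
  proof (intro sum_mono)
    fix i
    have "\<bar>if i = m then 1 else d\<bar> * cmod (x $ i) \<le> 1 * cmod (x $ i)"
      by (rule mult_right_mono) (use assms in auto)
    then show "(\<bar>if i = m then 1 else d\<bar> * cmod (x $ i))\<^sup>2 \<le> (cmod (x $ i))\<^sup>2"
      by (intro power_mono) auto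
  qed
qed simp

section \<open>Discrete loops and the action functional\<close>

definition period :: "nat \<Rightarrow> nat" where "period N = 2 * N + 1"
definition freqs :: "nat \<Rightarrow> int set" where "freqs N = {-int N..int N}"

lemma period_pos [simp]: "0 < period N" by (simp add: period_def)
lemma finite_freqs [simp]: "finite (freqs N)" by (simp add: freqs_def)
lemma card_freqs: "card (freqs N) = period N" by (simp add: freqs_def period_def)

lemma freqs_dist: "k \<in> freqs N \<Longrightarrow> l \<in> freqs N \<Longrightarrow> int (period N) dvd k - l \<Longrightarrow> k = l"
  unfolding freqs_def by (rule freq_distinct[OF period_def])

lemma sum_freqs_split:
  fixes f :: "int \<Rightarrow> 'b::ab_group_add"
  shows "sum f (freqs N) = sum f {-int N..0} + sum f {1..int N}"
proof -
  have "freqs N = {-int N..0} \<union> {1..int N}" by (auto simp: freqs_def)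
  then show ?thesis by (simp add: sum.union_disjoint)
qed

text \<open>The hypotheses of the minimax. \<open>H_up\<close> bounds the action from below on the
  small sphere, \<open>H_low\<close> from above on the far faces of the box. \<open>W\<close> has
  bounded support, so almost critical points are governed by the linear part. The ranges of
  \<open>a\<close> and \<open>d\<close> put \<open>a\<close> between the eigenvalues pi and 2 pi,
  and \<open>a * d\<close> between 0 and pi.\<close>

locale asymptotically_quadratic =
  fixes m :: "'n::finite" and d a L C\<^sub>0 C\<^sub>4 :: real
    and H :: "complex ^ 'n \<Rightarrow> real" and V W :: "complex ^ 'n \<Rightarrow> complex ^ 'n" and z\<^sub>0 :: "complex ^ 'n"
  assumes d: "0 < d" "d \<le> 1 / 4"
    and a: "pi < a" "a \<le> 3 * pi / 2"
    and H_deriv: "\<And>z. (H has_derivative (\<lambda>v. V z \<bullet> v)) (at z)"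
    and V_eq: "\<And>z. V z = (2 * a) *\<^sub>R aniso m d z + W z"
    and W_cont: "continuous_on UNIV W"
    and W_supp: "\<And>z. norm z > L \<Longrightarrow> W z = 0"
    and H_nonneg: "\<And>z. 0 \<le> H z"
    and H_low: "\<And>z. a * (z \<bullet> aniso m d z) - C\<^sub>0 \<le> H z"
    and H_up: "\<And>z. H z \<le> C\<^sub>4 * norm (z - z\<^sub>0) ^ 4"
begin

text \<open>The samples are the edge midpoints of a polygon, not its vertices; the vertices are
  recovered later by \<open>nodes\<close>.\<close>

definition loop :: "nat \<Rightarrow> (int \<Rightarrow> complex ^ 'n) \<Rightarrow> nat \<Rightarrow> complex ^ 'n" where
  "loop N c = synth (period N) (freqs N) c"

text \<open>The action functional, with \<open>H\<close> averaged over the midpoints.\<close>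

definition F :: "nat \<Rightarrow> (int \<Rightarrow> complex ^ 'n) \<Rightarrow> real" where
  "F N c = (\<Sum>k\<in>freqs N. midpoint_eig (period N) k * (norm (c k))\<^sup>2) - (1 / real (period N)) * (\<Sum>j<period N. H (loop N c j))"

text \<open>The gradient of \<open>F\<close> for the inner product that adds up
  \<open>c k \<bullet> v k\<close> over the frequencies.\<close>

definition G :: "nat \<Rightarrow> (int \<Rightarrow> complex ^ 'n) \<Rightarrow> int \<Rightarrow> complex ^ 'n" where
  "G N c k = (2 * midpoint_eig (period N) k) *\<^sub>R c k - coef (period N) (\<lambda>j. V (loop N c j)) k"

text \<open>By Parseval this is the root mean square of the loop.\<close>

definition mode_norm :: "nat \<Rightarrow> (int \<Rightarrow> complex ^ 'n) \<Rightarrow> real" where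
  "mode_norm N c = L2_set (\<lambda>k. norm (c k)) (freqs N)"

lemma mode_norm_nonneg [simp]: "0 \<le> mode_norm N c" by (simp add: mode_norm_def)
lemma mode_norm_sq: "(mode_norm N c)\<^sup>2 = (\<Sum>k\<in>freqs N. (norm (c k))\<^sup>2)"
  by (simp add: mode_norm_def L2_set_def sum_nonneg)
lemma norm_le_mode_norm: "k \<in> freqs N \<Longrightarrow> norm (c k) \<le> mode_norm N c"
  unfolding mode_norm_def by (rule member_le_L2_set) auto
lemma mode_norm_scaleR: "mode_norm N (\<lambda>k. r *\<^sub>R c k) = \<bar>r\<bar> * mode_norm N c"
  by (simp add: mode_norm_def L2_set_right_distrib)

lemma continuous_on_H: "continuous_on UNIV H"
  using H_deriv by (meson continuous_at_imp_continuous_on has_derivative_continuous)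

lemma continuous_on_V: "continuous_on UNIV V"
proof -
  have "continuous_on UNIV (\<lambda>z. (2 * a) *\<^sub>R aniso m d z + W z)"
    by (intro continuous_intros W_cont linear_continuous_on bounded_linear_aniso)
  then show ?thesis by (simp only: V_eq[symmetric])
qed

text \<open>A linear map plus a continuous map of bounded support. Uniformity on the whole space is
  what permits one step size for every starting point of the descent.\<close>

lemma uniformly_continuous_on_V: "uniformly_continuous_on UNIV V"
proof -
  have "uniformly_continuous_on UNIV (\<lambda>z. (2 * a) *\<^sub>R aniso m d z + W z)"
    by (intro uniformly_continuous_on_add uniformly_continuous_on_cmul uniformly_continuous_on_bounded_support[OF W_cont W_supp]
        bounded_linear.uniformly_continuous_on[OF bounded_linear_aniso] uniformly_continuous_on_id)
  then show ?thesis by (simp only: V_eq[symmetric])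
qed

text \<open>The mean value theorem along the segment leaves a difference of two values of
  \<open>V\<close>; its uniform continuity takes the place of a bound on second derivatives.\<close>

lemma uniform_taylor:
  assumes "e > 0"
  obtains t where "t > 0" "\<And>z v. norm v < t \<Longrightarrow> \<bar>H (z + v) - H z - V z \<bullet> v\<bar> \<le> e * norm v"
proof -
  obtain t where t: "t > 0" "\<And>x y. dist y x < t \<Longrightarrow> dist (V y) (V x) < e"
    using uniformly_continuous_onE[OF uniformly_continuous_on_V assms] by (metis UNIV_I)
  have "\<bar>H (z + v) - H z - V z \<bullet> v\<bar> \<le> e * norm v" if v: "norm v < t" for z v
  proof -
    have der: "((\<lambda>s. H (z + s *\<^sub>R v)) has_derivative (\<lambda>h. V (z + s *\<^sub>R v) \<bullet> (h *\<^sub>R v))) (at s within {0..1})" for s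
      by (rule has_derivative_compose[OF _ H_deriv]) (auto intro!: derivative_eq_intros)
    have "\<exists>s\<in>{0<..<1}. H (z + 1 *\<^sub>R v) - H (z + 0 *\<^sub>R v) = V (z + s *\<^sub>R v) \<bullet> ((1 - 0) *\<^sub>R v)"
      by (rule mvt_simple[OF zero_less_one der])
    then obtain s where s: "s \<in> {0<..<1}" "H (z + 1 *\<^sub>R v) - H (z + 0 *\<^sub>R v) = V (z + s *\<^sub>R v) \<bullet> ((1 - 0) *\<^sub>R v)"
      ..
    have "\<bar>H (z + v) - H z - V z \<bullet> v\<bar> = \<bar>(V (z + s *\<^sub>R v) - V z) \<bullet> v\<bar>"
      using s(2) by (simp add: inner_diff_left)
    also have "\<dots> \<le> norm (V (z + s *\<^sub>R v) - V z) * norm v" by (rule Cauchy_Schwarz_ineq2)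
    also have "\<dots> \<le> e * norm v"
    proof (rule mult_right_mono)
      have "norm (s *\<^sub>R v) \<le> 1 * norm v" unfolding norm_scaleR by (rule mult_right_mono) (use s in auto)
      then show "norm (V (z + s *\<^sub>R v) - V z) \<le> e"
        using t(2)[of "z + s *\<^sub>R v" z] v by (simp add: dist_norm less_imp_le)
    qed simp
    finally show ?thesis .
  qed
  then show ?thesis using that t(1) by blast
qed

lemma loop_add: "loop N (\<lambda>k. c k + v k) j = loop N c j + loop N v j"
  by (simp add: loop_def synth_def vector_add_ldistrib sum.distrib)

text \<open>The factor \<open>period N\<close> is crude, but it meets only a fixed \<open>N\<close>
  or a gradient of size \<open>1 / (period N)\<^sup>2\<close>.\<close>

lemma norm_loop_le: "norm (loop N v j) \<le> real (period N) * mode_norm N v"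
proof -
  have "norm (loop N v j) \<le> (\<Sum>k\<in>freqs N. norm (v k))"
    unfolding loop_def synth_def by (rule order_trans[OF norm_sum]) (simp add: norm_vector_smult)
  also have "\<dots> \<le> (\<Sum>k\<in>freqs N. mode_norm N v)" by (intro sum_mono norm_le_mode_norm)
  finally show ?thesis by (simp add: card_freqs)
qed

lemma F_step:
  assumes e: "e > 0"
  obtains t where "t > 0" "\<And>c v. mode_norm N v < t \<Longrightarrow>
    F N (\<lambda>k. c k + v k) \<le> F N c + (\<Sum>k\<in>freqs N. G N c k \<bullet> v k) + e * mode_norm N v"
proof -
  define M where "M = real (period N)"
  have M: "M > 0" by (simp add: M_def)
  define Lm where "Lm = (\<Sum>k\<in>freqs N. \<bar>midpoint_eig (period N) k\<bar>)"
  have Lm0: "0 \<le> Lm" by (simp add: Lm_def sum_nonneg)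
  have Lm: "midpoint_eig (period N) k \<le> Lm" if "k \<in> freqs N" for k
    using member_le_sum[of k "freqs N" "\<lambda>k. \<bar>midpoint_eig (period N) k\<bar>"] that by (simp add: Lm_def)
  obtain t where t: "t > 0" "\<And>z v. norm v < t \<Longrightarrow> \<bar>H (z + v) - H z - V z \<bullet> v\<bar> \<le> (e / (2 * M)) * norm v"
    using uniform_taylor[of "e / (2 * M)"] e M by (auto simp: divide_pos_pos)
  \<comment> \<open>The first entry keeps every sample of the shift below \<open>t\<close>; the
    second makes the second-order part of the quadratic form at most \<open>e / 2\<close> times the
    norm of \<open>v\<close>.\<close>
  define t' where "t' = min (t / M) (e / (2 * (Lm + 1)))"
  have t': "t' > 0" using t(1) e M Lm0 by (simp add: t'_def)
  have "F N (\<lambda>k. c k + v k) \<le> F N c + (\<Sum>k\<in>freqs N. G N c k \<bullet> v k) + e * mode_norm N v"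
    if v: "mode_norm N v < t'" for c v
  proof -
    have Hj: "H (loop N c j) + V (loop N c j) \<bullet> loop N v j - e / 2 * mode_norm N v \<le> H (loop N (\<lambda>k. c k + v k) j)" for j
    proof -
      have lv: "norm (loop N v j) \<le> M * mode_norm N v" unfolding M_def by (rule norm_loop_le)
      have "M * mode_norm N v < t" using v M by (simp add: t'_def field_simps)
      with lv have "\<bar>H (loop N c j + loop N v j) - H (loop N c j) - V (loop N c j) \<bullet> loop N v j\<bar>
          \<le> (e / (2 * M)) * norm (loop N v j)" by (intro t(2)) simp
      also have "\<dots> \<le> (e / (2 * M)) * (M * mode_norm N v)" using lv e M by (intro mult_left_mono) auto
      also have "\<dots> = e / 2 * mode_norm N v" using M by simp
      finally show ?thesis unfolding loop_add by linarith
    qed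
    have "(\<Sum>j<period N. H (loop N c j)) + (\<Sum>j<period N. V (loop N c j) \<bullet> loop N v j) - M * (e / 2 * mode_norm N v)
        = (\<Sum>j<period N. H (loop N c j) + V (loop N c j) \<bullet> loop N v j - e / 2 * mode_norm N v)"
      by (simp add: sum.distrib sum_subtractf M_def)
    also have "\<dots> \<le> (\<Sum>j<period N. H (loop N (\<lambda>k. c k + v k) j))" by (intro sum_mono Hj)
    finally have "(1 / M) * ((\<Sum>j<period N. H (loop N c j)) + (\<Sum>j<period N. V (loop N c j) \<bullet> loop N v j) - M * (e / 2 * mode_norm N v))
        \<le> (1 / M) * (\<Sum>j<period N. H (loop N (\<lambda>k. c k + v k) j))"
      using M by (intro mult_left_mono) auto
    then have avg: "(1 / M) * (\<Sum>j<period N. H (loop N c j)) + (1 / M) * (\<Sum>j<period N. V (loop N c j) \<bullet> loop N v j) - e / 2 * mode_norm N v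
        \<le> (1 / M) * (\<Sum>j<period N. H (loop N (\<lambda>k. c k + v k) j))"
      using M by (simp add: algebra_simps)
    have "(\<Sum>k\<in>freqs N. midpoint_eig (period N) k * (norm (c k + v k))\<^sup>2)
        = (\<Sum>k\<in>freqs N. midpoint_eig (period N) k * (norm (c k))\<^sup>2) + (\<Sum>k\<in>freqs N. ((2 * midpoint_eig (period N) k) *\<^sub>R c k) \<bullet> v k)
          + (\<Sum>k\<in>freqs N. midpoint_eig (period N) k * (norm (v k))\<^sup>2)"
      unfolding sum.distrib[symmetric]
      by (intro sum.cong refl) (simp add: power2_norm_eq_inner inner_add_left inner_add_right inner_commute algebra_simps)
    also have "(\<Sum>k\<in>freqs N. midpoint_eig (period N) k * (norm (v k))\<^sup>2) \<le> Lm * (mode_norm N v)\<^sup>2"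
      unfolding mode_norm_sq sum_distrib_left by (intro sum_mono mult_right_mono Lm) auto
    also have "\<dots> \<le> (Lm + 1) * mode_norm N v * mode_norm N v"
      by (simp add: power2_eq_square algebra_simps)
    also have "\<dots> \<le> e / 2 * mode_norm N v"
      using v Lm0 by (intro mult_right_mono) (simp_all add: t'_def field_simps)
    finally have quad: "(\<Sum>k\<in>freqs N. midpoint_eig (period N) k * (norm (c k + v k))\<^sup>2)
        \<le> (\<Sum>k\<in>freqs N. midpoint_eig (period N) k * (norm (c k))\<^sup>2) + (\<Sum>k\<in>freqs N. ((2 * midpoint_eig (period N) k) *\<^sub>R c k) \<bullet> v k) + e / 2 * mode_norm N v"
      by simp
    have "(\<Sum>k\<in>freqs N. G N c k \<bullet> v k) = (\<Sum>k\<in>freqs N. ((2 * midpoint_eig (period N) k) *\<^sub>R c k) \<bullet> v k)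
        - (1 / M) * (\<Sum>j<period N. V (loop N c j) \<bullet> loop N v j)"
      by (simp add: G_def inner_diff_left sum_subtractf sum_coef_inner M_def loop_def)
    then show ?thesis using avg quad by (simp add: F_def M_def)
  qed
  then show ?thesis using that t' by blast
qed

lemma continuous_on_loop: "continuous_on UNIV (\<lambda>c. loop N c j)"
  unfolding loop_def synth_def by (intro continuous_intros) auto

lemma continuous_on_F: "continuous_on UNIV (F N)"
  unfolding F_def
  by (intro continuous_intros continuous_on_compose2[OF continuous_on_H continuous_on_loop]) auto

lemma continuous_on_G: "continuous_on UNIV (\<lambda>c. G N c k)"
  unfolding G_def coef_def
  by (intro continuous_intros continuous_on_compose2[OF continuous_on_V continuous_on_loop]) auto

text \<open>A single step of the gradient descent, damped where \<open>F\<close> is small, replaces the flow of a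
  pseudo-gradient field: \<open>V\<close> is only continuous.\<close>

lemma descent_map:
  assumes \<beta>: "\<beta> > 0" and g: "g > 0"
    and big: "\<And>c. \<beta> / 2 \<le> F N c \<Longrightarrow> g \<le> mode_norm N (G N c)"
  obtains T \<kappa> where "continuous_on UNIV T" "\<kappa> > 0" "\<And>c. F N (T c) \<le> F N c"
    "\<And>c. F N c \<le> \<beta> / 2 \<Longrightarrow> T c = c" "\<And>c. \<beta> \<le> F N c \<Longrightarrow> F N (T c) \<le> F N c - \<kappa>"
proof -
  obtain t where t: "t > 0" and step: "\<And>c v. mode_norm N v < t \<Longrightarrow>
    F N (\<lambda>k. c k + v k) \<le> F N c + (\<Sum>k\<in>freqs N. G N c k \<bullet> v k) + (g / 2) * mode_norm N v"
    using F_step[of "g / 2" N] g by auto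
  \<comment> \<open>The damping: 0 where \<open>F\<close> is at most \<open>\<beta> / 2\<close>, and
    1 where it is at least \<open>\<beta>\<close>.\<close>
  define \<phi> where "\<phi> = (\<lambda>c. max 0 (min 1 (2 * F N c / \<beta> - 1)))"
  \<comment> \<open>The denominator bounds the length of the step by \<open>t / 2\<close>, within
    the reach of \<open>step\<close>, and keeps \<open>s\<close> continuous where the gradient
    vanishes.\<close>
  define s where "s = (\<lambda>c. (t / 2) * \<phi> c / (1 + mode_norm N (G N c)))"
  define T where "T = (\<lambda>c k. c k + (- s c) *\<^sub>R G N c k)"
  \<comment> \<open>With gradient norm \<open>n \<ge> g\<close> and no damping, the drop is
    \<open>(t / 2) * (n / (1 + n)) * (n - g / 2)\<close>. Both factors increase with
    \<open>n\<close>, and \<open>\<kappa>\<close> is the value at \<open>g\<close>.\<close>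
  define \<kappa> where "\<kappa> = (t / 2) * (g / (1 + g)) * (g / 2)"
  have \<phi>: "0 \<le> \<phi> c" "\<phi> c \<le> 1" for c by (auto simp: \<phi>_def)
  have s0: "0 \<le> s c" for c using \<phi>[of c] t by (simp add: s_def add_nonneg_nonneg)
  have drop: "F N (T c) \<le> F N c - s c * mode_norm N (G N c) * (mode_norm N (G N c) - g / 2)" for c
  proof -
    define n where "n = mode_norm N (G N c)"
    have n: "0 \<le> n" by (simp add: n_def)
    have nv: "mode_norm N (\<lambda>k. (- s c) *\<^sub>R G N c k) = s c * n"
      using s0[of c] by (simp only: mode_norm_scaleR n_def abs_minus_cancel abs_of_nonneg)
    have "s c * n = (t / 2) * (\<phi> c * (n / (1 + n)))" by (simp add: s_def n_def)
    also have "\<dots> \<le> (t / 2) * (1 * 1)"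
      using t \<phi>[of c] n by (intro mult_left_mono mult_mono) auto
    finally have "s c * n < t" using t by simp
    then have "F N (T c) \<le> F N c + (\<Sum>k\<in>freqs N. G N c k \<bullet> ((- s c) *\<^sub>R G N c k)) + (g / 2) * (s c * n)"
      unfolding T_def using step[of "\<lambda>k. (- s c) *\<^sub>R G N c k" c] nv by simp
    also have "(\<Sum>k\<in>freqs N. G N c k \<bullet> ((- s c) *\<^sub>R G N c k)) = - (s c * n\<^sup>2)"
      by (simp add: n_def mode_norm_sq sum_negf sum_distrib_left power2_norm_eq_inner)
    finally show ?thesis unfolding n_def by (simp add: power2_eq_square algebra_simps)
  qed
  show ?thesis
  proof (rule that[of T \<kappa>])
    have nz: "1 + mode_norm N (G N c) \<noteq> 0" for c using mode_norm_nonneg[of N "G N c"] by linarith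
    have "continuous_on UNIV s"
      unfolding s_def \<phi>_def mode_norm_def L2_set_def
      by (intro continuous_intros continuous_on_F continuous_on_G)
         (use nz \<beta> in \<open>auto simp: mode_norm_def L2_set_def\<close>)
    then show "continuous_on UNIV T"
      unfolding T_def by (intro continuous_intros continuous_on_G) auto
    show "\<kappa> > 0" using t g by (simp add: \<kappa>_def)
    show fix_T: "T c = c" if "F N c \<le> \<beta> / 2" for c
    proof -
      have "2 * F N c / \<beta> \<le> 1" using that \<beta> by (simp add: field_simps)
      then have "\<phi> c = 0" by (simp add: \<phi>_def)
      then show ?thesis by (simp add: T_def s_def)
    qed
    show "F N (T c) \<le> F N c" for c
    proof (cases "F N c \<le> \<beta> / 2")
      case False
      then have "0 \<le> s c * mode_norm N (G N c) * (mode_norm N (G N c) - g / 2)"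
        using s0[of c] big[of c] g by (intro mult_nonneg_nonneg) auto
      then show ?thesis using drop[of c] by linarith
    qed (simp add: fix_T)
    show "F N (T c) \<le> F N c - \<kappa>" if "\<beta> \<le> F N c" for c
    proof -
      define n where "n = mode_norm N (G N c)"
      have n: "g \<le> n" using big[of c] that \<beta> by (simp add: n_def)
      have "1 \<le> 2 * F N c / \<beta> - 1" using that \<beta> by (simp add: field_simps)
      then have "\<phi> c = 1" by (simp add: \<phi>_def)
      then have sn: "s c * n = (t / 2) * (n / (1 + n))" by (simp add: s_def n_def)
      have "g / (1 + g) \<le> n / (1 + n)" using n g by (simp add: field_simps)
      then have "\<kappa> \<le> s c * n * (n - g / 2)"
        unfolding \<kappa>_def sn using t g n by (intro mult_mono) auto
      then show ?thesis using drop[of c] by (simp add: n_def)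
    qed
  qed
qed

text \<open>Each step gains at least \<open>\<kappa>\<close> while \<open>F\<close> is at least
  \<open>\<beta>\<close>, so more than \<open>B / \<kappa>\<close> iterations bring everything that
  starts below \<open>B\<close> under \<open>\<beta>\<close>.\<close>

lemma deformation:
  assumes \<beta>: "\<beta> > 0" and g: "g > 0"
    and big: "\<And>c. \<beta> / 2 \<le> F N c \<Longrightarrow> g \<le> mode_norm N (G N c)"
  obtains S where "continuous_on UNIV S" "\<And>c. F N c \<le> \<beta> / 2 \<Longrightarrow> S c = c"
    "\<And>c. F N c \<le> B \<Longrightarrow> F N (S c) < \<beta>"
proof -
  obtain T \<kappa> where T: "continuous_on UNIV T" "\<kappa> > 0" "\<And>c. F N (T c) \<le> F N c"
    "\<And>c. F N c \<le> \<beta> / 2 \<Longrightarrow> T c = c" "\<And>c. \<beta> \<le> F N c \<Longrightarrow> F N (T c) \<le> F N c - \<kappa>"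
    using descent_map[OF \<beta> g big] by blast
  obtain n :: nat where n: "B < real n * \<kappa>" using reals_Archimedean3[OF T(2)] by blast
  have mono: "F N ((T ^^ i) c) < \<beta> \<or> F N ((T ^^ i) c) \<le> F N c - real i * \<kappa>" for i c
  proof (induction i)
    case (Suc i)
    consider "F N ((T ^^ i) c) < \<beta>" | "\<beta> \<le> F N ((T ^^ i) c)" "F N ((T ^^ i) c) \<le> F N c - real i * \<kappa>"
      using Suc by linarith
    then show ?case
    proof cases
      case 1
      then show ?thesis using T(3)[of "(T ^^ i) c"] by auto
    next
      case 2
      then show ?thesis using T(5)[of "(T ^^ i) c"] by (auto simp: algebra_simps)
    qed
  qed auto
  show ?thesis
  proof (rule that[of "T ^^ n"])
    have "continuous_on UNIV (T ^^ i)" for i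
      by (induction i) (auto intro!: continuous_on_compose2[OF T(1)] simp: o_def id_def)
    then show "continuous_on UNIV (T ^^ n)" .
    show "(T ^^ n) c = c" if "F N c \<le> \<beta> / 2" for c
    proof -
      have "(T ^^ i) c = c" for i by (induction i) (auto simp: T(4)[OF that])
      then show ?thesis .
    qed
    show "F N ((T ^^ n) c) < \<beta>" if "F N c \<le> B" for c
      using mono[of n c] n that \<beta> by linarith
  qed
qed

section \<open>Linking: bounds of the action on the box and on the sphere\<close>

lemma avg_inner_aniso_loop:
  "(1 / real (period N)) * (\<Sum>j<period N. loop N c j \<bullet> aniso m d (loop N c j)) = (\<Sum>k\<in>freqs N. c k \<bullet> aniso m d (c k))"
  unfolding loop_def aniso_synth by (rule parseval_inner) (auto intro: freqs_dist)

lemma F_le: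
  "F N c \<le> (\<Sum>k\<in>freqs N. midpoint_eig (period N) k * (norm (c k))\<^sup>2 - a * (c k \<bullet> aniso m d (c k))) + C\<^sub>0"
proof -
  have "a * (\<Sum>j<period N. loop N c j \<bullet> aniso m d (loop N c j)) - real (period N) * C\<^sub>0 
      = (\<Sum>j<period N. a * (loop N c j \<bullet> aniso m d (loop N c j)) - C\<^sub>0)"
    by (simp add: sum_subtractf sum_distrib_left)
  also have "\<dots> \<le> (\<Sum>j<period N. H (loop N c j))"
    by (intro sum_mono H_low)
  finally have "(1 / real (period N)) * (a * (\<Sum>j<period N. loop N c j \<bullet> aniso m d (loop N c j)) - real (period N) * C\<^sub>0)
      \<le> (1 / real (period N)) * (\<Sum>j<period N. H (loop N c j))"
    by (intro mult_left_mono) auto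
  moreover have "(1 / real (period N)) * (a * (\<Sum>j<period N. loop N c j \<bullet> aniso m d (loop N c j)) - real (period N) * C\<^sub>0)
      = a * (\<Sum>k\<in>freqs N. c k \<bullet> aniso m d (c k)) - C\<^sub>0"
    unfolding avg_inner_aniso_loop[symmetric] using period_pos[of N] by (simp add: field_simps)
  ultimately show ?thesis unfolding F_def sum_subtractf sum_distrib_left[symmetric] by linarith
qed

text \<open>The sphere is measured by the quadratic form itself and is centred at the constant loop
  \<open>z\<^sub>0\<close>. The quadratic part is \<open>A\<close> there, whereas
  \<open>H_up\<close> and \<open>L4_bound\<close> make the mean of \<open>H\<close> of order
  \<open>A\<^sup>2\<close>, uniformly in \<open>N\<close>.\<close>

lemma F_sphere:
  obtains A where "A > 0" "\<And>N c. (\<And>k. k \<in> {-int N..-1} \<Longrightarrow> c k = 0) \<Longrightarrow> c 0 = z\<^sub>0 \<Longrightarrow>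
     (\<Sum>k\<in>{1..int N}. midpoint_eig (period N) k * (norm (c k))\<^sup>2) = A \<Longrightarrow> A / 2 \<le> F N c"
proof -
  define n where "n = real CARD('n)"
  have n: "n > 0" by (simp add: n_def)
  define E where "E = \<bar>C\<^sub>4\<bar> + 1"
  have E: "E > 0" "C\<^sub>4 \<le> E" by (auto simp: E_def)
  \<comment> \<open>Solves \<open>E * n * A / pi\<^sup>2 = 1 / 2\<close>, so that the mean of
    \<open>H\<close> takes at most half of the quadratic part.\<close>
  define A where "A = pi\<^sup>2 / (2 * n * E)"
  have A: "A > 0" using n E by (simp add: A_def)
  have "A / 2 \<le> F N c" if neg: "\<And>k. k \<in> {-int N..-1} \<Longrightarrow> c k = 0" and c0: "c 0 = z\<^sub>0"
    and sph: "(\<Sum>k\<in>{1..int N}. midpoint_eig (period N) k * (norm (c k))\<^sup>2) = A" for N c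
  proof -
    define Q where "Q = (\<Sum>k\<in>{1..int N}. real_of_int k * (norm (c k))\<^sup>2)"
    have "pi * Q \<le> A"
      unfolding sph[symmetric] Q_def sum_distrib_left mult.assoc[symmetric]
      by (intro sum_mono mult_right_mono midpoint_eig_ge[OF period_def]) auto
    moreover have Q0: "0 \<le> Q" unfolding Q_def by (intro sum_nonneg) auto
    ultimately have "(pi * Q)\<^sup>2 \<le> A\<^sup>2" by (intro power_mono) auto
    then have Q2: "Q\<^sup>2 \<le> A\<^sup>2 / pi\<^sup>2" by (simp add: power_mult_distrib field_simps)
    have neg0: "sum f {-int N..0} = f 0" if "\<And>k. k \<in> {-int N..-1} \<Longrightarrow> f k = 0" for f :: "int \<Rightarrow> 'b::ab_group_add"
    proof -
      have "sum f {-int N..0} = sum f {0}" by (rule sum.mono_neutral_right) (use that in auto)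
      then show ?thesis by simp
    qed
    have modes: "(\<Sum>k\<in>{-int N..0}. fourier_char (period N) j k *s c k) = z\<^sub>0" for j
      using neg0[of "\<lambda>k. fourier_char (period N) j k *s c k"] neg c0 by simp
    have loop: "loop N c j - z\<^sub>0 = synth (period N) {1..int N} c j" for j
      unfolding loop_def synth_def sum_freqs_split modes by simp
    have "H (loop N c j) \<le> E * norm (synth (period N) {1..int N} c j) ^ 4" for j
      using H_up[of "loop N c j"] mult_right_mono[OF E(2), of "norm (loop N c j - z\<^sub>0) ^ 4"]
      unfolding loop by simp
    then have "(\<Sum>j<period N. H (loop N c j)) \<le> (\<Sum>j<period N. E * norm (synth (period N) {1..int N} c j) ^ 4)"
      by (intro sum_mono)
    then have "(1 / real (period N)) * (\<Sum>j<period N. H (loop N c j))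
        \<le> E * ((1 / real (period N)) * (\<Sum>j<period N. norm (synth (period N) {1..int N} c j) ^ 4))"
      by (simp add: sum_distrib_left[symmetric] divide_right_mono)
    also have "\<dots> \<le> E * (n * Q\<^sup>2)"
      unfolding n_def Q_def using E by (intro mult_left_mono L4_bound[OF period_def]) auto
    also have "\<dots> \<le> E * (n * (A\<^sup>2 / pi\<^sup>2))"
      using E n Q2 by (intro mult_left_mono) auto
    also have "\<dots> = A * (E * n * A / pi\<^sup>2)" by (simp add: power2_eq_square)
    also have "E * n * A / pi\<^sup>2 = 1 / 2" using E n by (simp add: A_def)
    finally have "(1 / real (period N)) * (\<Sum>j<period N. H (loop N c j)) \<le> A / 2" by simp
    moreover have "(\<Sum>k\<in>freqs N. midpoint_eig (period N) k * (norm (c k))\<^sup>2) = A"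
      using neg0[of "\<lambda>k. midpoint_eig (period N) k * (norm (c k))\<^sup>2"] neg sph
      unfolding sum_freqs_split by simp
    ultimately show ?thesis by (simp add: F_def)
  qed
  then show ?thesis using that A by blast
qed

text \<open>The box consists of the modes \<open>k \<le> 0\<close> and of a half line in the first mode of the disc
  coordinate; \<open>F \<le> 0\<close> on its faces. The deformation leaves the faces fixed, so by
  the intermediate value theorem of Poincare and Miranda its image still meets the sphere
  where \<open>A / 2 \<le> F\<close>.\<close>

lemma almost_critical:
  assumes N: "N \<ge> 1" and la: "midpoint_eig (period N) 1 < a" and g: "g > 0" and A: "A > 0"
    and sphere: "\<And>c. (\<And>k. k \<in> {-int N..-1} \<Longrightarrow> c k = 0) \<Longrightarrow> c 0 = z\<^sub>0 \<Longrightarrow>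
     (\<Sum>k\<in>{1..int N}. midpoint_eig (period N) k * (norm (c k))\<^sup>2) = A \<Longrightarrow> A / 2 \<le> F N c"
  obtains c where "A / 4 \<le> F N c" "mode_norm N (G N c) < g"
proof (rule ccontr)
  assume "\<not> thesis"
  then have big: "A / 4 \<le> F N c \<Longrightarrow> g \<le> mode_norm N (G N c)" for c
    using that[of c] by linarith
  define l where "l = midpoint_eig (period N) 1"
  have l: "pi \<le> l" using midpoint_eig_ge[OF period_def, of 1 N] N by (simp add: l_def)
  then have l1: "1 \<le> l" using pi_ge_two by linarith
  \<comment> \<open>The half side of the box. Its summands serve, in order: the far end of the half
    line, the faces of the modes \<open>k \<le> 0\<close>, room for the target
    \<open>z\<^sub>0\<close>, and a half line long enough to cross the sphere.\<close>
  define \<tau> where "\<tau> = 1 + \<bar>C\<^sub>0\<bar> / (a - l) + \<bar>C\<^sub>0\<bar> / (a * d) + norm z\<^sub>0 + A"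
  have al: "0 < a - l" using la by (simp add: l_def)
  have a0: "0 < a" using a pi_gt_zero by linarith
  then have ad: "0 < a * d" using d by simp
  have nn: "0 \<le> \<bar>C\<^sub>0\<bar> / (a - l)" "0 \<le> \<bar>C\<^sub>0\<bar> / (a * d)" using al ad by (auto intro!: divide_nonneg_pos)
  have \<tau>1: "1 \<le> \<tau>" using nn A by (simp add: \<tau>_def)
  then have \<tau>\<tau>: "\<tau> \<le> \<tau>\<^sup>2" by (simp add: power2_eq_square)
  have "\<bar>C\<^sub>0\<bar> / (a - l) \<le> \<tau>\<^sup>2" using nn A \<tau>\<tau> norm_ge_zero[of z\<^sub>0] unfolding \<tau>_def by linarith
  then have \<tau>2: "C\<^sub>0 \<le> (a - l) * \<tau>\<^sup>2" using al by (simp add: divide_le_eq mult.commute)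
  have "\<bar>C\<^sub>0\<bar> / (a * d) \<le> \<tau>\<^sup>2" using nn A \<tau>\<tau> norm_ge_zero[of z\<^sub>0] unfolding \<tau>_def by linarith
  then have \<tau>3: "C\<^sub>0 \<le> a * d * \<tau>\<^sup>2" using ad by (simp add: divide_le_eq mult.commute)
  have \<tau>4: "norm z\<^sub>0 \<le> \<tau>" using nn A by (simp add: \<tau>_def)
  have "A \<le> \<tau>\<^sup>2" using nn A \<tau>\<tau> norm_ge_zero[of z\<^sub>0] unfolding \<tau>_def by linarith
  then have \<tau>5: "A \<le> l * \<tau>\<^sup>2" using mult_right_mono[OF l1, of "\<tau>\<^sup>2"] by simp
  \<comment> \<open>Real coordinates of the box: \<open>None\<close> is the position on the half
    line, and \<open>Some (k, i, b)\<close> is the real or imaginary part, according to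
    \<open>b\<close>, of component \<open>i\<close> of mode \<open>k\<close>.\<close>
  define C :: "((int \<times> 'n \<times> bool) option \<Rightarrow> real) \<Rightarrow> int \<Rightarrow> complex ^ 'n" where
    "C = (\<lambda>x k. if k \<in> {-int N..0} then (\<chi> i. Complex (x (Some (k, i, True))) (x (Some (k, i, False))))
       else if k = 1 then axis m (complex_of_real (x None)) else 0)"
  have split1: "sum f {1..int N} = f 1 + sum f {2..int N}" for f :: "int \<Rightarrow> real"
  proof -
    have "{1..int N} = insert 1 {2..int N}" using N by auto
    then show ?thesis by simp
  qed
  have C1: "C x 1 = axis m (complex_of_real (x None))" for x by (simp add: C_def)
  have C2: "k \<ge> 2 \<Longrightarrow> C x k = 0" for x k by (simp add: C_def)
  have nC1: "(norm (C x 1))\<^sup>2 = (x None)\<^sup>2" for x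
  proof -
    have "(norm (C x 1))\<^sup>2 = (\<Sum>i\<in>UNIV. if i = m then (x None)\<^sup>2 else 0)"
      unfolding norm_vec_sq C1 axis_def by (intro sum.cong refl) auto
    then show ?thesis by simp
  qed
  have iC1: "C x 1 \<bullet> aniso m d (C x 1) = (x None)\<^sup>2" for x
  proof -
    have "C x 1 \<bullet> aniso m d (C x 1) = (\<Sum>i\<in>UNIV. if i = m then (x None)\<^sup>2 else 0)"
      unfolding inner_aniso C1 axis_def by (intro sum.cong refl) auto
    then show ?thesis by simp
  qed
  have F1: "F N (C x) \<le> l * (x None)\<^sup>2" for x
  proof -
    have "F N (C x) \<le> (\<Sum>k\<in>freqs N. midpoint_eig (period N) k * (norm (C x k))\<^sup>2)"
      by (simp add: F_def sum_nonneg H_nonneg)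
    also have "\<dots> \<le> l * (x None)\<^sup>2"
      unfolding sum_freqs_split split1 nC1
      by (auto simp: C2 l_def intro!: sum_nonpos mult_nonpos_nonneg midpoint_eig_nonpos[OF period_def])
    finally show ?thesis .
  qed
  have F2: "F N (C x) \<le> (l - a) * (x None)\<^sup>2 - a * d * (\<Sum>k\<in>{-int N..0}. (norm (C x k))\<^sup>2) + C\<^sub>0" for x
  proof -
    have "(\<Sum>k\<in>{-int N..0}. midpoint_eig (period N) k * (norm (C x k))\<^sup>2 - a * (C x k \<bullet> aniso m d (C x k)))
        \<le> (\<Sum>k\<in>{-int N..0}. - (a * d * (norm (C x k))\<^sup>2))"
    proof (rule sum_mono)
      fix k assume "k \<in> {-int N..0}"
      then have "midpoint_eig (period N) k * (norm (C x k))\<^sup>2 \<le> 0"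
        by (intro mult_nonpos_nonneg midpoint_eig_nonpos[OF period_def]) auto
      moreover have "a * (d * (norm (C x k))\<^sup>2) \<le> a * (C x k \<bullet> aniso m d (C x k))"
        using a0 d by (intro mult_left_mono inner_aniso_ge) auto
      ultimately show "midpoint_eig (period N) k * (norm (C x k))\<^sup>2 - a * (C x k \<bullet> aniso m d (C x k)) \<le> - (a * d * (norm (C x k))\<^sup>2)"
        by simp
    qed
    also have "\<dots> = - (a * d * (\<Sum>k\<in>{-int N..0}. (norm (C x k))\<^sup>2))"
      by (simp add: sum_negf sum_distrib_left)
    finally show ?thesis
      using F_le[of N "C x"] unfolding sum_freqs_split split1 nC1 iC1
      by (simp add: C2 l_def aniso_def algebra_simps)
  qed
  \<comment> \<open>The level \<open>A / 2\<close> is the bound known on the sphere, so that a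
    strict inequality below it contradicts an intersection; \<open>l * \<tau>\<^sup>2\<close> bounds
    \<open>F\<close> on the whole box by \<open>F1\<close>.\<close>
  obtain S where S: "continuous_on UNIV S" "\<And>c. F N c \<le> A / 2 / 2 \<Longrightarrow> S c = c"
    "\<And>c. F N c \<le> l * \<tau>\<^sup>2 \<Longrightarrow> F N (S c) < A / 2"
    using deformation[of "A / 2" g N "l * \<tau>\<^sup>2"] A g big by auto
  define I where "I = insert None (Some ` ({-int N..0} \<times> (UNIV :: 'n set) \<times> (UNIV :: bool set)))"
  define lo :: "(int \<times> 'n \<times> bool) option \<Rightarrow> real" where "lo = (\<lambda>i. case i of None \<Rightarrow> 0 | Some _ \<Rightarrow> - \<tau>)"
  define part where "part = (\<lambda>(c :: int \<Rightarrow> complex ^ 'n) (k, i, b). if b then Re (c k $ i) else Im (c k $ i))"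
  \<comment> \<open>One equation per parameter: the quadratic form of all positive modes must equal
    \<open>A\<close>, and the modes \<open>k \<le> 0\<close> must be those of the constant loop
    \<open>z\<^sub>0\<close>. A common solution is a point of the sphere.\<close>
  define G' where "G' = (\<lambda>c i. case i of None \<Rightarrow> (\<Sum>k\<in>{1..int N}. midpoint_eig (period N) k * (norm (c k))\<^sup>2) | Some q \<Rightarrow> part c q)"
  define p where "p = (\<lambda>i. case i of None \<Rightarrow> A | Some q \<Rightarrow> part (\<lambda>k. if k = 0 then z\<^sub>0 else 0) q)"
  have partC: "part (C x) q = x (Some q)" if "Some q \<in> I" for x q
    using that by (auto simp: part_def C_def I_def split: prod.splits)
  have G'None: "G' (C x) None = l * (x None)\<^sup>2" for x
    unfolding G'_def option.case split1 nC1 by (simp add: C2 l_def)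
  have face_vals: "G' (C x) i = (if i = None then l * (x None)\<^sup>2 else x i)" if "i \<in> I" for i x
    using that partC G'None by (cases i) (auto simp: G'_def)
  have p_None: "p None = A" by (simp add: p_def)
  have part_le: "\<bar>part c (k, i, b)\<bar> \<le> norm (c k)" for c k i b
    using abs_Re_le_cmod[of "c k $ i"] abs_Im_le_cmod[of "c k $ i"] Finite_Cartesian_Product.norm_nth_le[of "c k" i]
    by (auto simp: part_def)
  have p_bound: "\<bar>p (Some q)\<bar> \<le> \<tau>" for q
  proof (cases q)
    case (fields k i b)
    then show ?thesis
      using part_le[of "\<lambda>k. if k = 0 then z\<^sub>0 else 0" k i b] \<tau>4 \<tau>1 by (auto simp: p_def split: if_splits)
  qed
  \<comment> \<open>Where the half-line coordinate vanishes only nonpositive modes remain and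
    \<open>F1\<close> suffices. Elsewhere some coordinate has size \<open>\<tau>\<close>, and the
    quadratic growth of \<open>H\<close> in \<open>F2\<close> wins.\<close>
  have face: "F N (C x) \<le> 0"
    if x: "\<And>j. lo j \<le> x j \<and> x j \<le> \<tau>" and i: "i \<in> I" "x i = lo i \<or> x i = \<tau>" for x i
  proof (cases "x None = 0")
    case True
    then show ?thesis using F1[of x] by simp
  next
    case False
    have s0: "0 \<le> a * d * (\<Sum>k\<in>{-int N..0}. (norm (C x k))\<^sup>2)"
      using ad by (intro mult_nonneg_nonneg[OF less_imp_le] sum_nonneg) auto
    have s1: "(l - a) * (x None)\<^sup>2 \<le> 0" using al by (intro mult_nonpos_nonneg) auto
    show ?thesis
    proof (cases i)
      case None
      then have "x None = \<tau>" using i False by (auto simp: lo_def)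
      then show ?thesis using F2[of x] s0 \<tau>2 by (simp add: algebra_simps)
    next
      case (Some q)
      obtain k i' b where q: "q = (k, i', b)" by (cases q)
      then have k: "k \<in> {-int N..0}" using i Some by (auto simp: I_def)
      have "\<bar>part (C x) q\<bar> = \<tau>" using i Some partC[of q x] \<tau>1 by (auto simp: lo_def)
      then have "\<tau> \<le> norm (C x k)" using part_le[of "C x" k i' b] q by simp
      then have "\<tau>\<^sup>2 \<le> (norm (C x k))\<^sup>2" using \<tau>1 by (intro power_mono) auto
      also have "\<dots> \<le> (\<Sum>k\<in>{-int N..0}. (norm (C x k))\<^sup>2)"
        using k by (intro member_le_sum) auto
      finally have "a * d * \<tau>\<^sup>2 \<le> a * d * (\<Sum>k\<in>{-int N..0}. (norm (C x k))\<^sup>2)"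
        using ad by (intro mult_left_mono[OF _ less_imp_le])
      then show ?thesis using F2[of x] s1 \<tau>3 by linarith
    qed
  qed
  have SC: "S (C x) = C x" if "F N (C x) \<le> 0" for x using S(2)[of "C x"] that A by simp
  have cC: "continuous_on UNIV (\<lambda>x. C x k)" for k
  proof -
    have "continuous_on UNIV (\<lambda>x. \<chi> i. Complex (x (Some (k, i, True))) (x (Some (k, i, False))))"
      by (intro continuous_on_vec_lambda continuous_on_Complex) auto
    moreover have "continuous_on UNIV (\<lambda>x. axis m (complex_of_real (x None)))"
      unfolding axis_def
    proof (intro continuous_on_vec_lambda)
      fix i
      show "continuous_on UNIV (\<lambda>x. if i = m then complex_of_real (x None) else 0)"
        by (cases "i = m") (auto intro!: continuous_intros)
    qed
    ultimately show ?thesis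
      unfolding C_def by (cases "k \<in> {-int N..0}"; cases "k = 1") (simp_all only: if_True if_False simp_thms continuous_on_const)
  qed
  have cSC: "continuous_on UNIV (\<lambda>x. S (C x) k)" for k
  proof -
    have "continuous_on UNIV (\<lambda>x. S (C x))"
      by (rule continuous_on_compose2[OF S(1)]) (use cC in \<open>auto intro!: continuous_on_coordinatewise_then_product\<close>)
    then show ?thesis by (rule continuous_on_product_then_coordinatewise)
  qed
  obtain x where x: "\<And>j. lo j \<le> x j \<and> x j \<le> \<tau>" and hit: "\<And>i. i \<in> I \<Longrightarrow> G' (S (C x)) i = p i"
  proof (rule poincare_miranda[of I lo "\<lambda>_. \<tau>" "\<lambda>x i. G' (S (C x)) i" p])
    show "finite I" by (simp add: I_def)
    show "lo i < \<tau>" for i using \<tau>1 by (cases i) (auto simp: lo_def)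
    show "continuous_on UNIV (\<lambda>x. G' (S (C x)) i)" for i
    proof (cases i)
      case None
      then show ?thesis by (simp add: G'_def) (intro continuous_intros cSC)
    next
      case (Some q)
      obtain k j b where q: "q = (k, j, b)" by (cases q)
      then show ?thesis using Some
        by (cases b) (auto simp: G'_def part_def intro!: continuous_intros cSC)
    qed
    show "G' (S (C x)) i \<le> p i" if "\<And>j. lo j \<le> x j \<and> x j \<le> \<tau>" "i \<in> I" "x i = lo i" for x i
    proof -
      have "S (C x) = C x" using face[OF that(1,2)] that(3) SC by blast
      then show ?thesis
        using that(2,3) face_vals[of i x] p_bound[of "the i"] A by (cases i) (auto simp: lo_def abs_le_iff p_None)
    qed
    show "p i \<le> G' (S (C x)) i" if "\<And>j. lo j \<le> x j \<and> x j \<le> \<tau>" "i \<in> I" "x i = \<tau>" for x i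
    proof -
      have "S (C x) = C x" using face[OF that(1,2)] that(3) SC by blast
      then show ?thesis
        using that(2,3) face_vals[of i x] p_bound[of "the i"] \<tau>5 by (cases i) (auto simp: abs_le_iff p_None)
    qed
  qed auto
  define c where "c = S (C x)"
  have "\<bar>x None\<bar> \<le> \<bar>\<tau>\<bar>" using x[of None] by (auto simp: lo_def)
  then have "(x None)\<^sup>2 \<le> \<tau>\<^sup>2" by (simp add: abs_le_square_iff)
  then have "l * (x None)\<^sup>2 \<le> l * \<tau>\<^sup>2" using l1 by (intro mult_left_mono) auto
  then have "F N c < A / 2" using F1[of x] S(3)[of "C x"] by (simp add: c_def)
  moreover have ck: "c k = (if k = 0 then z\<^sub>0 else 0)" if k: "k \<in> {-int N..0}" for k
  proof -
    have part: "part c (k, i, b) = part (\<lambda>k. if k = 0 then z\<^sub>0 else 0) (k, i, b)" for i b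
      using hit[of "Some (k, i, b)"] k by (simp add: G'_def p_def I_def c_def)
    have "c k $ i = (if k = 0 then z\<^sub>0 else 0) $ i" for i
      using part[of i True] part[of i False] by (simp add: part_def complex_eq_iff)
    then show ?thesis by (simp add: vec_eq_iff)
  qed
  moreover have "A / 2 \<le> F N c"
  proof (rule sphere)
    show "(\<Sum>k\<in>{1..int N}. midpoint_eig (period N) k * (norm (c k))\<^sup>2) = A"
      using hit[of None] by (simp add: G'_def p_def I_def c_def)
  qed (simp_all add: ck)
  ultimately show False by linarith
qed

end

section \<open>Convergence of the midpoint rule\<close>

definition ramp :: "real \<Rightarrow> real" where "ramp u = max 0 (min 1 u)"

lemma sum_ramp: "(\<Sum>j<n. ramp (u - real j)) = max 0 (min (real n) u)"
  by (induction n) (auto simp: ramp_def)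

text \<open>Piecewise linear interpolation with nodes \<open>j / M\<close>. As a sum of ramps it
  turns increments into weighted sums of difference quotients.\<close>

definition interp :: "nat \<Rightarrow> (nat \<Rightarrow> 'a::real_normed_vector) \<Rightarrow> real \<Rightarrow> 'a" where
  "interp M z t = z 0 + (\<Sum>j<M. ramp (real M * t - real j) *\<^sub>R (z (Suc j) - z j))"

lemma interp_node:
  assumes "j \<le> M" "M > 0"
  shows "interp M z (real j / real M) = z j"
proof -
  have "(\<Sum>i<M. ramp (real M * (real j / real M) - real i) *\<^sub>R (z (Suc i) - z i))
      = (\<Sum>i<j. z (Suc i) - z i)"
  proof (rule sum.mono_neutral_cong_right)
    show "\<forall>i\<in>{..<M} - {..<j}. ramp (real M * (real j / real M) - real i) *\<^sub>R (z (Suc i) - z i) = 0"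
      using assms by (auto simp: ramp_def)
    show "ramp (real M * (real j / real M) - real i) *\<^sub>R (z (Suc i) - z i) = z (Suc i) - z i"
      if "i \<in> {..<j}" for i
    proof -
      have "1 \<le> real j - real i" using that by auto
      then show ?thesis using assms by (simp add: ramp_def)
    qed
  qed (use assms in auto)
  also have "\<dots> = z j - z 0" by (rule sum_lessThan_telescope)
  finally show ?thesis by (simp add: interp_def)
qed

text \<open>The weights \<open>q j / real M\<close> are nonnegative, add up to \<open>t - s\<close>
  and vanish for grid cells that miss the open interval from \<open>s\<close> to \<open>t\<close>;
  only the remaining cells need an estimate.\<close>

lemma interp_increment:
  assumes M: "M > 0" and st: "0 \<le> s" "s \<le> t" "t \<le> 1"
    and step: "\<And>j. j < M \<Longrightarrow> real M * s < real j + 1 \<Longrightarrow> real j < real M * t \<Longrightarrow>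
      norm (real M *\<^sub>R (z (Suc j) - z j) - v) \<le> e"
  shows "norm (interp M z t - interp M z s - (t - s) *\<^sub>R v) \<le> e * (t - s)"
proof -
  define q where "q = (\<lambda>j. ramp (real M * t - real j) - ramp (real M * s - real j))"
  have MM: "real M * s \<le> real M * t" using st by (intro mult_left_mono) auto
  have q0: "0 \<le> q j" for j using MM unfolding q_def ramp_def by simp
  have r: "0 \<le> real M * t" "real M * t \<le> real M" "0 \<le> real M * s" "real M * s \<le> real M"
    using st mult_left_mono[of t 1 "real M"] mult_left_mono[of s 1 "real M"] by auto
  have qs: "(\<Sum>j<M. q j) = real M * (t - s)"
    unfolding q_def sum_subtractf sum_ramp using r by (simp add: right_diff_distrib)
  have eq: "interp M z t - interp M z s - (t - s) *\<^sub>R v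
      = (\<Sum>j<M. (q j / real M) *\<^sub>R (real M *\<^sub>R (z (Suc j) - z j) - v))"
  proof -
    have "(t - s) *\<^sub>R v = (\<Sum>j<M. (q j / real M) *\<^sub>R v)"
      unfolding scaleR_sum_left[symmetric] sum_divide_distrib[symmetric] qs using M by simp
    moreover have "interp M z t - interp M z s = (\<Sum>j<M. q j *\<^sub>R (z (Suc j) - z j))"
      by (simp add: interp_def q_def scaleR_left_diff_distrib sum_subtractf)
    ultimately show ?thesis
      using M by (simp add: scaleR_right_diff_distrib sum_subtractf)
  qed
  have "norm (interp M z t - interp M z s - (t - s) *\<^sub>R v) \<le> (\<Sum>j<M. (q j / real M) * e)"
    unfolding eq
  proof (rule order_trans[OF norm_sum sum_mono])
    fix j assume "j \<in> {..<M}"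
    then have j: "j < M" by simp
    show "norm ((q j / real M) *\<^sub>R (real M *\<^sub>R (z (Suc j) - z j) - v)) \<le> (q j / real M) * e"
    proof (cases "real M * s < real j + 1 \<and> real j < real M * t")
      case True
      then have "norm (real M *\<^sub>R (z (Suc j) - z j) - v) \<le> e" using step j by blast
      then show ?thesis using q0[of j] by (simp add: divide_right_mono mult_left_mono)
    next
      case False
      then have "q j = 0" using MM by (auto simp: q_def ramp_def)
      then show ?thesis by simp
    qed
  qed
  also have "\<dots> = e * (t - s)"
    unfolding sum_distrib_right[symmetric] sum_divide_distrib[symmetric] qs using M by simp
  finally show ?thesis .
qed

text \<open>Bounded difference quotients make the interpolants equi-Lipschitz. Near time
  \<open>s\<close> all quotients are close to \<open>X (y s)\<close> by continuity alone, which
  yields the differential equation without any Lipschitz condition on \<open>X\<close>. The closed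
  set \<open>P\<close> carries a property of one midpoint per polygon over to the limit
  curve.\<close>

lemma midpoint_limit:
  fixes X :: "'a::euclidean_space \<Rightarrow> 'a" and z :: "nat \<Rightarrow> nat \<Rightarrow> 'a"
  assumes X: "continuous_on UNIV X" and M: "\<And>n. M n > 0" "filterlim M at_top sequentially"
    and period: "\<And>n. z n (M n) = z n 0"
    and step: "\<And>n j. j < M n \<Longrightarrow>
      norm (real (M n) *\<^sub>R (z n (Suc j) - z n j) - X ((1 / 2) *\<^sub>R (z n j + z n (Suc j)))) \<le> 1 / real (M n)"
    and bd: "\<And>n j. j \<le> M n \<Longrightarrow> norm (z n j) \<le> B"
    and J: "\<And>n. J n < M n" and P: "closed P" "\<And>n. (1 / 2) *\<^sub>R (z n (J n) + z n (Suc (J n))) \<in> P"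
  obtains y t where "y 0 = y 1" "t \<in> {0..1::real}" "y t \<in> P"
    "\<And>s. s \<in> {0..1} \<Longrightarrow> (y has_vector_derivative X (y s)) (at s within {0..1})"
proof -
  define mid where "mid = (\<lambda>n j. (1 / 2) *\<^sub>R (z n j + z n (Suc j)))"
  define Y where "Y = (\<lambda>n. interp (M n) (z n))"
  have inv_le1: "1 / real (M n) \<le> 1" for n using M(1)[of n] by simp
  have mid_bd: "norm (mid n j) \<le> B" if "j < M n" for n j
    using norm_triangle_ineq[of "z n j" "z n (Suc j)"] bd[of j n] bd[of "Suc j" n] that
    by (simp add: mid_def)
  obtain K where K: "\<And>w. norm w \<le> B \<Longrightarrow> norm (X w) \<le> K"
  proof -
    have "bounded (X ` cball 0 B)"
      by (intro compact_imp_bounded compact_continuous_image continuous_on_subset[OF X]) auto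
    then obtain K where "\<forall>w\<in>cball 0 B. norm (X w) \<le> K" unfolding bounded_iff by auto
    then show ?thesis using that[of K] by simp
  qed
  \<comment> \<open>A common Lipschitz constant: the field is bounded by \<open>K\<close> at the
    midpoints and the defect is at most 1.\<close>
  define Lp where "Lp = \<bar>K\<bar> + 1"
  have Lp: "Lp > 0" by (simp add: Lp_def)
  have slope: "norm (real (M n) *\<^sub>R (z n (Suc j) - z n j) - 0) \<le> Lp" if "j < M n" for n j
    using step[OF that] K[OF mid_bd[OF that]] inv_le1[of n]
      norm_triangle_sub[of "real (M n) *\<^sub>R (z n (Suc j) - z n j)" "X (mid n j)"]
    unfolding mid_def Lp_def by simp
  have lip0: "norm (Y n t - Y n s) \<le> Lp * (t - s)" if "0 \<le> s" "s \<le> t" "t \<le> 1" for n s t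
    using interp_increment[OF M(1)[of n] that, of "z n" 0 Lp] slope unfolding Y_def by simp
  have lip: "norm (Y n t - Y n s) \<le> Lp * \<bar>t - s\<bar>" if "s \<in> {0..1}" "t \<in> {0..1}" for n s t
    using lip0[of s t n] lip0[of t s n] that by (cases "s \<le> t") (auto simp: norm_minus_commute)
  have node: "Y n (real j / real (M n)) = z n j" if "j \<le> M n" for n j
    unfolding Y_def by (rule interp_node[OF that M(1)])
  have Y0: "Y n 0 = z n 0" "Y n 1 = z n 0" for n
    using node[of 0 n] node[of "M n" n] M(1)[of n] period[of n] by auto
  have Ybd: "norm (Y n t) \<le> B + Lp" if "t \<in> {0..1}" for n t
  proof -
    have "norm (Y n t - Y n 0) \<le> Lp * \<bar>t - 0\<bar>" using that by (intro lip) auto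
    also have "\<dots> \<le> Lp * 1" using that Lp by (intro mult_left_mono) auto
    finally show ?thesis using norm_triangle_sub[of "Y n t" "Y n 0"] bd[of 0 n] Y0(1)[of n] by simp
  qed
  have equi: "\<exists>d>0. \<forall>n y. y \<in> {0..1} \<and> norm (x - y) < d \<longrightarrow> norm (Y n x - Y n y) < e"
    if "x \<in> {0..1}" "0 < e" for x e
  proof (intro exI[of _ "e / Lp"] conjI allI impI)
    fix n y assume y: "y \<in> {0..1} \<and> norm (x - y) < e / Lp"
    then have "Lp * \<bar>x - y\<bar> < e" using Lp by (simp add: field_simps)
    then show "norm (Y n x - Y n y) < e" using lip[of y x n] y that by simp
  qed (use Lp that in simp)
  obtain y k where y: "continuous_on {0..1} y" and k: "strict_mono (k :: nat \<Rightarrow> nat)"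
    and conv: "\<And>e. 0 < e \<Longrightarrow> \<exists>N. \<forall>n x. n \<ge> N \<and> x \<in> {0..1} \<longrightarrow> norm (Y (k n) x - y x) < e"
    by (rule Arzela_Ascoli[of "{0..1}" Y "B + Lp"]) (use Ybd equi in auto)
  have ptw: "(\<lambda>n. Y (k n) x) \<longlonglongrightarrow> y x" if x: "x \<in> {0..1}" for x
    unfolding LIMSEQ_iff using conv x by blast
  have invM: "(\<lambda>n. 1 / real (M (k n))) \<longlonglongrightarrow> 0"
  proof -
    have "filterlim (\<lambda>n. M (k n)) at_top sequentially"
      using filterlim_compose[OF M(2) filterlim_subseq[OF k]] .
    then have "filterlim (\<lambda>n. real (M (k n))) at_top sequentially"
      by (rule filterlim_compose[OF filterlim_real_sequentially])
    then show ?thesis by (rule tendsto_divide_0[OF tendsto_const filterlim_at_top_imp_at_infinity])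
  qed
  have "y 0 = y 1"
    using LIMSEQ_unique[OF ptw[of 0]] ptw[of 1] by (simp add: Y0)
  moreover have "(y has_vector_derivative X (y s)) (at s within {0..1})" if s: "s \<in> {0..1}" for s
    unfolding has_vector_derivative_def has_derivative_within_alt
  proof (intro conjI allI impI bounded_linear_scaleR_left)
    fix e :: real assume e: "0 < e"
    obtain \<rho> where \<rho>: "\<rho> > 0" "\<And>w. dist w (y s) < \<rho> \<Longrightarrow> dist (X w) (X (y s)) < e / 2"
    proof -
      have "0 < e / 2" using e by simp
      with X show ?thesis using that unfolding continuous_on_iff by (metis UNIV_I)
    qed
    \<comment> \<open>The nodes concerned lie within \<open>2 * d\<close> of \<open>s\<close>, where
      an interpolant moves by at most \<open>\<rho> / 2\<close>; the other half of
      \<open>\<rho>\<close> is spent on convergence at \<open>s\<close>.\<close>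
    define d where "d = \<rho> / (4 * Lp)"
    have d: "d > 0" using \<rho> Lp by (simp add: d_def)
    have "norm (y t - y s - (t - s) *\<^sub>R X (y s)) \<le> e * norm (t - s)" if t: "t \<in> {0..1}" "norm (t - s) < d" for t
    proof -
      define l u where "l = min s t" and "u = max s t"
      have lu: "0 \<le> l" "l \<le> u" "u \<le> 1" "u - l = \<bar>t - s\<bar>" using s t by (auto simp: l_def u_def)
      have ev: "\<forall>\<^sub>F n in sequentially. norm (Y (k n) u - Y (k n) l - (u - l) *\<^sub>R X (y s)) \<le> e * (u - l)"
      proof -
        have "\<forall>\<^sub>F n in sequentially. 1 / real (M (k n)) < min (e / 2) d"
          using invM e d by (intro order_tendstoD(2)[OF invM]) auto
        moreover have "\<forall>\<^sub>F n in sequentially. norm (Y (k n) s - y s) < \<rho> / 2"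
        proof -
          obtain N where "\<forall>n x. n \<ge> N \<and> x \<in> {0..1} \<longrightarrow> norm (Y (k n) x - y x) < \<rho> / 2"
            using conv[of "\<rho> / 2"] \<rho>(1) by auto
          then show ?thesis using s unfolding eventually_sequentially by blast
        qed
        ultimately show ?thesis
        proof eventually_elim
          case (elim n)
          define m where "m = M (k n)"
          have m: "m > 0" "1 / real m < e / 2" "1 / real m < d" using M elim by (auto simp: m_def)
          show ?case
            unfolding Y_def m_def[symmetric]
          proof (rule interp_increment[OF m(1) lu(1-3)])
            fix j assume j: "j < m" "real m * l < real j + 1" "real j < real m * u"
            have j1: "l < (real j + 1) / real m" "real j / real m < u"
              using j m by (simp_all add: field_simps)
            have j2: "(real j + 1) / real m = real j / real m + 1 / real m" by (simp add: add_divide_distrib)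
            have near: "norm (z (k n) i - Y (k n) s) \<le> \<rho> / 2" if i: "i = j \<or> i = Suc j" for i
            proof -
              have im: "i \<le> m" using i j by auto
              have r: "real i / real m \<in> {0..1}" using im m by simp
              have "\<bar>real i / real m - s\<bar> \<le> \<bar>t - s\<bar> + 1 / real m"
              proof -
                have "real i / real m = real j / real m \<or> real i / real m = real j / real m + 1 / real m"
                  using i j2 by (auto simp: add.commute)
                moreover have "l \<le> s" "s \<le> u" "0 < 1 / real m" using m by (simp_all add: l_def u_def)
                ultimately show ?thesis using j1 j2 lu(4) by linarith
              qed
              also have "\<dots> \<le> 2 * d" using t m by simp
              finally have "Lp * \<bar>real i / real m - s\<bar> \<le> Lp * (2 * d)"
                using Lp by (intro mult_left_mono) auto
              also have "\<dots> = \<rho> / 2" using Lp by (simp add: d_def)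
              finally show ?thesis
                using lip[OF s r, of "k n"] node[of i "k n"] im by (simp add: m_def)
            qed
            have "mid (k n) j - Y (k n) s = (1/2) *\<^sub>R ((z (k n) j - Y (k n) s) + (z (k n) (Suc j) - Y (k n) s))"
              unfolding mid_def by (subst (1) scaleR_half_double[symmetric, of "Y (k n) s"])
                (simp only: scaleR_diff_right[symmetric] add_diff_add)
            then have "norm (mid (k n) j - Y (k n) s) \<le> (1/2) * (norm (z (k n) j - Y (k n) s) + norm (z (k n) (Suc j) - Y (k n) s))"
              using norm_triangle_ineq by simp
            then have "norm (mid (k n) j - Y (k n) s) \<le> \<rho> / 2" using near[of j] near[of "Suc j"] by simp
            then have "dist (mid (k n) j) (y s) < \<rho>"
              using elim(2) norm_triangle_ineq[of "mid (k n) j - Y (k n) s" "Y (k n) s - y s"] by (simp add: dist_norm)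
            then have "norm (X (mid (k n) j) - X (y s)) < e / 2" using \<rho>(2) by (simp add: dist_norm)
            moreover have "norm (real m *\<^sub>R (z (k n) (Suc j) - z (k n) j) - X (mid (k n) j)) \<le> 1 / real m"
              using step[of j "k n"] j by (simp add: m_def mid_def)
            ultimately show "norm (real m *\<^sub>R (z (k n) (Suc j) - z (k n) j) - X (y s)) \<le> e"
              using m(2) norm_triangle_ineq[of "real m *\<^sub>R (z (k n) (Suc j) - z (k n) j) - X (mid (k n) j)"
                  "X (mid (k n) j) - X (y s)"] by simp
          qed
        qed
      qed
      have "norm (y u - y l - (u - l) *\<^sub>R X (y s)) \<le> e * (u - l)"
      proof (rule tendsto_upperbound[OF _ ev])
        show "(\<lambda>n. norm (Y (k n) u - Y (k n) l - (u - l) *\<^sub>R X (y s))) \<longlonglongrightarrow> norm (y u - y l - (u - l) *\<^sub>R X (y s))"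
          using lu by (intro tendsto_intros ptw) auto
      qed simp
      moreover have "y t - y s - (t - s) *\<^sub>R X (y s) = y u - y l - (u - l) *\<^sub>R X (y s) \<or>
          y t - y s - (t - s) *\<^sub>R X (y s) = - (y u - y l - (u - l) *\<^sub>R X (y s))"
        by (cases "s \<le> t") (auto simp: l_def u_def scaleR_left_diff_distrib)
      ultimately show ?thesis using lu(4) by (auto simp: norm_minus_commute)
    qed
    then show "\<exists>d>0. \<forall>t\<in>{0..1}. norm (t - s) < d \<longrightarrow> norm (y t - y s - (t - s) *\<^sub>R X (y s)) \<le> e * norm (t - s)"
      using d by blast
  qed
  moreover obtain t where t: "t \<in> {0..1}" "y t \<in> P"
  proof -
    \<comment> \<open>The index of the distinguished midpoint, read as a time; a further subsequence
      makes it converge to \<open>t\<close>.\<close>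
    define \<tau> where "\<tau> = (\<lambda>n. real (J (k n)) / real (M (k n)))"
    have \<tau>: "\<tau> n \<in> {0..1}" for n using J[of "k n"] by (simp add: \<tau>_def)
    have "seq_compact {0..1::real}" by (simp add: compact_imp_seq_compact)
    then obtain t r where t: "t \<in> {0..1}" and r: "strict_mono (r :: nat \<Rightarrow> nat)" "(\<tau> \<circ> r) \<longlonglongrightarrow> t"
      unfolding seq_compact_def using \<tau> by metis
    have lim1: "(\<lambda>n. y (\<tau> (r n))) \<longlonglongrightarrow> y t"
      by (rule continuous_on_tendsto_compose[OF y _ t]) (use r(2) \<tau> in \<open>auto simp: o_def\<close>)
    have lim2: "(\<lambda>n. Y (k (r n)) (\<tau> (r n)) - y (\<tau> (r n))) \<longlonglongrightarrow> 0"
      unfolding LIMSEQ_iff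
    proof (intro allI impI)
      fix e :: real assume "0 < e"
      from conv[OF this] obtain N where N: "\<forall>n x. n \<ge> N \<and> x \<in> {0..1} \<longrightarrow> norm (Y (k n) x - y x) < e" ..
      show "\<exists>N. \<forall>n\<ge>N. norm (Y (k (r n)) (\<tau> (r n)) - y (\<tau> (r n)) - 0) < e"
      proof (intro exI[of _ N] allI impI)
        fix n assume "N \<le> n"
        then have "N \<le> r n" using seq_suble[OF r(1), of n] by simp
        then show "norm (Y (k (r n)) (\<tau> (r n)) - y (\<tau> (r n)) - 0) < e" using N \<tau>[of "r n"] by simp
      qed
    qed
    have lim3: "(\<lambda>n. mid (k (r n)) (J (k (r n))) - Y (k (r n)) (\<tau> (r n))) \<longlonglongrightarrow> 0"
    proof (rule Lim_null_comparison)
      have "norm (mid n (J n) - Y n (real (J n) / real (M n))) \<le> Lp * (1 / real (M n))" for n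
      proof -
        have "mid n (J n) - Y n (real (J n) / real (M n)) = (1/2) *\<^sub>R (z n (Suc (J n)) - z n (J n))"
          using node[of "J n" n] J[of n] by (simp add: mid_def algebra_simps flip: scaleR_add_left)
        moreover have "real (M n) * norm (z n (Suc (J n)) - z n (J n)) \<le> Lp"
          using slope[OF J[of n]] by simp
        then have "norm (z n (Suc (J n)) - z n (J n)) \<le> Lp * (1 / real (M n))"
          using M(1)[of n] by (simp add: field_simps)
        ultimately have "norm (mid n (J n) - Y n (real (J n) / real (M n))) \<le> norm (z n (Suc (J n)) - z n (J n))"
          by simp
        then show ?thesis using \<open>norm (z n (Suc (J n)) - z n (J n)) \<le> Lp * (1 / real (M n))\<close> by (rule order_trans)
      qed
      then show "\<forall>\<^sub>F n in sequentially. norm (mid (k (r n)) (J (k (r n))) - Y (k (r n)) (\<tau> (r n))) \<le> Lp * (1 / real (M (k (r n))))"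
        by (simp add: \<tau>_def)
      show "(\<lambda>n. Lp * (1 / real (M (k (r n))))) \<longlonglongrightarrow> 0"
        using tendsto_mult_right_zero[OF LIMSEQ_subseq_LIMSEQ[OF invM r(1)], of Lp] by (simp add: o_def)
    qed
    have "(\<lambda>n. mid (k (r n)) (J (k (r n)))) \<longlonglongrightarrow> y t"
      using tendsto_add[OF tendsto_add[OF lim3 lim2] lim1] by simp
    then have "y t \<in> P"
      by (rule closed_sequentially[OF P(1), rotated]) (use P(2) in \<open>simp add: mid_def\<close>)
    then show ?thesis using that t by blast
  qed
  ultimately show ?thesis using that by blast
qed

section \<open>Periodic orbits\<close>

context asymptotically_quadratic
begin

section \<open>Compactness: bounds for almost critical points\<close>

lemma W_bound:
  obtains B where "B > 0" "\<And>z. norm (W z) \<le> B"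
  using bounded_range_bounded_support[OF W_cont W_supp] by blast

lemma mode_norm_coef_le:
  assumes "\<And>j. j < period N \<Longrightarrow> norm (v j) \<le> B" "0 \<le> B"
  shows "mode_norm N (coef (period N) v) \<le> B"
proof (rule power2_le_imp_le)
  have "(mode_norm N (coef (period N) v))\<^sup>2 = (1 / real (period N)) * (\<Sum>j<period N. (norm (v j))\<^sup>2)"
    unfolding mode_norm_sq freqs_def by (rule sum_norm_coef[OF period_def])
  also have "\<dots> \<le> (1 / real (period N)) * (\<Sum>j<period N. B\<^sup>2)"
    using assms by (intro mult_left_mono sum_mono power_mono) auto
  also have "\<dots> = B\<^sup>2" by simp
  finally show "(mode_norm N (coef (period N) v))\<^sup>2 \<le> B\<^sup>2" .
qed (rule assms)

lemma coef_loop: "k \<in> freqs N \<Longrightarrow> coef (period N) (loop N c) k = c k"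
  unfolding loop_def by (rule coef_synth) (auto intro: freqs_dist)

lemma coef_V:
  assumes "k \<in> freqs N"
  shows "coef (period N) (\<lambda>j. V (loop N c j)) k
    = (2 * a) *\<^sub>R aniso m d (c k) + coef (period N) (\<lambda>j. W (loop N c j)) k"
proof -
  have "coef (period N) (\<lambda>j. V (loop N c j)) k
    = (2 * a) *\<^sub>R coef (period N) (\<lambda>j. aniso m d (loop N c j)) k + coef (period N) (\<lambda>j. W (loop N c j)) k"
    by (simp add: coef_def V_eq scaleR_vector_smult vector_add_ldistrib sum.distrib vector_smult_sum
        vector_smult_assoc mult_ac)
  also have "coef (period N) (\<lambda>j. aniso m d (loop N c j)) k = aniso m d (c k)"
    using coef_loop[OF assms, of c] aniso_coef[of m d "period N" "loop N c" k] by simp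
  finally show ?thesis .
qed

text \<open>The slopes \<open>a\<close> and \<open>a d\<close> at infinity are not eigenvalues of the midpoint scheme.\<close>

lemma spectral_gap:
  obtains e where "e > 0" "\<And>N k v. N \<ge> 1 \<Longrightarrow> midpoint_eig (period N) 1 \<le> (pi + a) / 2 \<Longrightarrow> k \<in> freqs N \<Longrightarrow>
    e * norm v \<le> norm (midpoint_eig (period N) k *\<^sub>R v - a *\<^sub>R aniso m d v)"
proof -
  \<comment> \<open>The entries bound the gap for \<open>k \<le> 0\<close>, for \<open>k = 1\<close>
    against \<open>a\<close>, and in the remaining cases, where it is at least
    \<open>pi / 2\<close>.\<close>
  define e where "e = min (a * d) (min ((a - pi) / 2) 1)"
  have a0: "0 < a" using a pi_gt_zero by linarith
  have pi2: "2 \<le> pi" using pi_ge_two .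
  have e: "e > 0" using a0 a d by (simp add: e_def)
  have "e \<le> a * d" "e \<le> min ((a - pi) / 2) 1" unfolding e_def by (rule min.cobounded1, rule min.cobounded2)
  then have e: "e > 0" "e \<le> a * d" "e \<le> (a - pi) / 2" "e \<le> 1" using e unfolding min.bounded_iff by blast+
  have ad: "a * d \<le> 3 * pi / 8" using mult_mono[of a "3 * pi / 2" d "1 / 4"] a a0 d by simp
  have ad1: "a * d \<le> a" using a0 d by (simp add: mult_le_cancel_left1)
  have "e * norm v \<le> norm (midpoint_eig (period N) k *\<^sub>R v - a *\<^sub>R aniso m d v)"
    if N: "N \<ge> 1" and l: "midpoint_eig (period N) 1 \<le> (pi + a) / 2" and k: "k \<in> freqs N" for N k v
  proof -
    have gap: "e \<le> \<bar>midpoint_eig (period N) k - a * (if i = m then 1 else d)\<bar>" for i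
    proof -
      consider "k \<le> 0" | "k = 1" | "2 \<le> k" by linarith
      then show ?thesis
      proof cases
        case 1
        then have "midpoint_eig (period N) k \<le> 0" using k by (intro midpoint_eig_nonpos[OF period_def]) (auto simp: freqs_def)
        then show ?thesis using e ad1 by auto
      next
        case 2
        moreover have "pi * real_of_int 1 \<le> midpoint_eig (period N) 1"
          using N by (intro midpoint_eig_ge[OF period_def]) auto
        ultimately show ?thesis using e ad l pi2 a by auto
      next
        case 3
        have "pi * 2 \<le> pi * real_of_int k" using 3 by (intro mult_left_mono) auto
        also have "\<dots> \<le> midpoint_eig (period N) k" using k 3 by (intro midpoint_eig_ge[OF period_def]) (auto simp: freqs_def)
        finally show ?thesis using e ad a pi2 by auto
      qed
    qed
    have "(e * norm v)\<^sup>2 = (\<Sum>i\<in>UNIV. (e * cmod (v $ i))\<^sup>2)"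
      by (simp add: power_mult_distrib norm_vec_sq sum_distrib_left)
    also have "\<dots> \<le> (\<Sum>i\<in>UNIV. (cmod ((midpoint_eig (period N) k *\<^sub>R v - a *\<^sub>R aniso m d v) $ i))\<^sup>2)"
    proof (intro sum_mono power_mono)
      fix i
      have "(midpoint_eig (period N) k *\<^sub>R v - a *\<^sub>R aniso m d v) $ i = (midpoint_eig (period N) k - a * (if i = m then 1 else d)) *\<^sub>R (v $ i)"
        by (simp add: aniso_def scaleR_left_diff_distrib)
      then have "cmod ((midpoint_eig (period N) k *\<^sub>R v - a *\<^sub>R aniso m d v) $ i) = \<bar>midpoint_eig (period N) k - a * (if i = m then 1 else d)\<bar> * cmod (v $ i)"
        by simp
      then show "e * cmod (v $ i) \<le> cmod ((midpoint_eig (period N) k *\<^sub>R v - a *\<^sub>R aniso m d v) $ i)"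
        using gap[of i] by (simp add: mult_right_mono)
    qed (use e in auto)
    also have "\<dots> = (norm (midpoint_eig (period N) k *\<^sub>R v - a *\<^sub>R aniso m d v))\<^sup>2" by (rule norm_vec_sq[symmetric])
    finally show ?thesis by (rule power2_le_imp_le) simp
  qed
  then show ?thesis using that e(1) by blast
qed

text \<open>A Palais-Smale estimate. The linear part is inverted with a constant independent of
  \<open>N\<close>, and the remaining terms, the gradient and the modes of the bounded
  \<open>W\<close>, are bounded.\<close>

lemma mode_norm_bound:
  obtains B where "B > 0" "\<And>N c. N \<ge> 1 \<Longrightarrow> midpoint_eig (period N) 1 \<le> (pi + a) / 2 \<Longrightarrow> mode_norm N (G N c) \<le> 1 \<Longrightarrow> mode_norm N c \<le> B"
proof -
  obtain e where e: "e > 0" "\<And>N k v. N \<ge> 1 \<Longrightarrow> midpoint_eig (period N) 1 \<le> (pi + a) / 2 \<Longrightarrow> k \<in> freqs N \<Longrightarrow>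
    e * norm v \<le> norm (midpoint_eig (period N) k *\<^sub>R v - a *\<^sub>R aniso m d v)" using spectral_gap by blast
  obtain C where C: "C > 0" "\<And>z. norm (W z) \<le> C" using W_bound by blast
  have "mode_norm N c \<le> (1 + C) / (2 * e)"
    if N: "N \<ge> 1" "midpoint_eig (period N) 1 \<le> (pi + a) / 2" and G1: "mode_norm N (G N c) \<le> 1" for N c
  proof -
    define b where "b = coef (period N) (\<lambda>j. W (loop N c j))"
    have "(2 * e) * mode_norm N c = L2_set (\<lambda>k. 2 * e * norm (c k)) (freqs N)"
      unfolding mode_norm_def using e by (intro L2_set_right_distrib) auto
    also have "\<dots> \<le> L2_set (\<lambda>k. norm (G N c k) + norm (b k)) (freqs N)"
    proof (rule L2_set_mono)
      fix k assume k: "k \<in> freqs N"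
      have "2 *\<^sub>R (midpoint_eig (period N) k *\<^sub>R c k - a *\<^sub>R aniso m d (c k)) = G N c k + b k"
        unfolding G_def coef_V[OF k] b_def by (simp add: algebra_simps)
      then have "2 * norm (midpoint_eig (period N) k *\<^sub>R c k - a *\<^sub>R aniso m d (c k)) = norm (G N c k + b k)"
        by (metis norm_scaleR abs_numeral)
      then show "2 * e * norm (c k) \<le> norm (G N c k) + norm (b k)"
        using e(2)[OF N k, of "c k"] norm_triangle_ineq[of "G N c k" "b k"] by linarith
    qed (use e in auto)
    also have "\<dots> \<le> mode_norm N (G N c) + mode_norm N b" unfolding mode_norm_def by (rule L2_set_triangle_ineq)
    also have "mode_norm N b \<le> C" unfolding b_def using C by (intro mode_norm_coef_le) auto
    finally show ?thesis using G1 e(1) by (simp add: field_simps)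
  qed
  then show ?thesis using that[of "(1 + C) / (2 * e)"] e C by simp
qed

lemma avg_norm_sq_loop: "(1 / real (period N)) * (\<Sum>j<period N. (norm (loop N c j))\<^sup>2) = (mode_norm N c)\<^sup>2"
  unfolding mode_norm_sq power2_norm_eq_inner loop_def by (rule parseval_inner) (auto intro: freqs_dist)

lemma avg_norm_loop: "(1 / real (period N)) * (\<Sum>j<period N. norm (loop N c j)) \<le> mode_norm N c"
proof (rule power2_le_imp_le)
  have "(\<Sum>j<period N. norm (loop N c j))\<^sup>2 \<le> (\<Sum>j<period N. (norm (loop N c j))\<^sup>2) * real (period N)"
    using sum_squared_le_sum_of_squares[of "\<lambda>j. norm (loop N c j)" "{..<period N}"] by simp
  then have "((1 / real (period N)) * (\<Sum>j<period N. norm (loop N c j)))\<^sup>2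
      \<le> (1 / real (period N))\<^sup>2 * ((\<Sum>j<period N. (norm (loop N c j))\<^sup>2) * real (period N))"
    unfolding power_mult_distrib by (intro mult_left_mono) auto
  also have "\<dots> = (1 / real (period N)) * (\<Sum>j<period N. (norm (loop N c j))\<^sup>2)"
    using period_pos[of N] by (simp add: power2_eq_square)
  finally show "((1 / real (period N)) * (\<Sum>j<period N. norm (loop N c j)))\<^sup>2 \<le> (mode_norm N c)\<^sup>2"
    unfolding avg_norm_sq_loop .
qed simp

text \<open>The vertices of the closed polygon with midpoints \<open>loop N c\<close>: the factor 1
  - i tan(pi k / M) undoes the averaging of neighbours in mode \<open>k\<close>.\<close>

definition nodes :: "nat \<Rightarrow> (int \<Rightarrow> complex ^ 'n) \<Rightarrow> nat \<Rightarrow> complex ^ 'n" where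
  "nodes N c = loop N (\<lambda>k. Complex 1 (- midpoint_eig (period N) k / real (period N)) *s c k)"

lemma nodes_period: "nodes N c (period N) = nodes N c 0"
  by (simp add: nodes_def loop_def synth_def fourier_char_period)

lemma nodes_Suc:
  "nodes N c (Suc j) = loop N (\<lambda>k. Complex 1 (midpoint_eig (period N) k / real (period N)) *s c k) j"
  unfolding nodes_def loop_def synth_def
proof (intro sum.cong refl)
  fix k assume "k \<in> freqs N"
  then have k: "k \<in> {-int N..int N}" by (simp add: freqs_def)
  show "fourier_char (period N) (Suc j) k *s (Complex 1 (- midpoint_eig (period N) k / real (period N)) *s c k)
      = fourier_char (period N) j k *s (Complex 1 (midpoint_eig (period N) k / real (period N)) *s c k)"
    unfolding vector_smult_assoc fourier_char_Suc mult.assoc fourier_char_1_tan[OF period_def k] ..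
qed

lemma nodes_mid: "(1 / 2) *\<^sub>R (nodes N c j + nodes N c (Suc j)) = loop N c j"
proof -
  have "nodes N c j + nodes N c (Suc j) = loop N (\<lambda>k. 2 *s c k) j"
    unfolding nodes_Suc unfolding nodes_def loop_add[symmetric] vector_sadd_rdistrib[symmetric]
    by (simp add: complex_eq_iff Complex_eq)
  also have "\<dots> = 2 *\<^sub>R loop N c j"
    by (simp add: loop_def synth_def scaleR_vector_smult vector_smult_sum vector_smult_assoc mult.commute)
  finally show ?thesis by simp
qed

text \<open>The gradient of \<open>F\<close> is precisely the defect in the midpoint rule, up to the
  factor \<i>.\<close>

lemma nodes_diff:
  assumes j: "j < period N"
  shows "real (period N) *\<^sub>R (nodes N c (Suc j) - nodes N c j) = \<i> *s (V (loop N c j) + loop N (G N c) j)"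
proof -
  have "real (period N) *\<^sub>R (nodes N c (Suc j) - nodes N c j) = loop N (\<lambda>k. \<i> *s ((2 * midpoint_eig (period N) k) *\<^sub>R c k)) j"
    unfolding nodes_Suc unfolding nodes_def loop_def synth_def sum_subtractf[symmetric] scaleR_sum_right
  proof (intro sum.cong refl)
    fix k
    have "of_real (real (period N)) * (Complex 1 (midpoint_eig (period N) k / real (period N)) - Complex 1 (- midpoint_eig (period N) k / real (period N)))
        = \<i> * of_real (2 * midpoint_eig (period N) k)"
      by (simp add: complex_eq_iff)
    then show "real (period N) *\<^sub>R (fourier_char (period N) j k *s (Complex 1 (midpoint_eig (period N) k / real (period N)) *s c k)
        - fourier_char (period N) j k *s (Complex 1 (- midpoint_eig (period N) k / real (period N)) *s c k))
      = fourier_char (period N) j k *s (\<i> *s ((2 * midpoint_eig (period N) k) *\<^sub>R c k))"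
      unfolding scaleR_vector_smult vector_ssub_ldistrib[symmetric] vector_sub_rdistrib[symmetric] vector_smult_assoc
      by (simp only: right_diff_distrib[symmetric] mult.left_commute[of _ "fourier_char (period N) j k"])
  qed
  also have "\<dots> = \<i> *s loop N (\<lambda>k. (2 * midpoint_eig (period N) k) *\<^sub>R c k) j"
    by (simp add: loop_def synth_def vector_smult_sum vector_smult_assoc mult.commute)
  also have "(\<lambda>k. (2 * midpoint_eig (period N) k) *\<^sub>R c k) = (\<lambda>k. coef (period N) (\<lambda>j. V (loop N c j)) k + G N c k)"
    by (simp add: G_def)
  also have "loop N \<dots> j = V (loop N c j) + loop N (G N c) j"
    unfolding loop_add using synth_coef[OF period_def j, of "\<lambda>j. V (loop N c j)"] by (simp add: loop_def freqs_def)
  finally show ?thesis .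
qed

text \<open>Solving the definition of \<open>G\<close> for the linear term removes the quadratic
  part. Up to the gradient, \<open>F\<close> is the mean of a pointwise action density, so a
  positive value forces a midpoint of positive density.\<close>

lemma F_eq_action:
  "F N c = (1 / real (period N)) * (\<Sum>j<period N. (1 / 2) * (V (loop N c j) \<bullet> loop N c j) - H (loop N c j))
     + (1 / 2) * (\<Sum>k\<in>freqs N. G N c k \<bullet> c k)"
proof -
  have "(\<Sum>k\<in>freqs N. midpoint_eig (period N) k * (norm (c k))\<^sup>2)
      = (1 / 2) * (\<Sum>k\<in>freqs N. (coef (period N) (\<lambda>j. V (loop N c j)) k + G N c k) \<bullet> c k)"
    unfolding sum_distrib_left by (intro sum.cong refl) (simp add: G_def power2_norm_eq_inner)
  then show ?thesis
    by (simp add: F_def inner_add_left sum.distrib sum_coef_inner loop_def[symmetric] sum_subtractf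
        sum_distrib_left[symmetric] right_diff_distrib distrib_left sum_divide_distrib[symmetric])
qed

text \<open>\<open>A\<close> and \<open>B\<close> precede \<open>N\<close>, as the passage to the
  limit requires. The mean square bound becomes a bound at every vertex because the variation of the
  polygon is bounded too.\<close>

lemma discrete_orbit:
  obtains A B where "A > 0" "\<forall>\<^sub>F N in sequentially. \<exists>z J. z (period N) = z 0 \<and>
     (\<forall>j<period N. norm (real (period N) *\<^sub>R (z (Suc j) - z j) - \<i> *s V ((1 / 2) *\<^sub>R (z j + z (Suc j)))) \<le> 1 / real (period N)) \<and>
     (\<forall>j\<le>period N. norm (z j) \<le> B) \<and> J < period N \<and>
     (let w = (1 / 2) *\<^sub>R (z J + z (Suc J)) in A + H w \<le> (1 / 2) * (V w \<bullet> w))"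
proof -
  obtain A where A: "A > 0" "\<And>N c. (\<And>k. k \<in> {-int N..-1} \<Longrightarrow> c k = 0) \<Longrightarrow> c 0 = z\<^sub>0 \<Longrightarrow>
     (\<Sum>k\<in>{1..int N}. midpoint_eig (period N) k * (norm (c k))\<^sup>2) = A \<Longrightarrow> A / 2 \<le> F N c"
    using F_sphere by blast
  obtain B where B: "B > 0" "\<And>N c. N \<ge> 1 \<Longrightarrow> midpoint_eig (period N) 1 \<le> (pi + a) / 2 \<Longrightarrow> mode_norm N (G N c) \<le> 1 \<Longrightarrow> mode_norm N c \<le> B"
    using mode_norm_bound by blast
  obtain C where C: "C > 0" "\<And>z. norm (W z) \<le> C" using W_bound by blast
  have a0: "0 < a" using a pi_gt_zero by linarith
  define B' where "B' = B + (2 * a * B + C + 1)"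
  have "filterlim period at_top sequentially"
    by (rule filterlim_subseq) (auto simp: strict_mono_def period_def)
  from filterlim_compose[OF midpoint_eig_1_tendsto this] have "(\<lambda>N. midpoint_eig (period N) 1) \<longlonglongrightarrow> pi" .
  then have "\<forall>\<^sub>F N in sequentially. midpoint_eig (period N) 1 < (pi + a) / 2"
    using a by (intro order_tendstoD) auto
  moreover have "\<forall>\<^sub>F N in sequentially. 1 \<le> N" by (rule eventually_ge_at_top)
  ultimately have "\<forall>\<^sub>F N in sequentially. \<exists>z J. z (period N) = z 0 \<and>
     (\<forall>j<period N. norm (real (period N) *\<^sub>R (z (Suc j) - z j) - \<i> *s V ((1 / 2) *\<^sub>R (z j + z (Suc j)))) \<le> 1 / real (period N)) \<and>
     (\<forall>j\<le>period N. norm (z j) \<le> B') \<and> J < period N \<and>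
     (let w = (1 / 2) *\<^sub>R (z J + z (Suc J)) in A / 8 + H w \<le> (1 / 2) * (V w \<bullet> w))"
  proof eventually_elim
    case (elim N)
    define M where "M = real (period N)"
    have M: "M \<ge> 1" by (simp add: M_def period_def)
    \<comment> \<open>The first entry leaves a defect of \<open>1 / M\<close> after the crude
      \<open>norm_loop_le\<close>. The second limits the gradient term of \<open>F_eq_action\<close>
      to \<open>A / 8\<close>, half of the available \<open>A / 4\<close>.\<close>
    define g where "g = min (1 / M\<^sup>2) (A / (4 * B))"
    have g: "g > 0" "g \<le> 1 / M\<^sup>2" "g \<le> A / (4 * B)" using M A B by (auto simp: g_def)
    have "1 / M\<^sup>2 \<le> 1" using M by simp
    then have g1: "g \<le> 1" using g by linarith
    have "(pi + a) / 2 < a" using a by simp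
    with elim(1) have la: "midpoint_eig (period N) 1 < a" by (rule less_trans)
    obtain c where c: "A / 4 \<le> F N c" "mode_norm N (G N c) < g"
      using almost_critical[OF elim(2) la g(1) A(1) A(2)] by blast
    have cB: "mode_norm N c \<le> B" by (rule B(2)) (use elim c g1 in auto)
    define z where "z = nodes N c"
    define w where "w = loop N c"
    have mid: "(1 / 2) *\<^sub>R (z j + z (Suc j)) = w j" for j
      unfolding z_def w_def by (rule nodes_mid)
    have "M * g \<le> M * (1 / M\<^sup>2)" using g M by (intro mult_left_mono) auto
    also have "\<dots> = 1 / M" using M by (simp add: power2_eq_square)
    finally have Mg: "M * g \<le> 1 / M" .
    have dz: "norm (M *\<^sub>R (z (Suc j) - z j) - \<i> *s V (w j)) \<le> 1 / M" if "j < period N" for j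
    proof -
      have "M *\<^sub>R (z (Suc j) - z j) - \<i> *s V (w j) = \<i> *s loop N (G N c) j"
        unfolding M_def z_def w_def nodes_diff[OF that] vector_add_ldistrib by simp
      then have "norm (M *\<^sub>R (z (Suc j) - z j) - \<i> *s V (w j)) = norm (loop N (G N c) j)"
        by (simp add: norm_vector_smult)
      also have "\<dots> \<le> M * mode_norm N (G N c)" unfolding M_def by (rule norm_loop_le)
      also have "\<dots> \<le> M * g" using c M by (intro mult_left_mono) auto
      finally show ?thesis using Mg by simp
    qed
    have sum_w: "(\<Sum>j<period N. norm (w j)) \<le> M * B"
    proof -
      have "(1 / M) * (\<Sum>j<period N. norm (w j)) \<le> B"
        using avg_norm_loop[of N c] cB unfolding w_def M_def by (rule order_trans)
      then show ?thesis using M by (simp add: field_simps)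
    qed
    \<comment> \<open>The equation bounds the speed by \<open>2 * a * norm (w j)\<close> plus a
      constant, and the mean of \<open>norm (w j)\<close> is at most \<open>B\<close>.\<close>
    have var: "(\<Sum>j<period N. norm (z (Suc j) - z j)) \<le> 2 * a * B + C + 1"
    proof -
      have "M * norm (z (Suc j) - z j) \<le> 2 * a * norm (w j) + (C + 1)" if "j < period N" for j
      proof -
        have "M * norm (z (Suc j) - z j) = norm (M *\<^sub>R (z (Suc j) - z j))" using M by simp
        also have "\<dots> \<le> norm (\<i> *s V (w j)) + norm (M *\<^sub>R (z (Suc j) - z j) - \<i> *s V (w j))"
          by (rule norm_triangle_sub)
        also have "norm (\<i> *s V (w j)) \<le> norm ((2 * a) *\<^sub>R aniso m d (w j)) + norm (W (w j))"
          using norm_triangle_ineq[of "(2 * a) *\<^sub>R aniso m d (w j)" "W (w j)"]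
          by (simp only: norm_vector_smult V_eq norm_ii mult_1)
        also have "norm ((2 * a) *\<^sub>R aniso m d (w j)) \<le> 2 * a * norm (w j)"
          using norm_aniso_le[of d m "w j"] a0 d by simp
        moreover have "1 / M \<le> 1" using M by simp
        ultimately show ?thesis using C(2)[of "w j"] dz[OF that] by linarith
      qed
      then have "(\<Sum>j<period N. M * norm (z (Suc j) - z j)) \<le> (\<Sum>j<period N. 2 * a * norm (w j) + (C + 1))"
        by (intro sum_mono) auto
      also have "\<dots> = 2 * a * (\<Sum>j<period N. norm (w j)) + M * (C + 1)"
        by (simp add: sum.distrib sum_distrib_left M_def)
      also have "\<dots> \<le> 2 * a * (M * B) + M * (C + 1)"
        using sum_w a0 by (intro add_right_mono mult_left_mono) auto
      finally have "M * (\<Sum>j<period N. norm (z (Suc j) - z j)) \<le> M * (2 * a * B + C + 1)"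
        by (simp add: sum_distrib_left algebra_simps)
      then show ?thesis using M by simp
    qed
    have dist0: "norm (z j - z i) \<le> 2 * a * B + C + 1" if "i \<le> j" "j \<le> period N" for i j
    proof -
      have "z j - z i = (\<Sum>l\<in>{i..<j}. z (Suc l) - z l)" using that(1) by (simp add: sum_Suc_diff')
      then have "norm (z j - z i) \<le> (\<Sum>l\<in>{i..<j}. norm (z (Suc l) - z l))" by (simp add: norm_sum)
      also have "\<dots> \<le> (\<Sum>l<period N. norm (z (Suc l) - z l))"
        using that by (intro sum_mono2) auto
      finally show ?thesis using var by simp
    qed
    have dist: "norm (z j - z i) \<le> 2 * a * B + C + 1" if "i \<le> period N" "j \<le> period N" for i j
      using dist0[of i j] dist0[of j i] that by (cases "i \<le> j") (auto simp: norm_minus_commute)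
    \<comment> \<open>An anchor for the variation bound: not all midpoints can exceed their
      mean.\<close>
    have "\<exists>j0<period N. norm (w j0) \<le> B"
    proof (rule ccontr)
      assume "\<not> ?thesis"
      then have "(\<Sum>j<period N. B) < (\<Sum>j<period N. norm (w j))"
        by (intro sum_strict_mono) (auto simp: not_le period_def)
      then show False using sum_w by (simp add: M_def)
    qed
    then obtain j0 where j0: "j0 < period N" "norm (w j0) \<le> B" by blast
    have zB: "norm (z j) \<le> B'" if j: "j \<le> period N" for j
    proof -
      have half: "\<bar>1 / 2 :: real\<bar> = 1 / 2" by simp
      have mean: "z j - w j0 = (1/2) *\<^sub>R ((z j - z j0) + (z j - z (Suc j0)))"
        unfolding mid[symmetric] by (subst (1) scaleR_half_double[symmetric, of "z j"])
          (simp only: scaleR_diff_right[symmetric] add_diff_add)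
      have "norm (z j - w j0) \<le> (1/2) * (norm (z j - z j0) + norm (z j - z (Suc j0)))"
        unfolding mean norm_scaleR half by (intro mult_left_mono norm_triangle_ineq) simp
      then have "norm (z j - w j0) \<le> 2 * a * B + C + 1"
        using dist[of j0 j] dist[of "Suc j0" j] j j0 by simp
      then show ?thesis using norm_triangle_sub[of "z j" "w j0"] j0 by (simp add: B'_def)
    qed
    have "\<exists>J<period N. A / 8 + H (w J) \<le> (1 / 2) * (V (w J) \<bullet> w J)"
    proof (rule ccontr)
      assume "\<not> ?thesis"
      then have "(\<Sum>j<period N. (1 / 2) * (V (w j) \<bullet> w j) - H (w j)) < (\<Sum>j<period N. A / 8)"
        by (intro sum_strict_mono) (auto simp: not_le period_def)
      then have "(1 / M) * (\<Sum>j<period N. (1 / 2) * (V (w j) \<bullet> w j) - H (w j)) < A / 8"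
        using M by (simp add: M_def field_simps)
      moreover have "(\<Sum>k\<in>freqs N. G N c k \<bullet> c k) \<le> A / 4"
      proof -
        have "(\<Sum>k\<in>freqs N. G N c k \<bullet> c k) \<le> (\<Sum>k\<in>freqs N. \<bar>norm (G N c k)\<bar> * \<bar>norm (c k)\<bar>)"
          by (intro sum_mono) (simp add: norm_cauchy_schwarz)
        also have "\<dots> \<le> mode_norm N (G N c) * mode_norm N c" unfolding mode_norm_def by (rule L2_set_mult_ineq)
        also have "\<dots> \<le> (A / (4 * B)) * B"
          using c g cB B A by (intro mult_mono) auto
        finally show ?thesis using B by simp
      qed
      ultimately show False using c(1) unfolding F_eq_action M_def w_def by linarith
    qed
    then obtain J where J: "J < period N" "A / 8 + H (w J) \<le> (1 / 2) * (V (w J) \<bullet> w J)" by blast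
    have "z (period N) = z 0" by (simp add: z_def nodes_period)
    then show ?case
      unfolding Let_def M_def[symmetric]
      by (intro exI[of _ z] exI[of _ J] conjI allI impI) (simp_all only: mid dz zB J)
  qed
  then show ?thesis using that[of "A / 8" B'] A(1) by simp
qed

text \<open>The margin \<open>A\<close> is the same for all \<open>N\<close>, so it survives the
  limit as a closed condition and leaves a strict inequality.\<close>

lemma periodic_orbit:
  obtains y t where "y 0 = y 1" "t \<in> {0..1::real}" "H (y t) < (1 / 2) * (V (y t) \<bullet> y t)"
    "\<And>s. s \<in> {0..1} \<Longrightarrow> (y has_vector_derivative \<i> *s V (y s)) (at s within {0..1})"
proof -
  obtain A B where A: "A > 0" and ev: "\<forall>\<^sub>F N in sequentially. \<exists>z J. z (period N) = z 0 \<and>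
     (\<forall>j<period N. norm (real (period N) *\<^sub>R (z (Suc j) - z j) - \<i> *s V ((1 / 2) *\<^sub>R (z j + z (Suc j)))) \<le> 1 / real (period N)) \<and>
     (\<forall>j\<le>period N. norm (z j) \<le> B) \<and> J < period N \<and>
     (let w = (1 / 2) *\<^sub>R (z J + z (Suc J)) in A + H w \<le> (1 / 2) * (V w \<bullet> w))"
    using discrete_orbit by blast
  define P where "P = {w. A + H w \<le> (1 / 2) * (V w \<bullet> w)}"
  have P: "closed P"
    unfolding P_def by (intro closed_Collect_le continuous_intros continuous_on_H continuous_on_V)
  define Q where "Q = (\<lambda>N z J. z (period N) = z 0 \<and>
     (\<forall>j<period N. norm (real (period N) *\<^sub>R (z (Suc j) - z j) - \<i> *s V ((1 / 2) *\<^sub>R (z j + z (Suc j)))) \<le> 1 / real (period N)) \<and>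
     (\<forall>j\<le>period N. norm (z j) \<le> B) \<and> J < period N \<and> (1 / 2) *\<^sub>R (z J + z (Suc J)) \<in> P)"
  have "\<forall>\<^sub>F N in sequentially. \<exists>z J. Q N z J"
    using ev unfolding Q_def P_def Let_def mem_Collect_eq .
  then obtain N0 where "\<exists>z J. Q (N0 + n) z J" for n
    unfolding eventually_sequentially using le_add1 by blast
  then obtain z J where Q: "Q (N0 + n) (z n) (J n)" for n by metis
  define M where "M = (\<lambda>n. period (N0 + n))"
  have zJ: "\<And>n. z n (M n) = z n 0"
     "\<And>n j. j < M n \<Longrightarrow> norm (real (M n) *\<^sub>R (z n (Suc j) - z n j) - \<i> *s V ((1 / 2) *\<^sub>R (z n j + z n (Suc j)))) \<le> 1 / real (M n)"
     "\<And>n j. j \<le> M n \<Longrightarrow> norm (z n j) \<le> B" "\<And>n. J n < M n" "\<And>n. (1 / 2) *\<^sub>R (z n (J n) + z n (Suc (J n))) \<in> P"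
    using Q unfolding M_def Q_def by simp_all
  have cX: "continuous_on UNIV (\<lambda>w. \<i> *s V w)" by (intro continuous_intros continuous_on_V)
  have M: "\<And>n. M n > 0" "filterlim M at_top sequentially"
    by (auto simp: M_def strict_mono_def period_def intro!: filterlim_subseq)
  obtain y t where y: "y 0 = y 1" "t \<in> {0..1::real}" "y t \<in> P"
    "\<And>s. s \<in> {0..1} \<Longrightarrow> (y has_vector_derivative \<i> *s V (y s)) (at s within {0..1})"
    using midpoint_limit[OF cX M zJ(1-4) P zJ(5)] by blast
  then have "H (y t) < (1 / 2) * (V (y t) \<bullet> y t)" using A by (simp add: P_def)
  then show ?thesis by (rule that[OF y(1,2) _ y(4)])
qed

end

section \<open>The Hamiltonian of an embedded ball\<close>

text \<open>The antiderivative of \<open>ramp (t / w)\<close> that vanishes for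
  \<open>t \<le> 0\<close>, hence a C1 substitute for \<open>max 0 t\<close> with a bend of width
  \<open>w\<close>.\<close>

definition soft_ramp :: "real \<Rightarrow> real \<Rightarrow> real" where
  "soft_ramp w t = ((max 0 t)\<^sup>2 - (max 0 (t - w))\<^sup>2) / (2 * w)"

lemma DERIV_pos_part_sq: "((\<lambda>t. (max 0 t)\<^sup>2) has_real_derivative 2 * max 0 t) (at t)" for t :: real
proof -
  consider "t > 0" | "t < 0" | "t = 0" by linarith
  then show ?thesis
  proof cases
    case 1
    have "((\<lambda>t. t\<^sup>2) has_real_derivative 2 * t) (at t)" by (auto intro!: derivative_eq_intros)
    then have "((\<lambda>t. t\<^sup>2) has_real_derivative 2 * max 0 t) (at t)" using 1 by simp
    then show ?thesis
      by (rule has_field_derivative_transform_within_open[where S = "{0<..}"]) (use 1 in auto)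
  next
    case 2
    have "((\<lambda>t. 0) has_real_derivative 0) (at t)" by simp
    then have "((\<lambda>t. 0) has_real_derivative 2 * max 0 t) (at t)" using 2 by simp
    then show ?thesis
      by (rule has_field_derivative_transform_within_open[where S = "{..<0}"]) (use 2 in auto)
  next
    case 3
    have "((\<lambda>h. (max 0 h)\<^sup>2 / h) \<longlongrightarrow> 0) (at (0::real))"
    proof (rule Lim_null_comparison)
      show "\<forall>\<^sub>F h in at (0::real). norm ((max 0 h)\<^sup>2 / h) \<le> \<bar>h\<bar>"
        by (intro always_eventually allI) (auto simp: max_def power2_eq_square)
      show "((\<lambda>h. \<bar>h\<bar>) \<longlongrightarrow> 0) (at (0::real))" by (auto intro!: tendsto_eq_intros)
    qed
    then show ?thesis using 3 by (simp add: DERIV_def)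
  qed
qed

lemma DERIV_soft_ramp: "w > 0 \<Longrightarrow> (soft_ramp w has_real_derivative ramp (t / w)) (at t)"
proof -
  assume w: "w > 0"
  have "((\<lambda>t. (max 0 (t - w))\<^sup>2) has_real_derivative 2 * max 0 (t - w) * 1) (at t)"
    by (rule DERIV_chain2[OF DERIV_pos_part_sq]) (auto intro!: derivative_eq_intros)
  then have "((\<lambda>t. ((max 0 t)\<^sup>2 - (max 0 (t - w))\<^sup>2) / (2 * w)) has_real_derivative
      (2 * max 0 t - 2 * max 0 (t - w) * 1) / (2 * w)) (at t)"
    by (intro DERIV_cdivide DERIV_diff DERIV_pos_part_sq)
  moreover have "(2 * max 0 t - 2 * max 0 (t - w) * 1) / (2 * w) = ramp (t / w)"
    using w by (simp add: ramp_def max_def min_def field_simps)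
  moreover have "soft_ramp w = (\<lambda>t. ((max 0 t)\<^sup>2 - (max 0 (t - w))\<^sup>2) / (2 * w))"
    by (simp add: fun_eq_iff soft_ramp_def)
  ultimately show ?thesis by simp
qed

lemma ramp_bounds: "0 \<le> ramp u" "ramp u \<le> 1" by (auto simp: ramp_def)

lemma soft_ramp_mono:
  assumes "w > 0" "s \<le> t"
  shows "soft_ramp w s \<le> soft_ramp w t"
proof (rule DERIV_nonneg_imp_nondecreasing[OF assms(2)])
  show "\<exists>y. (soft_ramp w has_real_derivative y) (at x) \<and> 0 \<le> y" for x
    by (intro exI conjI, rule DERIV_soft_ramp[OF assms(1)], rule ramp_bounds)
qed

lemma soft_ramp_nonpos: "w > 0 \<Longrightarrow> t \<le> 0 \<Longrightarrow> soft_ramp w t = 0"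
  by (simp add: soft_ramp_def max_def)

lemma soft_ramp_nonneg: "w > 0 \<Longrightarrow> 0 \<le> soft_ramp w t"
  using soft_ramp_mono[of w 0 t] soft_ramp_mono[of w t 0] soft_ramp_nonpos[of w 0] soft_ramp_nonpos[of w t]
  by (cases "0 \<le> t") auto

lemma soft_ramp_large: "w > 0 \<Longrightarrow> w \<le> t \<Longrightarrow> soft_ramp w t = t - w / 2"
  by (simp add: soft_ramp_def max_def field_simps power2_eq_square)

lemma soft_ramp_middle: "w > 0 \<Longrightarrow> 0 \<le> t \<Longrightarrow> t \<le> w \<Longrightarrow> soft_ramp w t = t\<^sup>2 / (2 * w)"
  by (simp add: soft_ramp_def max_def)

lemma soft_ramp_le_square: "w > 0 \<Longrightarrow> soft_ramp w t \<le> t\<^sup>2 / (2 * w)"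
  unfolding soft_ramp_def
  by (intro divide_right_mono) (auto simp: max_def power2_eq_square mult_nonneg_nonneg)

lemma soft_ramp_ge: "w > 0 \<Longrightarrow> t - w / 2 \<le> soft_ramp w t"
proof -
  assume w: "w > 0"
  consider "t \<le> 0" | "0 \<le> t" "t \<le> w" | "w \<le> t" by linarith
  then show ?thesis
  proof cases
    case 2
    have "0 \<le> (t - w)\<^sup>2" by simp
    then have "2 * w * t - w\<^sup>2 \<le> t\<^sup>2" by (simp add: power2_diff algebra_simps)
    then show ?thesis using w 2 by (simp add: soft_ramp_middle field_simps power2_eq_square)
  qed (use w in \<open>auto simp: soft_ramp_nonpos soft_ramp_large\<close>)
qed

text \<open>The difference of \<open>ramp (t / w) * t\<close> and \<open>soft_ramp w t\<close> is a
  Legendre transform: it rises from 0 to \<open>w / 2\<close> along the bend and stays there. It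
  controls the action density of the outer Hamiltonian.\<close>

lemma soft_ramp_legendre: "w > 0 \<Longrightarrow> ramp (t / w) * t \<le> soft_ramp w t + w / 2"
proof -
  assume w: "w > 0"
  consider "t \<le> 0" | "0 \<le> t" "t \<le> w" | "w \<le> t" by linarith
  then show ?thesis
  proof cases
    case 1
    then have "ramp (t / w) = 0" using w by (simp add: ramp_def divide_nonpos_pos)
    then show ?thesis using w 1 by (simp add: soft_ramp_nonpos)
  next
    case 2
    then have r: "ramp (t / w) = t / w" using w by (simp add: ramp_def)
    have "t * t \<le> w * w" using 2 by (intro mult_mono) auto
    then show ?thesis
      unfolding r soft_ramp_middle[OF w 2] using w by (simp add: field_simps power2_eq_square)
  next
    case 3
    then have "ramp (t / w) = 1" using w by (simp add: ramp_def)
    then show ?thesis using w 3 by (simp add: soft_ramp_large)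
  qed
qed

lemma soft_ramp_le: "w > 0 \<Longrightarrow> soft_ramp w t \<le> max 0 t"
proof -
  assume w: "w > 0"
  consider "t \<le> 0" | "0 \<le> t" "t \<le> w" | "w \<le> t" by linarith
  then show ?thesis
  proof cases
    case 2
    then have "t * t \<le> t * (2 * w)" using w by (intro mult_left_mono) auto
    then show ?thesis using w 2 by (simp add: soft_ramp_middle field_simps power2_eq_square)
  qed (use w in \<open>auto simp: soft_ramp_nonpos soft_ramp_large\<close>)
qed

text \<open>Near \<open>0\<close> the profile is quadratic in \<open>\<rho> = |y|\<^sup>2\<close>, hence quartic in \<open>y\<close>.\<close>

lemma profile:
  fixes w b c :: real
  assumes w: "w > 0" and b: "b > 0" and c: "c > 0"
  obtains f f' E where "\<And>\<rho>. (f has_real_derivative f' \<rho>) (at \<rho>)" "continuous_on UNIV f'"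
    "\<And>\<rho>. 0 \<le> f' \<rho>" "\<And>\<rho>. f' \<rho> \<le> c" "\<And>\<rho>. 0 \<le> f \<rho>" "\<And>\<rho>. 0 \<le> \<rho> \<Longrightarrow> f \<rho> \<le> E * \<rho>\<^sup>2"
    "\<And>\<rho>. f \<rho> \<le> c * b"
    "\<And>\<rho>. b + w \<le> \<rho> \<Longrightarrow> f \<rho> = c * b" "\<And>\<rho>. b + w \<le> \<rho> \<Longrightarrow> f' \<rho> = 0"
proof -
  \<comment> \<open>The slope rises to at most \<open>c\<close> and a copy delayed by
    \<open>b\<close> cancels it again, so the total climb is \<open>c * b\<close>.\<close>
  define f where "f = (\<lambda>\<rho>. c * (soft_ramp w \<rho> - soft_ramp w (\<rho> - b)))"
  define f' where "f' = (\<lambda>\<rho>. c * (ramp (\<rho> / w) - ramp ((\<rho> - b) / w)))"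
  have d: "(f has_real_derivative f' \<rho>) (at \<rho>)" for \<rho>
  proof -
    have "((\<lambda>\<rho>. soft_ramp w (\<rho> - b)) has_real_derivative ramp ((\<rho> - b) / w) * 1) (at \<rho>)"
      by (rule DERIV_chain2[OF DERIV_soft_ramp[OF w]]) (auto intro!: derivative_eq_intros)
    then have "((\<lambda>\<rho>. c * (soft_ramp w \<rho> - soft_ramp w (\<rho> - b))) has_real_derivative
        c * (ramp (\<rho> / w) - ramp ((\<rho> - b) / w) * 1)) (at \<rho>)"
      by (intro DERIV_cmult DERIV_diff DERIV_soft_ramp[OF w])
    then show ?thesis by (simp add: f_def f'_def)
  qed
  have mono: "(\<rho> - b) / w \<le> \<rho> / w" for \<rho> using b w by (simp add: divide_right_mono)
  have f'0: "0 \<le> f' \<rho>" for \<rho> using mono[of \<rho>] c by (auto simp: f'_def ramp_def)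
  have f'c: "f' \<rho> \<le> c" for \<rho>
  proof -
    have "ramp (\<rho> / w) - ramp ((\<rho> - b) / w) \<le> 1"
      using ramp_bounds(1)[of "(\<rho> - b) / w"] ramp_bounds(2)[of "\<rho> / w"] by linarith
    then show ?thesis using c unfolding f'_def by (simp add: mult_left_le)
  qed
  have f0: "0 \<le> f \<rho>" for \<rho> using soft_ramp_mono[OF w, of "\<rho> - b" \<rho>] b c by (simp add: f_def)
  have fE: "f \<rho> \<le> c / (2 * w) * \<rho>\<^sup>2" for \<rho>
  proof -
    have "f \<rho> \<le> c * (\<rho>\<^sup>2 / (2 * w))"
      unfolding f_def using soft_ramp_nonneg[OF w, of "\<rho> - b"] soft_ramp_le_square[OF w, of \<rho>] c
      by (intro mult_left_mono) auto
    then show ?thesis by simp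
  qed
  have fl: "f \<rho> = c * b" if "b + w \<le> \<rho>" for \<rho>
    using that w b by (simp add: f_def soft_ramp_large)
  have fle: "f \<rho> \<le> c * b" for \<rho>
  proof (cases "b + w \<le> \<rho>")
    case False
    have "f \<rho> \<le> f (b + w)"
    proof (rule DERIV_nonneg_imp_nondecreasing[where f = f])
      show "\<exists>y. (f has_real_derivative y) (at x) \<and> 0 \<le> y" for x
        by (intro exI conjI, rule d, rule f'0)
    qed (use False in simp)
    then show ?thesis using fl by simp
  qed (simp add: fl)
  have f'l: "f' \<rho> = 0" if "b + w \<le> \<rho>" for \<rho>
  proof -
    have "1 \<le> (\<rho> - b) / w" "1 \<le> \<rho> / w" using that w b by (simp_all add: field_simps)
    then show ?thesis by (simp add: f'_def ramp_def)
  qed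
  have cf': "continuous_on UNIV f'"
    unfolding f'_def ramp_def using w by (intro continuous_intros) auto
  show ?thesis by (rule that[of f f' "c / (2 * w)"]) (simp_all only: d cf' f'0 f'c f0 fE fle fl f'l)
qed

text \<open>In this form the Hamiltonian vector field of \<open>H\<close> is \<i> times its
  gradient, up to the sign convention.\<close>

lemma std_symplectic_eq: "std_symplectic p u v = (\<i> *s u) \<bullet> v"
  by (simp add: std_symplectic_def wedge_def dx_def dy_def inner_vec_def inner_complex_def algebra_simps)

lemma inner_i_i: "(\<i> *s (\<i> *s u)) \<bullet> v = - (u \<bullet> v)" for u v :: "complex ^ 'n"
  by (simp add: vector_smult_assoc flip: vector_sneg_minus1)

lemma vector_smult_scaleR: "a *s (x *\<^sub>R u) = x *\<^sub>R (a *s u)" for u :: "complex ^ 'n"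
  by (simp add: vec_eq_iff)

lemma inner_i_self: "x \<bullet> (\<i> *s x) = 0" for x :: "complex ^ 'n"
  by (simp add: inner_vec_def inner_complex_def)

text \<open>Unlike the library constant \<open>adjoint\<close>, this sum is visibly continuous in \<open>f\<close>.\<close>

definition real_adjoint :: "('a::euclidean_space \<Rightarrow> 'b::real_inner) \<Rightarrow> 'b \<Rightarrow> 'a" where
  "real_adjoint f y = (\<Sum>b\<in>Basis. (y \<bullet> f b) *\<^sub>R b)"

lemma real_adjoint_inner:
  assumes "linear f"
  shows "real_adjoint f y \<bullet> v = y \<bullet> f v"
proof -
  have "f v = f (\<Sum>b\<in>Basis. (v \<bullet> b) *\<^sub>R b)" by (simp add: euclidean_representation)
  also have "\<dots> = (\<Sum>b\<in>Basis. (v \<bullet> b) *\<^sub>R f b)" using assms by (simp add: linear_sum linear_scale)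
  finally show ?thesis
    by (simp add: real_adjoint_def inner_sum_left inner_sum_right inner_commute mult.commute)
qed

text \<open>\<open>s < r\<close> makes the image of the closed ball compact inside the open
  \<open>G\<close>. The profile is constant from \<open>s\<^sup>2\<close> on, so the Hamiltonian
  extends by a constant.\<close>

locale symplectic_ball =
  fixes r s :: real and \<Phi> \<Psi> :: "complex ^ 'n::finite \<Rightarrow> complex ^ 'n"
    and \<Phi>' \<Psi>' :: "complex ^ 'n \<Rightarrow> (complex ^ 'n) \<Rightarrow>\<^sub>L (complex ^ 'n)" and G :: "(complex ^ 'n) set"
    and f f' :: "real \<Rightarrow> real" and E c\<^sub>f :: real
  assumes s: "0 < s" "s < r" and open_G: "open G"
    and \<Phi>_deriv: "\<And>p. p \<in> ball 0 r \<Longrightarrow> (\<Phi> has_derivative \<Phi>' p) (at p)"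
    and \<Psi>_deriv: "\<And>z. z \<in> G \<Longrightarrow> (\<Psi> has_derivative \<Psi>' z) (at z)"
    and \<Psi>'_cont: "continuous_on G \<Psi>'"
    and \<Phi>_in: "\<And>p. p \<in> ball 0 r \<Longrightarrow> \<Phi> p \<in> G" and \<Psi>_in: "\<And>z. z \<in> G \<Longrightarrow> \<Psi> z \<in> ball 0 r"
    and \<Psi>\<Phi>: "\<And>p. p \<in> ball 0 r \<Longrightarrow> \<Psi> (\<Phi> p) = p" and \<Phi>\<Psi>: "\<And>z. z \<in> G \<Longrightarrow> \<Phi> (\<Psi> z) = z"
    and symplectic: "\<And>p u v. p \<in> ball 0 r \<Longrightarrow> (\<i> *s \<Phi>' p u) \<bullet> \<Phi>' p v = (\<i> *s u) \<bullet> v"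
    and f_deriv: "\<And>\<rho>. (f has_real_derivative f' \<rho>) (at \<rho>)" and f'_cont: "continuous_on UNIV f'"
    and f'_nonneg: "\<And>\<rho>. 0 \<le> f' \<rho>" and f'_less: "\<And>\<rho>. f' \<rho> < pi"
    and f_nonneg: "\<And>\<rho>. 0 \<le> f \<rho>" and f_small: "\<And>\<rho>. 0 \<le> \<rho> \<Longrightarrow> f \<rho> \<le> E * \<rho>\<^sup>2" and f_le: "\<And>\<rho>. f \<rho> \<le> c\<^sub>f"
    and f_large: "\<And>\<rho>. s\<^sup>2 \<le> \<rho> \<Longrightarrow> f \<rho> = c\<^sub>f" and f'_large: "\<And>\<rho>. s\<^sup>2 \<le> \<rho> \<Longrightarrow> f' \<rho> = 0"
begin

definition K :: "(complex ^ 'n) set" where "K = \<Phi> ` cball 0 s"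

definition h :: "complex ^ 'n \<Rightarrow> real" where "h z = (if z \<in> G then f ((norm (\<Psi> z))\<^sup>2) else c\<^sub>f)"

definition grad_h :: "complex ^ 'n \<Rightarrow> complex ^ 'n" where
  "grad_h z = (if z \<in> G then (2 * f' ((norm (\<Psi> z))\<^sup>2)) *\<^sub>R real_adjoint (\<Psi>' z) (\<Psi> z) else 0)"

lemma cont_\<Phi>: "continuous_on (ball 0 r) \<Phi>"
  by (intro continuous_at_imp_continuous_on ballI has_derivative_continuous[OF \<Phi>_deriv])

lemma cont_\<Psi>: "continuous_on G \<Psi>"
  by (intro continuous_at_imp_continuous_on ballI has_derivative_continuous[OF \<Psi>_deriv])

lemma compact_image: "t \<le> s \<Longrightarrow> compact (\<Phi> ` cball 0 t)"
  using s by (intro compact_continuous_image continuous_on_subset[OF cont_\<Phi>]) auto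

lemma compact_K: "compact K" unfolding K_def by (rule compact_image) simp

lemma K_sub_G: "K \<subseteq> G" using s \<Phi>_in by (auto simp: K_def)

lemma in_K_iff: "z \<in> G \<Longrightarrow> z \<in> K \<longleftrightarrow> norm (\<Psi> z) \<le> s"
proof
  assume "z \<in> G" "norm (\<Psi> z) \<le> s"
  then show "z \<in> K" unfolding K_def by (intro image_eqI[of _ _ "\<Psi> z"]) (auto simp: \<Phi>\<Psi>)
next
  assume "z \<in> K"
  then obtain p where "p \<in> cball 0 s" "z = \<Phi> p" by (auto simp: K_def)
  then show "norm (\<Psi> z) \<le> s" using s \<Psi>\<Phi>[of p] by simp
qed

lemma outside_K:
  assumes "z \<notin> K"
  shows "h z = c\<^sub>f" "grad_h z = 0"
proof -
  have "s\<^sup>2 \<le> (norm (\<Psi> z))\<^sup>2" if "z \<in> G"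
    using in_K_iff[OF that] assms s by (intro power_mono) auto
  then show "h z = c\<^sub>f" "grad_h z = 0" by (auto simp: h_def grad_h_def f_large f'_large)
qed

lemma open_compl_K: "open (- K)" using compact_K by (simp add: compact_imp_closed open_Compl)

lemma h_nonneg: "0 \<le> h z" and h_le: "h z \<le> c\<^sub>f"
  using f_nonneg f_le f_nonneg[of "s\<^sup>2"] f_large[of "s\<^sup>2"] by (auto simp: h_def)

text \<open>\<open>G\<close> and \<open>- K\<close> are open and cover the space; on the second set
  \<open>h\<close> is constant, and on the overlap the two branches agree.\<close>

lemma h_deriv: "(h has_derivative (\<lambda>v. grad_h z \<bullet> v)) (at z)"
proof (cases "z \<in> G")
  case True
  have lin: "linear (blinfun_apply (\<Psi>' z))" by (rule bounded_linear.linear[OF blinfun.bounded_linear_right])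
  have "((\<lambda>z. \<Psi> z \<bullet> \<Psi> z) has_derivative (\<lambda>v. \<Psi> z \<bullet> \<Psi>' z v + \<Psi>' z v \<bullet> \<Psi> z)) (at z)"
    by (rule has_derivative_inner[OF \<Psi>_deriv[OF True] \<Psi>_deriv[OF True]])
  then have "((\<lambda>z. (norm (\<Psi> z))\<^sup>2) has_derivative (\<lambda>v. 2 * (\<Psi> z \<bullet> \<Psi>' z v))) (at z)"
    by (simp add: power2_norm_eq_inner inner_commute)
  from has_derivative_compose[OF this f_deriv[unfolded has_field_derivative_def]]
  have "((\<lambda>z. f ((norm (\<Psi> z))\<^sup>2)) has_derivative (\<lambda>v. grad_h z \<bullet> v)) (at z)"
    using True by (simp add: grad_h_def real_adjoint_inner[OF lin] mult_ac)
  then show ?thesis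
    by (rule has_derivative_transform_within_open[OF _ open_G True]) (simp add: h_def)
next
  case False
  then have z: "z \<in> - K" using K_sub_G by auto
  have "((\<lambda>_. c\<^sub>f) has_derivative (\<lambda>v. grad_h z \<bullet> v)) (at z)" using outside_K(2) z by simp
  then show ?thesis
    by (rule has_derivative_transform_within_open[OF _ open_compl_K z]) (simp add: outside_K)
qed

lemma grad_h_cont: "continuous_on UNIV grad_h"
proof -
  have "continuous_on G (\<lambda>z. f' ((norm (\<Psi> z))\<^sup>2))"
    by (rule continuous_on_compose2[OF f'_cont]) (auto intro!: continuous_intros cont_\<Psi>)
  then have "continuous_on G (\<lambda>z. (2 * f' ((norm (\<Psi> z))\<^sup>2)) *\<^sub>R real_adjoint (\<Psi>' z) (\<Psi> z))"
    unfolding real_adjoint_def by (intro continuous_intros cont_\<Psi> \<Psi>'_cont)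
  then have "continuous_on G grad_h" by (rule continuous_on_eq) (simp add: grad_h_def)
  moreover have "continuous_on (- K) grad_h"
    by (rule continuous_on_eq[OF continuous_on_const[of _ 0]]) (simp add: outside_K)
  ultimately have "continuous_on (G \<union> - K) grad_h" by (rule continuous_on_open_Un[OF open_G open_compl_K])
  moreover have "G \<union> - K = UNIV" using K_sub_G by auto
  ultimately show ?thesis by simp
qed

text \<open>Differentiability of \<Psi> at the single point \<Phi> 0 bounds
  \<open>norm (\<Psi> z)\<close> linearly, and \<open>h\<close> is at most quartic in that
  norm.\<close>

lemma h_small:
  obtains \<delta> C where "\<delta> > 0" "C \<ge> 0" "\<And>z. norm (z - \<Phi> 0) < \<delta> \<Longrightarrow> h z \<le> C * norm (z - \<Phi> 0) ^ 4"
proof -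
  define z0 where "z0 = \<Phi> 0"
  have 0: "0 \<in> ball 0 r" using s by simp
  have z0: "z0 \<in> G" "\<Psi> z0 = 0" using \<Phi>_in[OF 0] \<Psi>\<Phi>[OF 0] by (auto simp: z0_def)
  obtain \<delta>1 where \<delta>1: "\<delta>1 > 0" "\<And>z. norm (z - z0) < \<delta>1 \<Longrightarrow>
      norm (\<Psi> z - \<Psi> z0 - \<Psi>' z0 (z - z0)) \<le> 1 * norm (z - z0)"
    using \<Psi>_deriv[OF z0(1)] unfolding has_derivative_at_alt by (metis zero_less_one)
  obtain \<delta>2 where \<delta>2: "\<delta>2 > 0" "ball z0 \<delta>2 \<subseteq> G" using open_G z0 by (meson openE)
  define B where "B = norm (\<Psi>' z0) + 1"
  have hz: "h z \<le> (\<bar>E\<bar> * B ^ 4) * norm (z - z0) ^ 4" if z: "norm (z - z0) < min \<delta>1 \<delta>2" for z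
  proof -
    have zG: "z \<in> G" using z \<delta>2(2) by (auto simp: dist_norm norm_minus_commute)
    have "norm (\<Psi> z - \<Psi>' z0 (z - z0)) \<le> norm (z - z0)" using \<delta>1(2)[of z] z z0 by simp
    moreover have "norm (\<Psi>' z0 (z - z0)) \<le> norm (\<Psi>' z0) * norm (z - z0)" by (rule norm_blinfun)
    ultimately have "norm (\<Psi> z) \<le> B * norm (z - z0)"
      using norm_triangle_sub[of "\<Psi> z" "\<Psi>' z0 (z - z0)"] by (simp add: B_def distrib_right)
    then have "norm (\<Psi> z) ^ 4 \<le> (B * norm (z - z0)) ^ 4" by (intro power_mono) auto
    moreover have "h z \<le> \<bar>E\<bar> * norm (\<Psi> z) ^ 4"
    proof -
      have "h z \<le> E * ((norm (\<Psi> z))\<^sup>2)\<^sup>2" using zG f_small[of "(norm (\<Psi> z))\<^sup>2"] by (simp add: h_def)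
      also have "\<dots> \<le> \<bar>E\<bar> * ((norm (\<Psi> z))\<^sup>2)\<^sup>2" by (intro mult_right_mono) auto
      finally show ?thesis by simp
    qed
    ultimately have "h z \<le> \<bar>E\<bar> * (B * norm (z - z0)) ^ 4"
      using mult_left_mono[of "norm (\<Psi> z) ^ 4" "(B * norm (z - z0)) ^ 4" "\<bar>E\<bar>"] by simp
    then show ?thesis by (simp add: power_mult_distrib mult.assoc)
  qed
  have "B \<ge> 0" by (simp add: B_def)
  then show ?thesis
    using that[of "min \<delta>1 \<delta>2" "\<bar>E\<bar> * B ^ 4"] hz \<delta>1 \<delta>2 unfolding z0_def by simp
qed

text \<open>Only the symplectic identity at the single point \<open>\<Psi> z\<close> enters, so \<open>C\<^sup>1\<close> regularity suffices.\<close>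

lemma transport:
  assumes z: "z \<in> G"
  shows "\<Psi>' z (\<i> *s grad_h z) = (2 * f' ((norm (\<Psi> z))\<^sup>2)) *\<^sub>R (\<i> *s \<Psi> z)"
proof -
  let ?p = "\<Psi> z" and ?k = "2 * f' ((norm (\<Psi> z))\<^sup>2)"
  have p: "?p \<in> ball 0 r" by (rule \<Psi>_in[OF z])
  have lin: "linear (blinfun_apply (\<Psi>' z))" by (rule bounded_linear.linear[OF blinfun.bounded_linear_right])
  have 1: "\<Phi>' ?p (\<Psi>' z v) = v" for v
  proof -
    have d: "((\<lambda>w. \<Phi> (\<Psi> w)) has_derivative (\<lambda>v. \<Phi>' ?p (\<Psi>' z v))) (at z)"
      by (rule has_derivative_compose[OF \<Psi>_deriv[OF z] \<Phi>_deriv[OF p]])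
    have "((\<lambda>w. \<Phi> (\<Psi> w)) has_derivative (\<lambda>v. v)) (at z)"
      by (rule has_derivative_transform_within_open[OF has_derivative_ident open_G z]) (simp add: \<Phi>\<Psi>)
    from has_derivative_unique[OF d this] show ?thesis by (rule fun_cong)
  qed
  have 2: "\<Psi>' z (\<Phi>' ?p v) = v" for v
  proof -
    have d: "((\<lambda>w. \<Psi> (\<Phi> w)) has_derivative (\<lambda>v. \<Psi>' (\<Phi> ?p) (\<Phi>' ?p v))) (at ?p)"
      by (rule has_derivative_compose[OF \<Phi>_deriv[OF p] \<Psi>_deriv[OF \<Phi>_in[OF p]]])
    have "((\<lambda>w. \<Psi> (\<Phi> w)) has_derivative (\<lambda>v. v)) (at ?p)"
      by (rule has_derivative_transform_within_open[OF has_derivative_ident open_ball p]) (simp add: \<Psi>\<Phi>)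
    from has_derivative_unique[OF d this] have "\<Psi>' (\<Phi> ?p) (\<Phi>' ?p v) = v" by (rule fun_cong)
    then show ?thesis by (simp only: \<Phi>\<Psi>[OF z])
  qed
  \<comment> \<open>The extra \<i> makes the left side a value of the symplectic form; testing
    against all \<open>e\<close> uses its nondegeneracy.\<close>
  have "(\<i> *s \<Psi>' z (\<i> *s grad_h z)) \<bullet> e = (\<i> *s (?k *\<^sub>R (\<i> *s ?p))) \<bullet> e" for e
  proof -
    have "(\<i> *s \<Psi>' z (\<i> *s grad_h z)) \<bullet> e = (\<i> *s (\<i> *s grad_h z)) \<bullet> \<Phi>' ?p e"
      by (rule symplectic[OF p, of "\<Psi>' z (\<i> *s grad_h z)" e, unfolded 1, symmetric])
    also have "\<dots> = - (grad_h z \<bullet> \<Phi>' ?p e)" by (rule inner_i_i)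
    also have "grad_h z \<bullet> \<Phi>' ?p e = ?k * (?p \<bullet> e)"
      using z by (simp only: grad_h_def if_True inner_scaleR_left real_adjoint_inner[OF lin] 2)
    also have "- (?k * (?p \<bullet> e)) = (\<i> *s (\<i> *s (?k *\<^sub>R ?p))) \<bullet> e"
      by (simp only: inner_i_i inner_scaleR_left)
    also have "\<i> *s (\<i> *s (?k *\<^sub>R ?p)) = \<i> *s (?k *\<^sub>R (\<i> *s ?p))"
      by (simp only: vector_smult_scaleR)
    finally show ?thesis .
  qed
  then have "\<i> *s \<Psi>' z (\<i> *s grad_h z) = \<i> *s (?k *\<^sub>R (\<i> *s ?p))"
    by (rule vector_eq_rdot[THEN iffD1, OF allI])
  then show ?thesis by (simp only: vector_smult_inj)
qed

text \<open>In the ball the orbit preserves its norm, so the angular velocity is constant and the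
  motion is a linear rotation. As this velocity is below 2 pi, closing up after time 1 forces
  rest.\<close>

lemma orbit_stationary:
  fixes y :: "real \<Rightarrow> complex ^ 'n"
  assumes y: "\<And>t. t \<in> {0..1} \<Longrightarrow> (y has_vector_derivative \<i> *s V (y t)) (at t within {0..1})"
    and VK: "\<And>z. z \<in> K \<Longrightarrow> V z = grad_h z" and closed_orbit: "y 0 = y 1"
    and t0: "t0 \<in> {0..1}" "y t0 \<in> K"
  shows "grad_h (y t0) = 0"
proof -
  define x where "x = (\<lambda>t. \<Psi> (y t))"
  define \<rho> where "\<rho> = norm (x t0)"
  have t0G: "y t0 \<in> G" using t0 K_sub_G by auto
  have \<rho>s: "\<rho> \<le> s" using in_K_iff[OF t0G] t0 by (simp add: \<rho>_def x_def)
  show ?thesis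
  proof (cases "\<rho> = s")
    case True
    then show ?thesis by (simp add: grad_h_def \<rho>_def x_def f'_large)
  next
    case False
    then have \<rho>: "\<rho> < s" using \<rho>s by simp
    have cy: "continuous_on {0..1} y"
      unfolding continuous_on_eq_continuous_within
      by (intro ballI has_vector_derivative_continuous[OF y])
    have xder: "(x has_vector_derivative (2 * f' ((norm (x t))\<^sup>2)) *\<^sub>R (\<i> *s x t)) (at t within T)"
      if t: "t \<in> T" "T \<subseteq> {0..1}" "y t \<in> K" for t T
    proof -
      have yG: "y t \<in> G" using t K_sub_G by auto
      have "(y has_vector_derivative \<i> *s grad_h (y t)) (at t within T)"
        using has_vector_derivative_within_subset[OF y t(2), of t] t VK[OF t(3)] by auto
      then have "((\<Psi> \<circ> y) has_vector_derivative \<Psi>' (y t) (\<i> *s grad_h (y t))) (at t within T)"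
        by (rule vector_derivative_diff_chain_within)
           (rule has_derivative_at_withinI[OF \<Psi>_deriv[OF yG]])
      then show ?thesis by (simp add: transport[OF yG] x_def o_def)
    qed
    \<comment> \<open>A continuous field need not have unique solutions, so invariance of the level
      is shown by connectedness of time. Openness holds as the level lies inside \<open>K\<close>,
      where the derivative of \<open>x t \<bullet> x t\<close> vanishes.\<close>
    define S where "S = {t \<in> {0..1}. y t \<in> \<Phi> ` sphere 0 \<rho>}"
    have S_iff: "y t \<in> \<Phi> ` sphere 0 \<rho> \<longleftrightarrow> y t \<in> G \<and> norm (x t) = \<rho>" for t
    proof
      assume "y t \<in> \<Phi> ` sphere 0 \<rho>"
      then obtain p where p: "norm p = \<rho>" "y t = \<Phi> p" by auto
      then have "p \<in> ball 0 r" using \<rho> s by simp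
      then show "y t \<in> G \<and> norm (x t) = \<rho>" using p \<Phi>_in \<Psi>\<Phi> by (simp add: x_def)
    next
      assume "y t \<in> G \<and> norm (x t) = \<rho>"
      then show "y t \<in> \<Phi> ` sphere 0 \<rho>"
        by (intro image_eqI[of _ _ "x t"]) (simp_all add: x_def \<Phi>\<Psi>)
    qed
    have closedS: "closedin (top_of_set {0..1}) S"
    proof -
      have "compact (\<Phi> ` sphere 0 \<rho>)"
        using \<rho> s by (intro compact_continuous_image continuous_on_subset[OF cont_\<Phi>]) auto
      then have "closedin (top_of_set {0..1}) ({0..1} \<inter> y -` (\<Phi> ` sphere 0 \<rho>))"
        by (intro continuous_closedin_preimage cy compact_imp_closed)
      moreover have "{0..1} \<inter> y -` (\<Phi> ` sphere 0 \<rho>) = S" by (auto simp: S_def)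
      ultimately show ?thesis by simp
    qed
    have openS: "openin (top_of_set {0..1}) S"
    proof (subst openin_subopen, intro ballI)
      fix t assume tS: "t \<in> S"
      define U where "U = G \<inter> \<Psi> -` ball 0 s"
      have "open U" unfolding U_def by (intro continuous_open_preimage cont_\<Psi> open_G open_ball)
      have UK: "U \<subseteq> K" using in_K_iff by (auto simp: U_def)
      have tU: "t \<in> {0..1}" "y t \<in> U" using tS S_iff[of t] \<rho> by (auto simp: S_def U_def x_def)
      have "openin (top_of_set {0..1}) ({0..1} \<inter> y -` U)"
        using continuous_openin_preimage_gen[OF cy \<open>open U\<close>] .
      then have "\<exists>e>0. \<forall>t'\<in>{0..1}. dist t' t < e \<longrightarrow> t' \<in> {0..1} \<inter> y -` U"
        unfolding openin_euclidean_subtopology_iff using tU by blast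
      then obtain e where e: "e > 0" "\<And>t'. t' \<in> {0..1} \<Longrightarrow> dist t' t < e \<Longrightarrow> y t' \<in> U" by blast
      define T where "T = {0..1} \<inter> ball t e"
      have T: "T \<subseteq> {0..1}" "t \<in> T" "convex T" "\<And>t'. t' \<in> T \<Longrightarrow> y t' \<in> U"
        using e tU by (auto simp: T_def dist_commute intro!: convex_Int)
      have deriv: "((\<lambda>t. x t \<bullet> x t) has_vector_derivative 0) (at t' within T)" if t': "t' \<in> T" for t'
      proof -
        have "y t' \<in> K" using T(4)[OF t'] UK by auto
        from xder[OF t' T(1) this]
        have d: "(x has_derivative (\<lambda>v. v *\<^sub>R (2 * f' ((norm (x t'))\<^sup>2)) *\<^sub>R (\<i> *s x t'))) (at t' within T)"
          by (simp add: has_vector_derivative_def)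
        show ?thesis
          using has_derivative_inner[OF d d] inner_i_self[of "x t'"]
          by (simp add: has_vector_derivative_def inner_commute)
      qed
      obtain C where C: "\<And>t'. t' \<in> T \<Longrightarrow> x t' \<bullet> x t' = C"
        using has_vector_derivative_zero_constant[OF T(3) deriv] by blast
      have "T \<subseteq> S"
      proof
        fix t' assume t': "t' \<in> T"
        have "norm (x t') = norm (x t)" using C[OF t'] C[OF T(2)] by (simp add: norm_eq_sqrt_inner)
        also have "\<dots> = \<rho>" using tS S_iff[of t] by (simp add: S_def)
        finally have "y t' \<in> \<Phi> ` sphere 0 \<rho>" using T(4)[OF t'] S_iff[of t'] by (simp add: U_def)
        then show "t' \<in> S" using t' T(1) by (auto simp: S_def)
      qed
      moreover have "openin (top_of_set {0..1}) T" unfolding T_def by (simp add: openin_open_Int)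
      ultimately show "\<exists>T. openin (top_of_set {0..1}) T \<and> t \<in> T \<and> T \<subseteq> S" using T(2) by blast
    qed
    have "t0 \<in> S" using t0 t0G S_iff[of t0] by (auto simp: S_def \<rho>_def)
    moreover have "connected {0..1::real}" by simp
    ultimately have S: "S = {0..1}" using openS closedS unfolding connected_clopen by blast
    have onK: "norm (x t) = \<rho>" "y t \<in> K" if "t \<in> {0..1}" for t
    proof -
      have "y t \<in> G \<and> norm (x t) = \<rho>" using that S S_iff[of t] by (auto simp: S_def)
      then show "norm (x t) = \<rho>" "y t \<in> K" using \<rho>s in_K_iff[of "y t"] by (auto simp: x_def)
    qed
    define k where "k = 2 * f' (\<rho>\<^sup>2)"
    have xder': "(x has_vector_derivative k *\<^sub>R (\<i> *s x t)) (at t within {0..1})" if "t \<in> {0..1}" for t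
      using xder[OF that subset_refl onK(2)[OF that]] onK(1)[OF that] by (simp add: k_def)
    have k0: "k = 0 \<or> x t0 = 0"
    proof (rule ccontr)
      assume "\<not> ?thesis"
      then have k: "k \<noteq> 0" and x0: "x t0 \<noteq> 0" by auto
      have "norm (x 0) \<noteq> 0" using onK(1)[of 0] x0 by (simp add: \<rho>_def)
      then obtain i where i: "x 0 $ i \<noteq> 0" by (auto simp: vec_eq_iff)
      \<comment> \<open>An integrating factor: e^(-ikt) x_i(t) is constant, so closure gives e^(-ik)
        = 1. This makes \<open>k\<close> a multiple of 2 pi, against 0 < k < 2 pi.\<close>
      define A where "A = - (of_real k * \<i>)"
      have "((\<lambda>t. exp (t *\<^sub>R A) * x t $ i) has_vector_derivative 0) (at t within {0..1})" if t: "t \<in> {0..1}" for t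
      proof -
        have "((\<lambda>t. x t $ i) has_vector_derivative (k *\<^sub>R (\<i> *s x t)) $ i) (at t within {0..1})"
          by (rule bounded_linear.has_vector_derivative[OF bounded_linear_vec_nth xder'[OF t]])
        from has_vector_derivative_mult[OF exp_scaleR_has_vector_derivative_right this, of A]
        have "((\<lambda>t. exp (t *\<^sub>R A) * x t $ i) has_vector_derivative
          exp (t *\<^sub>R A) * (k *\<^sub>R (\<i> *s x t)) $ i + exp (t *\<^sub>R A) * A * x t $ i) (at t within {0..1})" .
        moreover have "exp (t *\<^sub>R A) * (k *\<^sub>R (\<i> *s x t)) $ i + exp (t *\<^sub>R A) * A * x t $ i = 0"
        proof -
          have "(k *\<^sub>R (\<i> *s x t)) $ i = - (A * x t $ i)"
            by (simp add: A_def scaleR_conv_of_real[where 'a=complex])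
          then show ?thesis by simp
        qed
        ultimately show ?thesis by (rule back_subst[where P = "\<lambda>D. (_ has_vector_derivative D) _"])
      qed
      then obtain C where C: "\<And>t. t \<in> {0..1} \<Longrightarrow> exp (t *\<^sub>R A) * x t $ i = C"
        using has_vector_derivative_zero_constant[of "{0..1}" "\<lambda>t. exp (t *\<^sub>R A) * x t $ i"] by auto
      have "exp A * x 0 $ i = x 0 $ i"
        using C[of 0] C[of 1] closed_orbit by (simp add: x_def)
      then have "exp A = 1" using i by simp
      from exp_eq_1[THEN iffD1, OF this, THEN conjunct2]
      obtain n :: int where "Im A = of_int (2 * n) * pi" ..
      moreover have "Im A = - (2 * f' (\<rho>\<^sup>2))" by (simp add: A_def k_def)
      moreover have "real_of_int (2 * n) = - 2 * real_of_int (- n)" by simp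
      ultimately have n: "f' (\<rho>\<^sup>2) = real_of_int (- n) * pi" by (simp only:)
      have "f' (\<rho>\<^sup>2) \<noteq> 0" using k by (simp add: k_def)
      with f'_nonneg[of "\<rho>\<^sup>2"] have "0 < f' (\<rho>\<^sup>2)" by linarith
      then have "0 < real_of_int (- n)" unfolding n by (rule zero_less_mult_pos2[OF _ pi_gt_zero])
      then have "0 < - n" by (simp only: of_int_0_less_iff)
      moreover have "real_of_int (- n) * pi < 1 * pi" using f'_less[of "\<rho>\<^sup>2"] unfolding n mult_1 .
      then have "real_of_int (- n) < 1" by (rule mult_less_cancel_right_pos[OF pi_gt_zero, THEN iffD1])
      then have "- n < 1" by (simp only: of_int_less_1_iff)
      ultimately show False by linarith
    qed
    from k0 show ?thesis
    proof
      assume "k = 0"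
      then have "f' ((norm (\<Psi> (y t0)))\<^sup>2) = 0" by (simp add: k_def \<rho>_def x_def)
      then show ?thesis by (simp add: grad_h_def)
    next
      assume "x t0 = 0"
      then have "\<Psi> (y t0) = 0" by (simp add: x_def)
      then show ?thesis by (simp add: grad_h_def real_adjoint_def)
    qed
  qed
qed

end

section \<open>Nonsqueezing\<close>

lemma outer_deriv:
  assumes w: "w > 0"
  shows "((\<lambda>z. a * soft_ramp w (z \<bullet> aniso m d z - q)) has_derivative
    (\<lambda>v. ((2 * a * ramp ((z \<bullet> aniso m d z - q) / w)) *\<^sub>R aniso m d z) \<bullet> v)) (at z)"
proof -
  have "(aniso m d has_derivative aniso m d) (at z)"
    by (rule bounded_linear_imp_has_derivative[OF bounded_linear_aniso])
  from has_derivative_inner[OF has_derivative_ident this]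
  have "((\<lambda>z. z \<bullet> aniso m d z) has_derivative (\<lambda>v. z \<bullet> aniso m d v + v \<bullet> aniso m d z)) (at z)" .
  then have "((\<lambda>z. z \<bullet> aniso m d z - q) has_derivative (\<lambda>v. z \<bullet> aniso m d v + v \<bullet> aniso m d z - 0)) (at z)"
    by (rule has_derivative_diff[OF _ has_derivative_const])
  moreover have "z \<bullet> aniso m d v + v \<bullet> aniso m d z - 0 = 2 * (aniso m d z \<bullet> v)" for v
    by (simp add: inner_aniso_swap[of z m d v] inner_commute)
  ultimately have q: "((\<lambda>z. z \<bullet> aniso m d z - q) has_derivative (\<lambda>v. 2 * (aniso m d z \<bullet> v))) (at z)"
    by (simp only:)
  have "((\<lambda>t. a * soft_ramp w t) has_derivative (*) (a * ramp ((z \<bullet> aniso m d z - q) / w))) (at (z \<bullet> aniso m d z - q))"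
    using DERIV_cmult[OF DERIV_soft_ramp[OF w]] unfolding has_field_derivative_def by blast
  from has_derivative_compose[OF q this] show ?thesis by (simp add: mult_ac)
qed

text \<open>The Legendre bound: beyond its own value, the outer Hamiltonian contributes at most
  \<open>a * (q + w / 2)\<close> to the action. A plateau of at least that height makes the total
  density nonpositive.\<close>

lemma outer_negative:
  assumes w: "w > 0" and q: "0 \<le> q" and a: "0 \<le> a"
  shows "(1 / 2) * (((2 * a * ramp ((z \<bullet> aniso m d z - q) / w)) *\<^sub>R aniso m d z) \<bullet> z)
    \<le> a * (q + w / 2) + a * soft_ramp w (z \<bullet> aniso m d z - q)"
proof -
  define t where "t = z \<bullet> aniso m d z - q"
  have "ramp (t / w) * t \<le> soft_ramp w t + w / 2" by (rule soft_ramp_legendre[OF w])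
  moreover have "ramp (t / w) * q \<le> 1 * q" by (rule mult_right_mono[OF ramp_bounds(2) q])
  ultimately have "ramp (t / w) * (t + q) \<le> soft_ramp w t + w / 2 + q" by (simp add: distrib_left)
  then have "a * (ramp (t / w) * (t + q)) \<le> a * (soft_ramp w t + w / 2 + q)" using a by (rule mult_left_mono)
  moreover have "aniso m d z \<bullet> z = t + q" by (simp add: t_def inner_commute)
  ultimately show ?thesis unfolding t_def[symmetric] by (simp add: algebra_simps)
qed

text \<open>Here \<open>R < s\<close> is turned into slopes on both sides of pi. The last equation
  matches the climb of the inner profile with the height that the outer Hamiltonian
  requires.\<close>

lemma slope_constants:
  fixes R s :: real
  assumes "0 < R" "R < s"
  obtains \<theta> a c where "0 < \<theta>" "0 < s\<^sup>2 - \<theta>" "pi < a" "a \<le> 3 * pi / 2" "0 < c" "c < pi"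
    "c * (s\<^sup>2 - \<theta>) = a * (R\<^sup>2 + 2 * \<theta>)"
proof -
  \<comment> \<open>With eighths, \<open>s\<^sup>2 - \<theta>\<close> is
    \<open>R\<^sup>2 + 7 * \<theta>\<close>, still above
    \<open>R\<^sup>2 + 2 * \<theta>\<close>.\<close>
  define \<theta> where "\<theta> = (s\<^sup>2 - R\<^sup>2) / 8"
  have "R\<^sup>2 < s\<^sup>2" using assms by (intro power_strict_mono) auto
  then have \<theta>: "0 < \<theta>" by (simp add: \<theta>_def)
  define A B where "A = R\<^sup>2 + 2 * \<theta>" and "B = s\<^sup>2 - \<theta>"
  have "s\<^sup>2 = R\<^sup>2 + 8 * \<theta>" by (simp add: \<theta>_def field_simps)
  then have AB: "0 < A" "A < B" using assms \<theta> by (auto simp: A_def B_def add_pos_pos)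
  define x where "x = B / A - 1"
  \<comment> \<open>Half of the relative excess of \<open>B\<close> over \<open>A\<close> keeps
    \<open>c\<close> below pi; the cap \<open>1 / 2\<close> keeps \<open>a\<close> at most
    \<open>3 * pi / 2\<close>.\<close>
  define \<mu> where "\<mu> = min (1 / 2) (x / 2)"
  have x: "0 < x" using AB by (simp add: x_def)
  then have \<mu>: "0 < \<mu>" by (simp add: \<mu>_def)
  have \<mu>': "\<mu> \<le> 1 / 2" "\<mu> \<le> x / 2" unfolding \<mu>_def by (rule min.cobounded1, rule min.cobounded2)
  then have "1 + \<mu> < 1 + x" using x by linarith
  then have "1 + \<mu> < B / A" by (simp add: x_def)
  then have lt: "(1 + \<mu>) * A < B" using AB by (simp add: less_divide_eq)
  show ?thesis
  proof (rule that[of \<theta> "pi * (1 + \<mu>)" "pi * ((1 + \<mu>) * A) / B"])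
    show "0 < s\<^sup>2 - \<theta>" using AB unfolding B_def by linarith
    show "pi < pi * (1 + \<mu>)" using \<mu> by simp
    have "pi * (1 + \<mu>) \<le> pi * (3 / 2)" using \<mu>' by (intro mult_left_mono) auto
    then show "pi * (1 + \<mu>) \<le> 3 * pi / 2" by simp
    show "0 < pi * ((1 + \<mu>) * A) / B" using \<mu> AB by (intro divide_pos_pos mult_pos_pos) auto
    show "pi * ((1 + \<mu>) * A) / B < pi" using lt AB by (simp add: divide_less_eq)
    show "pi * ((1 + \<mu>) * A) / B * (s\<^sup>2 - \<theta>) = pi * (1 + \<mu>) * (R\<^sup>2 + 2 * \<theta>)"
      using AB unfolding A_def[symmetric] B_def[symmetric] by simp
  qed (rule \<theta>)
qed

text \<open>At distance at least \<open>\<delta>\<close> from \<open>p\<close>, constants and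
  squares are dominated by fourth powers, so quadratic growth suffices there.\<close>

lemma quartic_bound:
  fixes H :: "'a::real_normed_vector \<Rightarrow> real"
  assumes near: "\<delta> > 0" "\<And>z. norm (z - p) < \<delta> \<Longrightarrow> H z \<le> C * norm (z - p) ^ 4"
    and far: "\<And>z. H z \<le> b + a * (norm z)\<^sup>2" and "0 \<le> C" "0 \<le> a" "0 \<le> b"
  obtains E where "\<And>z. H z \<le> E * norm (z - p) ^ 4"
proof -
  define e where "e = b + 2 * a * (norm p)\<^sup>2"
  define E where "E = C + (e / \<delta> ^ 4 + 2 * a / \<delta>\<^sup>2)"
  have e: "0 \<le> e" using assms by (simp add: e_def)
  have E0: "0 \<le> e / \<delta> ^ 4 + 2 * a / \<delta>\<^sup>2" using assms e by simp
  have "H z \<le> E * norm (z - p) ^ 4" for z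
  proof (cases "norm (z - p) < \<delta>")
    case True
    have "C * norm (z - p) ^ 4 \<le> E * norm (z - p) ^ 4"
      by (rule mult_right_mono) (use E0 in \<open>simp_all add: E_def\<close>)
    then show ?thesis using near(2)[OF True] by linarith
  next
    case False
    define x where "x = norm (z - p)"
    have x: "\<delta> \<le> x" "0 \<le> x" using False by (auto simp: x_def)
    have "(norm z)\<^sup>2 \<le> (x + norm p)\<^sup>2"
      using norm_triangle_sub[of z p] by (intro power_mono) (auto simp: x_def)
    also have "\<dots> \<le> 2 * x\<^sup>2 + 2 * (norm p)\<^sup>2"
      using zero_le_power2[of "x - norm p"] by (simp add: power2_sum power2_diff)
    finally have "a * (norm z)\<^sup>2 \<le> a * (2 * x\<^sup>2 + 2 * (norm p)\<^sup>2)" using assms by (intro mult_left_mono)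
    then have "H z \<le> e + 2 * a * x\<^sup>2" using far[of z] by (simp add: e_def algebra_simps)
    also have "e \<le> e / \<delta> ^ 4 * x ^ 4"
    proof -
      have "\<delta> ^ 4 \<le> x ^ 4" using x near(1) by (intro power_mono) auto
      then have "e * \<delta> ^ 4 \<le> e * x ^ 4" using e by (intro mult_left_mono)
      then show ?thesis using near(1) by (simp add: field_simps)
    qed
    also have "2 * a * x\<^sup>2 \<le> 2 * a / \<delta>\<^sup>2 * x ^ 4"
    proof -
      have "\<delta>\<^sup>2 \<le> x\<^sup>2" using x near(1) by (intro power_mono) auto
      then have "(2 * a * x\<^sup>2) * \<delta>\<^sup>2 \<le> (2 * a * x\<^sup>2) * x\<^sup>2" using assms by (intro mult_left_mono) auto
      then have "2 * a * x\<^sup>2 \<le> (2 * a * x\<^sup>2) * x\<^sup>2 / \<delta>\<^sup>2" using near(1) by (simp add: le_divide_eq)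
      also have "\<dots> = 2 * a / \<delta>\<^sup>2 * x ^ 4" by (simp add: power2_eq_square power4_eq_xxxx)
      finally show ?thesis .
    qed
    finally have "H z \<le> (e / \<delta> ^ 4 + 2 * a / \<delta>\<^sup>2) * x ^ 4" by (simp add: distrib_right)
    also have "\<dots> \<le> E * x ^ 4"
      by (rule mult_right_mono) (use assms in \<open>simp_all add: E_def\<close>)
    finally show ?thesis by (simp add: x_def)
  qed
  then show ?thesis using that by blast
qed

theorem corollary3p2:
  fixes k :: "'n::finite"
    and G :: "(complex ^ 'n) set"
    and \<Phi> :: "complex ^ 'n \<Rightarrow> complex ^ 'n"
    and r R :: real
  assumes "R > 0"
    and "is_domain G" and "G \<subseteq> disc_cylinder k R"
    and "r > 0"
    and "C1_diffeomorphism (ball 0 r) G \<Phi>"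
    and "\<forall>p\<in>ball 0 r. pullback \<Phi> std_symplectic p = std_symplectic p"
  shows "r \<le> R"
proof (rule ccontr)
  assume "\<not> r \<le> R"
  define s where "s = (R + r) / 2"
  have s: "R < s" "s < r" "0 < s" using \<open>\<not> r \<le> R\<close> assms(1) by (auto simp: s_def)
  obtain \<theta> a c where cst: "0 < \<theta>" "0 < s\<^sup>2 - \<theta>" "pi < a" "a \<le> 3 * pi / 2" "0 < c" "c < pi"
    "c * (s\<^sup>2 - \<theta>) = a * (R\<^sup>2 + 2 * \<theta>)"
    using slope_constants[OF assms(1) s(1)] by blast
  have a0: "0 < a" using cst(3) pi_gt_zero by linarith
  \<comment> \<open>A climb of length \<open>s\<^sup>2 - \<theta>\<close> and a bend of width
    \<open>\<theta>\<close> make the profile constant from \<open>s\<^sup>2\<close> on.\<close>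
  obtain f f' E where f: "\<And>\<rho>. (f has_real_derivative f' \<rho>) (at \<rho>)" "continuous_on UNIV f'"
    "\<And>\<rho>. 0 \<le> f' \<rho>" "\<And>\<rho>. f' \<rho> \<le> c" "\<And>\<rho>. 0 \<le> f \<rho>" "\<And>\<rho>. 0 \<le> \<rho> \<Longrightarrow> f \<rho> \<le> E * \<rho>\<^sup>2"
    "\<And>\<rho>. f \<rho> \<le> c * (s\<^sup>2 - \<theta>)"
    "\<And>\<rho>. (s\<^sup>2 - \<theta>) + \<theta> \<le> \<rho> \<Longrightarrow> f \<rho> = c * (s\<^sup>2 - \<theta>)" "\<And>\<rho>. (s\<^sup>2 - \<theta>) + \<theta> \<le> \<rho> \<Longrightarrow> f' \<rho> = 0"
    using profile[OF cst(1,2,5)] by blast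
  define \<Psi> where "\<Psi> = inv_into (ball 0 r) \<Phi>"
  have bij: "bij_betw \<Phi> (ball 0 r) G" and C1: "C1_on (ball 0 r) \<Phi>" "C1_on G \<Psi>"
    using assms(5) by (auto simp: C1_diffeomorphism_def \<Psi>_def)
  obtain \<Phi>' where \<Phi>': "\<And>p. p \<in> ball 0 r \<Longrightarrow> (\<Phi> has_derivative blinfun_apply (\<Phi>' p)) (at p)"
    using C1(1) unfolding C1_on_def by blast
  obtain \<Psi>' where \<Psi>': "\<And>z. z \<in> G \<Longrightarrow> (\<Psi> has_derivative blinfun_apply (\<Psi>' z)) (at z)" "continuous_on G \<Psi>'"
    using C1(2) unfolding C1_on_def by blast
  interpret S: symplectic_ball r s \<Phi> \<Psi> \<Phi>' \<Psi>' G f f' E "c * (s\<^sup>2 - \<theta>)"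
  proof
    show "open G" using assms(2) by (simp add: is_domain_def)
    show "\<Phi> p \<in> G" if "p \<in> ball 0 r" for p by (rule bij_betw_apply[OF bij that])
    show "\<Psi> z \<in> ball 0 r" if "z \<in> G" for z
      unfolding \<Psi>_def by (rule bij_betw_apply[OF bij_betw_inv_into[OF bij] that])
    show "\<Psi> (\<Phi> p) = p" if "p \<in> ball 0 r" for p
      unfolding \<Psi>_def by (rule bij_betw_inv_into_left[OF bij that])
    show "\<Phi> (\<Psi> z) = z" if "z \<in> G" for z
      unfolding \<Psi>_def by (rule bij_betw_inv_into_right[OF bij that])
    show "(\<i> *s \<Phi>' p u) \<bullet> \<Phi>' p v = (\<i> *s u) \<bullet> v" if p: "p \<in> ball 0 r" for p u v
    proof -
      have "pullback \<Phi> std_symplectic p u v = std_symplectic p u v" using assms(6) p by simp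
      then show ?thesis
        unfolding pullback_def frechet_derivative_at[OF \<Phi>'[OF p], symmetric] std_symplectic_eq .
    qed
    show "f' \<rho> < pi" for \<rho> using f(4)[of \<rho>] cst(6) by linarith
    show "f \<rho> = c * (s\<^sup>2 - \<theta>)" "f' \<rho> = 0" if "s\<^sup>2 \<le> \<rho>" for \<rho>
      using that f(8,9)[of \<rho>] by simp_all
  qed (use s f \<Phi>' \<Psi>' in simp_all)
  have "bounded S.K" by (rule compact_imp_bounded[OF S.compact_K])
  then obtain L where L: "0 < L" "\<And>z. z \<in> S.K \<Longrightarrow> norm z \<le> L" unfolding bounded_pos by blast
  \<comment> \<open>The second entry keeps the contribution of the other coordinates to
    \<open>q\<close> below \<open>\<theta>\<close> on \<open>K\<close>; the first is for the
    spectral gap.\<close>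
  define d where "d = min (1 / 4) (\<theta> / (L\<^sup>2 + 1))"
  have L1: "0 < L\<^sup>2 + 1" by (simp add: add_nonneg_pos)
  have "0 < d" using cst(1) L1 by (simp add: d_def)
  moreover have "d \<le> 1 / 4" "d \<le> \<theta> / (L\<^sup>2 + 1)" unfolding d_def by (rule min.cobounded1, rule min.cobounded2)
  ultimately have d: "0 < d" "d \<le> 1 / 4" "d \<le> \<theta> / (L\<^sup>2 + 1)" .
  have dL: "d * L\<^sup>2 < \<theta>"
  proof -
    have "d * (L\<^sup>2 + 1) \<le> \<theta>" using d(3) L1 by (simp add: le_divide_eq)
    then show ?thesis using d(1) by (simp add: distrib_left)
  qed
  define q where "q = (\<lambda>z. z \<bullet> aniso k d z)"
  define q\<^sub>0 where "q\<^sub>0 = R\<^sup>2 + \<theta>"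
  have q\<^sub>0: "0 \<le> q\<^sub>0" using cst(1) by (simp add: q\<^sub>0_def)
  have qK: "q z < q\<^sub>0" if z: "z \<in> S.K" for z
  proof -
    have "z $ k \<in> ball 0 R" using S.K_sub_G assms(3) z by (auto simp: disc_cylinder_def)
    then have zk: "(cmod (z $ k))\<^sup>2 \<le> R\<^sup>2" by (intro power_mono) auto
    have "q z \<le> (\<Sum>i\<in>UNIV. (if i = k then (cmod (z $ k))\<^sup>2 else 0) + d * (cmod (z $ i))\<^sup>2)"
      unfolding q_def inner_aniso using d(1) by (intro sum_mono) auto
    also have "\<dots> = (cmod (z $ k))\<^sup>2 + d * (norm z)\<^sup>2"
      by (simp add: sum.distrib norm_vec_sq sum_distrib_left)
    also have "d * (norm z)\<^sup>2 \<le> d * L\<^sup>2" using L(2)[OF z] d(1) by (intro mult_left_mono power_mono) auto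
    finally show ?thesis using zk dL by (simp add: q\<^sub>0_def)
  qed
  \<comment> \<open>It vanishes for \<open>q z \<le> q\<^sub>0\<close>, in particular on
    \<open>K\<close>, so the dynamics on \<open>K\<close> are those of \<open>S.h\<close>
    alone.\<close>
  define h\<^sub>2 where "h\<^sub>2 = (\<lambda>z. a * soft_ramp \<theta> (q z - q\<^sub>0))"
  define V\<^sub>2 where "V\<^sub>2 = (\<lambda>z. (2 * a * ramp ((q z - q\<^sub>0) / \<theta>)) *\<^sub>R aniso k d z)"
  define H where "H = (\<lambda>z. S.h z + h\<^sub>2 z)"
  define V where "V = (\<lambda>z. S.grad_h z + V\<^sub>2 z)"
  define W where "W = (\<lambda>z. S.grad_h z + (2 * a * (ramp ((q z - q\<^sub>0) / \<theta>) - 1)) *\<^sub>R aniso k d z)"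
  have h2_0: "0 \<le> h\<^sub>2 z" for z using soft_ramp_nonneg[OF cst(1)] a0 by (simp add: h\<^sub>2_def)
  have small_q: "h\<^sub>2 z = 0" "V\<^sub>2 z = 0" if "q z \<le> q\<^sub>0" for z
  proof -
    have "(q z - q\<^sub>0) / \<theta> \<le> 0" using that cst(1) by (simp add: divide_nonpos_pos)
    then show "h\<^sub>2 z = 0" "V\<^sub>2 z = 0" using that cst(1) by (simp_all add: h\<^sub>2_def V\<^sub>2_def soft_ramp_nonpos ramp_def)
  qed
  have q_cont: "continuous_on UNIV q"
    unfolding q_def by (intro continuous_intros linear_continuous_on bounded_linear_aniso)
  have q_le: "q z \<le> (norm z)\<^sup>2" for z unfolding q_def using d by (intro inner_aniso_le) auto
  have VW: "V z = (2 * a) *\<^sub>R aniso k d z + W z" for z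
    by (simp add: V_def W_def V\<^sub>2_def algebra_simps)
  define p where "p = \<Phi> 0"
  have pK: "p \<in> S.K" unfolding S.K_def p_def using s by (intro imageI) simp
  obtain e C where e: "e > 0" "C \<ge> 0" "\<And>z. norm (z - p) < e \<Longrightarrow> S.h z \<le> C * norm (z - p) ^ 4"
    using S.h_small unfolding p_def by blast
  \<comment> \<open>The outer term vanishes near \<open>p\<close>, so the quartic behaviour of
    \<open>S.h\<close> there is that of \<open>H\<close>.\<close>
  have "open {z. q z < q\<^sub>0}" by (intro open_Collect_less q_cont continuous_on_const)
  then obtain e' where e': "e' > 0" "\<And>z. dist z p < e' \<Longrightarrow> q z < q\<^sub>0"
    using qK[OF pK] unfolding open_dist by blast
  have near: "H z \<le> C * norm (z - p) ^ 4" if "norm (z - p) < min e e'" for z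
    using e(3)[of z] e'(2)[of z] small_q(1)[of z] that by (simp add: H_def dist_norm)
  have far: "H z \<le> c * (s\<^sup>2 - \<theta>) + a * (norm z)\<^sup>2" for z
  proof -
    have "soft_ramp \<theta> (q z - q\<^sub>0) \<le> max 0 (q z - q\<^sub>0)" by (rule soft_ramp_le[OF cst(1)])
    also have "\<dots> \<le> (norm z)\<^sup>2" using q_le[of z] q\<^sub>0 by simp
    finally have "h\<^sub>2 z \<le> a * (norm z)\<^sup>2" unfolding h\<^sub>2_def using a0 by (intro mult_left_mono) auto
    then show ?thesis using S.h_le[of z] by (simp add: H_def)
  qed
  have "0 < min e e'" using e e' by simp
  moreover have "0 \<le> c * (s\<^sup>2 - \<theta>)" using cst by simp
  ultimately obtain C4 where C4: "\<And>z. H z \<le> C4 * norm (z - p) ^ 4"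
    using quartic_bound[of "min e e'" p H C "c * (s\<^sup>2 - \<theta>)" a] near far e(2) a0 by (metis less_imp_le)
  \<comment> \<open>Beyond this radius a point is outside \<open>K\<close>. The summand 1 allows
    passing from the norm to its square, so that \<open>q z \<ge> q\<^sub>0 + \<theta>\<close> and
    the ramp is saturated. The constant \<open>a * (q\<^sub>0 + \<theta> / 2)\<close> is the offset
    of \<open>soft_ramp\<close> past its bend.\<close>
  interpret A: asymptotically_quadratic k d a "L + (q\<^sub>0 + \<theta>) / d + 1" "a * (q\<^sub>0 + \<theta> / 2)" C4 H V W p
  proof
    show "(H has_derivative (\<lambda>v. V z \<bullet> v)) (at z)" for z
      unfolding H_def V_def h\<^sub>2_def V\<^sub>2_def q_def inner_add_left
      by (intro has_derivative_add S.h_deriv outer_deriv cst(1))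
    show "continuous_on UNIV W"
      unfolding W_def ramp_def using cst(1)
      by (intro continuous_intros S.grad_h_cont q_cont linear_continuous_on bounded_linear_aniso) auto
    show "W z = 0" if z: "L + (q\<^sub>0 + \<theta>) / d + 1 < norm z" for z
    proof -
      have qd: "0 \<le> (q\<^sub>0 + \<theta>) / d" using q\<^sub>0 cst(1) d(1) by simp
      then have "z \<notin> S.K" using L(2)[of z] z by fastforce
      then have grad_h: "S.grad_h z = 0" by (rule S.outside_K)
      have z1: "1 \<le> norm z" "(q\<^sub>0 + \<theta>) / d \<le> norm z" using z L(1) qd by linarith+
      then have "(q\<^sub>0 + \<theta>) / d \<le> (norm z)\<^sup>2"
        using mult_right_mono[of 1 "norm z" "norm z"] by (simp add: power2_eq_square)
      then have "q\<^sub>0 + \<theta> \<le> d * (norm z)\<^sup>2" using d(1) by (simp add: divide_le_eq mult.commute)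
      also have "\<dots> \<le> q z" unfolding q_def using d by (intro inner_aniso_ge) auto
      finally have "1 \<le> (q z - q\<^sub>0) / \<theta>" using cst(1) by (simp add: le_divide_eq)
      then show ?thesis by (simp add: W_def grad_h ramp_def)
    qed
    show "a * (z \<bullet> aniso k d z) - a * (q\<^sub>0 + \<theta> / 2) \<le> H z" for z
    proof -
      have "a * (q z - q\<^sub>0 - \<theta> / 2) \<le> h\<^sub>2 z"
        unfolding h\<^sub>2_def using a0 by (intro mult_left_mono soft_ramp_ge cst(1)) auto
      then show ?thesis using S.h_nonneg[of z] by (simp add: H_def q_def algebra_simps)
    qed
    show "0 \<le> H z" for z using S.h_nonneg[of z] h2_0[of z] by (simp add: H_def)
    show "V z = (2 * a) *\<^sub>R aniso k d z + W z" for z by (rule VW)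
    show "H z \<le> C4 * norm (z - p) ^ 4" for z by (rule C4)
  qed (use d cst in simp_all)
  obtain y t where y: "y 0 = y 1" "t \<in> {0..1::real}" "H (y t) < (1 / 2) * (V (y t) \<bullet> y t)"
    "\<And>s. s \<in> {0..1} \<Longrightarrow> (y has_vector_derivative \<i> *s V (y s)) (at s within {0..1})"
    using A.periodic_orbit by blast
  have VK: "V z = S.grad_h z" if "z \<in> S.K" for z using small_q(2)[of z] qK[OF that] by (simp add: V_def)
  show False
  proof (cases "y t \<in> S.K")
    case True
    \<comment> \<open>At a rest point the density is \<open>- H (y t)\<close>, which cannot be
      positive.\<close>
    then have "V (y t) = 0"
      using S.orbit_stationary[OF y(4) VK y(1,2) True] VK[OF True] by simp
    then show False using y(3) A.H_nonneg[of "y t"] by simp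
  next
    case False
    have "(1 / 2) * (V (y t) \<bullet> y t) \<le> a * (q\<^sub>0 + \<theta> / 2) + h\<^sub>2 (y t)"
      using outer_negative[OF cst(1) q\<^sub>0, of a "y t" k d] a0
      by (simp add: V_def S.outside_K[OF False] V\<^sub>2_def h\<^sub>2_def q_def)
    \<comment> \<open>The left side is \<open>a * (R\<^sup>2 + 3 / 2 * \<theta>)\<close>; the right
      side is the plateau height of \<open>S.h\<close> by the choice of \<open>c\<close>.\<close>
    also have "a * (q\<^sub>0 + \<theta> / 2) \<le> a * (R\<^sup>2 + 2 * \<theta>)"
      using a0 cst(1) by (intro mult_left_mono) (auto simp: q\<^sub>0_def)
    finally have "(1 / 2) * (V (y t) \<bullet> y t) \<le> a * (R\<^sup>2 + 2 * \<theta>) + h\<^sub>2 (y t)" by simp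
    moreover have "H (y t) = a * (R\<^sup>2 + 2 * \<theta>) + h\<^sub>2 (y t)"
      unfolding cst(7)[symmetric] by (simp only: H_def S.outside_K[OF False])
    ultimately show False using y(3) by linarith
  qed
qed

end
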